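(* There exist absolute constants $c_4\in(0,1)$, $c>0$ and $C>0$ such that the following holds for all integers $d,n\ge 1$. Suppose $0<\alpha\le c_4$, $0<\varepsilon\le 1$ and $0\le\delta\le \varepsilon^2/d^2$. Let $M$ be an $(\varepsilon,\delta)$-differentially private mechanism that takes as input $X=\{X_1,\dots,X_n\}$ with each $X_i\in\mathbb{R}^d$ and outputs a $d\times d$ real matrix. Suppose that for every positive definite $d\times d$ matrix $\Sigma$, if $X_1,\dots,X_n$ are drawn i.i.d. from $\mathcal{N}(0,\Sigma)$, then with probability at least $2/3$ over the randomness of $M$ and $X_1,\dots,X_n$, $$(1-\alpha)\Sigma\preccurlyeq M(X)\preccurlyeq(1+\alpha)\Sigma .$$ Then $n\ge\tilde\Omega\left(\frac{d}{\alpha^2}+\frac{d^{3/2}}{\alpha\varepsilon}\right)$, that is, $$n\ \ge\ \frac{c}{\left(\log\left(2+\frac{d}{\alpha\varepsilon}\right)\right)^{C}}\left(\frac{d}{\alpha^2}+\frac{d^{3/2}}{\alpha\,\varepsilon}\right).$$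
   Context: A randomized algorithm $M:\mathcal{X}^n\to\mathcal{O}$ is $(\varepsilon,\delta)$-differentially private if for any two datasets $\mathbf{X},\mathbf{X}'\in\mathcal{X}^n$ that differ in only a single data point and any (measurable) $O\subset\mathcal{O}$, $\mathbb{P}[M(\mathbf{X}')\in O]\le e^{\varepsilon}\,\mathbb{P}[M(\mathbf{X})\in O]+\delta$. The symbol $\preccurlyeq$ is the Loewner order on symmetric matrices: $A\preccurlyeq B$ iff $B-A$ is positive semidefinite. *)

theory Defs
  imports
    "HOL-Probability.Probability"
    "Jordan_Normal_Form.Gauss_Jordan_Elimination"
    "Jordan_Normal_Form.Determinant"
begin

text \<open>
  The dimension is quantified inside the statement, so it cannot be a type. The measurable spaces of
  \<open>d\<close>-vectors and of \<open>d \<times> d\<close> matrices are the finite products \<open>\<Pi>\<^sub>M\<close> of the Borel space of the reals,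
  whose points are extensional functions on the index set; \<open>Matrix.vec d\<close> and \<open>Matrix.mat d d\<close> turn
  such points into vectors and matrices.
\<close>

abbreviation borel_vec :: "nat \<Rightarrow> (nat \<Rightarrow> real) measure" where
  "borel_vec d \<equiv> (\<Pi>\<^sub>M i\<in>{..<d}. borel)"

abbreviation borel_mat :: "nat \<Rightarrow> (nat \<times> nat \<Rightarrow> real) measure" where
  "borel_mat d \<equiv> (\<Pi>\<^sub>M ij\<in>{..<d} \<times> {..<d}. borel)"

definition symmetric_mat :: "nat \<Rightarrow> real mat \<Rightarrow> bool" where
  "symmetric_mat d A \<longleftrightarrow> A \<in> carrier_mat d d \<and> transpose_mat A = A"

definition psd_mat :: "nat \<Rightarrow> real mat \<Rightarrow> bool" where
  "psd_mat d A \<longleftrightarrow> symmetric_mat d A \<and>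
     (\<forall>v\<in>carrier_vec d. 0 \<le> Matrix.scalar_prod v (A *\<^sub>v v))"

definition pos_def_mat :: "nat \<Rightarrow> real mat \<Rightarrow> bool" where
  "pos_def_mat d A \<longleftrightarrow> symmetric_mat d A \<and>
     (\<forall>v\<in>carrier_vec d. v \<noteq> 0\<^sub>v d \<longrightarrow> 0 < Matrix.scalar_prod v (A *\<^sub>v v))"

definition loewner_le :: "nat \<Rightarrow> real mat \<Rightarrow> real mat \<Rightarrow> bool" where
  "loewner_le d A B \<longleftrightarrow> symmetric_mat d A \<and> symmetric_mat d B \<and> psd_mat d (B - A)"

text \<open>
  The centred normal distribution \<open>N(0, S)\<close>, given by its density with respect to Lebesgue measure.
  Only meaningful for positive definite \<open>S\<close>, for which \<open>mat_inverse S\<close> is \<open>Some\<close> of the inverse.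
\<close>

definition mvn_density :: "nat \<Rightarrow> real mat \<Rightarrow> (nat \<Rightarrow> real) \<Rightarrow> real" where
  "mvn_density d S x =
     exp (- Matrix.scalar_prod (Matrix.vec d x) (the (mat_inverse S) *\<^sub>v Matrix.vec d x) / 2)
       / sqrt ((2 * pi) ^ d * Determinant.det S)"

definition mvn :: "nat \<Rightarrow> real mat \<Rightarrow> (nat \<Rightarrow> real) measure" where
  "mvn d S = density (\<Pi>\<^sub>M i\<in>{..<d}. lborel) (\<lambda>x. ennreal (mvn_density d S x))"

text \<open>
  A randomized algorithm on datasets of \<open>n\<close> points of \<open>D\<close> with output in \<open>Q\<close> is a Markov kernel;
  datasets are ordered \<open>n\<close>-tuples.
\<close>

definition mechanism ::
  "nat \<Rightarrow> 'a measure \<Rightarrow> 'b measure \<Rightarrow> ((nat \<Rightarrow> 'a) \<Rightarrow> 'b measure) \<Rightarrow> bool" where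
  "mechanism n D Q M \<longleftrightarrow> M \<in> (\<Pi>\<^sub>M i\<in>{..<n}. D) \<rightarrow>\<^sub>M prob_algebra Q"

definition neighbouring :: "nat \<Rightarrow> (nat \<Rightarrow> 'a) \<Rightarrow> (nat \<Rightarrow> 'a) \<Rightarrow> bool" where
  "neighbouring n X X' \<longleftrightarrow> card {i \<in> {..<n}. X i \<noteq> X' i} = 1"

definition diff_private ::
  "nat \<Rightarrow> 'a measure \<Rightarrow> 'b measure \<Rightarrow> real \<Rightarrow> real \<Rightarrow> ((nat \<Rightarrow> 'a) \<Rightarrow> 'b measure) \<Rightarrow> bool" where
  "diff_private n D Q \<epsilon> \<delta> M \<longleftrightarrow>
     mechanism n D Q M \<and>
     (\<forall>X\<in>space (\<Pi>\<^sub>M i\<in>{..<n}. D). \<forall>X'\<in>space (\<Pi>\<^sub>M i\<in>{..<n}. D). neighbouring n X X' \<longrightarrow>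
        (\<forall>E\<in>sets Q. measure (M X') E \<le> exp \<epsilon> * measure (M X) E + \<delta>))"

text \<open>The law of \<open>M(X)\<close>, over the joint randomness of \<open>M\<close> and of \<open>X\<close> drawn i.i.d. from \<open>P\<close>.\<close>

definition output_law ::
  "nat \<Rightarrow> 'a measure \<Rightarrow> ((nat \<Rightarrow> 'a) \<Rightarrow> 'b measure) \<Rightarrow> 'b measure" where
  "output_law n P M = (\<Pi>\<^sub>M i\<in>{..<n}. P) \<bind> M"

end

theory Submission
  imports Defs
begin

text \<open>
  The hard covariance matrices come from a linear regression. Let \<open>m = d div 2\<close>, let \<open>B\<close> be an
  \<open>m \<times> m\<close> matrix, and split a sample as \<open>x = (y, z, rest)\<close>, where \<open>y\<close> and \<open>rest\<close> are standard normal and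
  \<open>z = B y + w\<close> with standard normal noise \<open>w\<close>. The covariance of \<open>x\<close> is \<open>L L\<^sup>T\<close> with \<open>L\<close> lower triangular,
  unit diagonal and one further block \<open>B\<close>. Hence every real \<open>B\<close> is allowed, the determinant is 1,
  the density is an explicit product of normal densities, and \<open>B\<close> is the block of the covariance in the
  rows of \<open>z\<close> and the columns of \<open>y\<close>. A Loewner approximation with relative error \<open>\<alpha>\<close> gives that block up to
  \<open>\<alpha> (|B| + sqrt m)\<close> in the Frobenius norm \<open>|B|\<close> (\<open>reg_accuracy\<close>).

  The lower bound is a fingerprinting argument with a Gaussian prior: the entries of \<open>B\<close> are independent
  normal with standard deviation \<open>s\<close>. The derivative of the log density of one sample in \<open>B\<^sub>j\<^sub>k\<close> is the score
  \<open>w\<^sub>j y\<^sub>k\<close>. The posterior density of \<open>B\<close> given the data tends to 0 at infinity, so its derivative integrates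
  to 0, and therefore, for every bounded statistic \<open>h\<close> of the data,
  \<open>E (h B\<^sub>j\<^sub>k) / s\<^sup>2\<close> equals the sum over the samples \<open>i\<close> of \<open>E (h w\<^sub>i\<^sub>j y\<^sub>i\<^sub>k)\<close> (\<open>posterior_gap_average\<close>). This is applied to
  the mean output of \<open>f\<close>, the estimated block scaled to norm 1.

  On the left, \<open>f\<close> has correlation at least \<open>|B|\<close> minus a small error with \<open>B\<close> when the mechanism succeeds
  and at least \<open>-|B|\<close> otherwise. Success has probability \<open>2/3\<close>, so the mean is at least \<open>|B|/3\<close> minus the
  error (\<open>expectation_from_event\<close>): since \<open>f\<close> has norm at most 1, a constant failure probability costs only a
  constant factor.

  On the right there are two estimates. The scores are orthonormal, so the scores of one sample have
  mean absolute correlation at most 1 with a fixed unit vector, and mean correlation 0. Privacy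
  compares the output with the output on the data set whose \<open>i\<close>-th sample is overwritten by a
  constant; that output does not see the sample, and the correlation is at most
  \<open>exp \<epsilon> - 1 + 2 \<delta> m\<close> per sample (\<open>privacy_bound\<close>). Without privacy, the norm of the sum of \<open>n\<close> independent
  scores gives \<open>sqrt n m\<close> (\<open>sampling_bound\<close>).

  With \<open>s\<close> a large multiple of \<open>\<alpha> / sqrt m\<close>, the left side is of order \<open>m sqrt m / \<alpha>\<close>. The two estimates yield
  \<open>n\<close> of order at least \<open>m sqrt m / (\<alpha> \<epsilon>)\<close> and \<open>m / \<alpha>\<^sup>2\<close>. The logarithmic factor is absorbed by
  \<open>ln (2 + d / (\<alpha> \<epsilon>)) \<ge> ln 2\<close>.

  In dimension one there is no room for the block. There the regression with \<open>m = 1\<close> lives in the plane,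
  and the mechanism is shown the sum of the two coordinates. This sum is normal with variance
  \<open>1 + (1 + b)\<^sup>2\<close>, and comparing the estimate of the variance with 2 recovers the sign of a small \<open>b\<close>.
\<close>

section \<open>Integrals under approximately dominated distributions\<close>

text \<open>Integrate the area below the graph of \<open>g\<close> in the other order. This turns a comparison of
  probabilities of events into a comparison of integrals.\<close>

lemma nn_integral_layer_cake:
  fixes g :: "'a \<Rightarrow> real"
  assumes "sigma_finite_measure \<mu>" and [measurable]: "g \<in> borel_measurable \<mu>"
  shows "(\<integral>\<^sup>+x. ennreal (g x) \<partial>\<mu>) =
    (\<integral>\<^sup>+t. emeasure \<mu> {x \<in> space \<mu>. t < g x} * indicator {0..} t \<partial>lborel)"
proof -
  interpret sigma_finite_measure \<mu> by fact
  interpret P: pair_sigma_finite \<mu> lborel ..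
  have "(\<integral>\<^sup>+x. ennreal (g x) \<partial>\<mu>) = (\<integral>\<^sup>+x. \<integral>\<^sup>+t. indicator {0..<g x} t \<partial>lborel \<partial>\<mu>)"
  proof (intro nn_integral_cong)
    show "ennreal (g x) = (\<integral>\<^sup>+t. indicator {0..<g x} t \<partial>lborel)" for x
      by (cases "0 \<le> g x") (auto simp: ennreal_neg)
  qed
  also have "\<dots> = (\<integral>\<^sup>+x. \<integral>\<^sup>+t. (if 0 \<le> t \<and> t < g x then 1 else 0) \<partial>lborel \<partial>\<mu>)"
    by (intro nn_integral_cong) (auto simp: indicator_def)
  also have "\<dots> = (\<integral>\<^sup>+t. \<integral>\<^sup>+x. (if 0 \<le> t \<and> t < g x then 1 else 0) \<partial>\<mu> \<partial>lborel)"
    by (intro P.Fubini'[symmetric]) measurable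
  also have "\<dots> = (\<integral>\<^sup>+t. \<integral>\<^sup>+x. indicator {x \<in> space \<mu>. t < g x} x * indicator {0..} t \<partial>\<mu> \<partial>lborel)"
    by (intro nn_integral_cong) (auto simp: indicator_def)
  also have "\<dots> = (\<integral>\<^sup>+t. emeasure \<mu> {x \<in> space \<mu>. t < g x} * indicator {0..} t \<partial>lborel)"
    by (simp add: nn_integral_multc)
  finally show ?thesis .
qed

definition approx_dominated :: "real \<Rightarrow> real \<Rightarrow> 'a measure \<Rightarrow> 'a measure \<Rightarrow> bool" where
  "approx_dominated \<epsilon> \<delta> \<mu> \<nu> \<longleftrightarrow> (\<forall>E\<in>sets \<nu>. measure \<mu> E \<le> exp \<epsilon> * measure \<nu> E + \<delta>)"

text \<open>In the layer cake formula only the levels between 0 and \<open>T\<close> contribute, so the additive error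
  \<open>\<delta>\<close> of the superlevel sets is paid over an interval of length \<open>T\<close>.\<close>

lemma approx_dominated_nonneg_integral:
  fixes g :: "'a \<Rightarrow> real"
  assumes dom: "approx_dominated \<epsilon> \<delta> \<mu> \<nu>" and \<delta>: "0 \<le> \<delta>"
    and "prob_space \<mu>" "prob_space \<nu>" and sets[measurable_cong]: "sets \<mu> = sets \<nu>"
    and g[measurable]: "g \<in> borel_measurable \<nu>"
    and bd: "\<And>x. x \<in> space \<nu> \<Longrightarrow> 0 \<le> g x \<and> g x \<le> T"
  shows "(\<integral>x. g x \<partial>\<mu>) \<le> exp \<epsilon> * (\<integral>x. g x \<partial>\<nu>) + \<delta> * T"
proof -
  interpret \<mu>: prob_space \<mu> by fact
  interpret \<nu>: prob_space \<nu> by fact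
  have sp: "space \<mu> = space \<nu>" using sets by (rule sets_eq_imp_space_eq)
  have T: "0 \<le> T" using bd \<nu>.not_empty by fastforce
  have I\<mu>: "integrable \<mu> g" using bd sp by (intro \<mu>.integrable_const_bound[where B=T]) auto
  have I\<nu>: "integrable \<nu> g" using bd by (intro \<nu>.integrable_const_bound[where B=T]) auto
  have "ennreal (\<integral>x. g x \<partial>\<mu>) = (\<integral>\<^sup>+x. ennreal (g x) \<partial>\<mu>)"
    using bd sp by (intro nn_integral_eq_integral[symmetric] I\<mu>) auto
  also have "\<dots> = (\<integral>\<^sup>+t. emeasure \<mu> {x \<in> space \<mu>. t < g x} * indicator {0..} t \<partial>lborel)"
    by (intro nn_integral_layer_cake) (unfold_locales, measurable)
  also have "\<dots> \<le> (\<integral>\<^sup>+t. ennreal (exp \<epsilon>) * (emeasure \<nu> {x \<in> space \<nu>. t < g x} * indicator {0..} t)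
                       + ennreal \<delta> * indicator {0..<T} t \<partial>lborel)"
  proof (intro nn_integral_mono)
    fix t :: real
    let ?S = "{x \<in> space \<nu>. t < g x}"
    show "emeasure \<mu> {x \<in> space \<mu>. t < g x} * indicator {0..} t \<le>
       ennreal (exp \<epsilon>) * (emeasure \<nu> ?S * indicator {0..} t) + ennreal \<delta> * indicator {0..<T} t"
    proof (cases "0 \<le> t \<and> t < T")
      case True
      have "measure \<mu> ?S \<le> exp \<epsilon> * measure \<nu> ?S + \<delta>"
        using dom unfolding approx_dominated_def by auto
      then have "ennreal (measure \<mu> ?S) \<le> ennreal (exp \<epsilon> * measure \<nu> ?S + \<delta>)"
        by (rule ennreal_leI)
      also have "\<dots> = ennreal (exp \<epsilon>) * ennreal (measure \<nu> ?S) + ennreal \<delta>"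
        using \<delta> by (simp add: ennreal_mult)
      finally show ?thesis using True
        by (simp add: sp \<mu>.emeasure_eq_measure \<nu>.emeasure_eq_measure)
    next
      case False
      then consider "t < 0" | "?S = {}" using bd by fastforce
      then show ?thesis
      proof cases
        case 2
        show ?thesis unfolding sp 2 by simp
      qed simp
    qed
  qed
  also have "\<dots> = (\<integral>\<^sup>+t. ennreal (exp \<epsilon>) * (emeasure \<nu> {x \<in> space \<nu>. t < g x} * indicator {0..} t) \<partial>lborel)
       + (\<integral>\<^sup>+t. ennreal \<delta> * indicator {0..<T} t \<partial>lborel)"
    by (intro nn_integral_add) measurable
  also have "(\<integral>\<^sup>+t. ennreal \<delta> * indicator {0..<T} t \<partial>lborel) = ennreal (\<delta> * T)"
    using T \<delta> by (simp add: nn_integral_cmult_indicator ennreal_mult)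
  also have "(\<integral>\<^sup>+t. ennreal (exp \<epsilon>) * (emeasure \<nu> {x \<in> space \<nu>. t < g x} * indicator {0..} t) \<partial>lborel)
     = ennreal (exp \<epsilon>) * (\<integral>\<^sup>+x. ennreal (g x) \<partial>\<nu>)"
    by (subst nn_integral_layer_cake) (unfold_locales, measurable, intro nn_integral_cmult, measurable)
  also have "(\<integral>\<^sup>+x. ennreal (g x) \<partial>\<nu>) = ennreal (\<integral>x. g x \<partial>\<nu>)"
    using bd by (intro nn_integral_eq_integral I\<nu>) auto
  also have "ennreal (exp \<epsilon>) * ennreal (\<integral>x. g x \<partial>\<nu>) + ennreal (\<delta> * T)
     = ennreal (exp \<epsilon> * (\<integral>x. g x \<partial>\<nu>) + \<delta> * T)"
    using bd T \<delta> by (subst ennreal_plus) (auto simp: ennreal_mult intro!: integral_nonneg_AE mult_nonneg_nonneg)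
  finally show ?thesis
    using bd T \<delta> by (subst (asm) ennreal_le_iff) (auto intro!: add_nonneg_nonneg mult_nonneg_nonneg integral_nonneg_AE)
qed

text \<open>Treat the positive part of \<open>h\<close> with one of the two dominations and the negative part with the other.
  The loss is then governed by the mean of \<open>\<bar>h\<bar>\<close> instead of its supremum, up to the term with \<open>\<delta>\<close>;
  this is what makes the bound for spread-out scores sharp.\<close>

lemma approx_dominated_integral:
  fixes h :: "'a \<Rightarrow> real"
  assumes dom: "approx_dominated \<epsilon> \<delta> \<mu> \<nu>" "approx_dominated \<epsilon> \<delta> \<nu> \<mu>" and \<delta>: "0 \<le> \<delta>" and \<epsilon>: "0 \<le> \<epsilon>"
    and "prob_space \<mu>" "prob_space \<nu>" and sets[measurable_cong]: "sets \<mu> = sets \<nu>"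
    and h[measurable]: "h \<in> borel_measurable \<nu>"
    and bd: "\<And>x. x \<in> space \<nu> \<Longrightarrow> \<bar>h x\<bar> \<le> T"
  shows "(\<integral>x. h x \<partial>\<mu>) \<le> (\<integral>x. h x \<partial>\<nu>) + (exp \<epsilon> - 1) * (\<integral>x. \<bar>h x\<bar> \<partial>\<nu>) + 2 * \<delta> * T"
proof -
  interpret \<mu>: prob_space \<mu> by fact
  interpret \<nu>: prob_space \<nu> by fact
  have sp: "space \<mu> = space \<nu>" using sets by (rule sets_eq_imp_space_eq)
  have T: "0 \<le> T" using bd \<nu>.not_empty by fastforce
  define p where "p = (\<lambda>x. max 0 (h x))"
  define q where "q = (\<lambda>x. max 0 (- h x))"
  have [measurable]: "p \<in> borel_measurable \<nu>" "q \<in> borel_measurable \<nu>"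
    unfolding p_def q_def by measurable
  have bd': "0 \<le> p x \<and> p x \<le> T" "0 \<le> q x \<and> q x \<le> T" if "x \<in> space \<nu>" for x
    using bd[OF that] T by (auto simp: p_def q_def)
  have I: "integrable \<mu> p" "integrable \<mu> q" "integrable \<nu> p" "integrable \<nu> q"
    using bd' sp by (auto intro!: \<mu>.integrable_const_bound[where B=T] \<nu>.integrable_const_bound[where B=T])
  have h: "h x = p x - q x" "\<bar>h x\<bar> = p x + q x" for x by (auto simp: p_def q_def)
  have 1: "(\<integral>x. p x \<partial>\<mu>) \<le> exp \<epsilon> * (\<integral>x. p x \<partial>\<nu>) + \<delta> * T"
    by (rule approx_dominated_nonneg_integral[OF dom(1) \<delta>]) (use bd' sets in \<open>auto intro: assms\<close>)
  have 2: "(\<integral>x. q x \<partial>\<nu>) \<le> exp \<epsilon> * (\<integral>x. q x \<partial>\<mu>) + \<delta> * T"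
    by (rule approx_dominated_nonneg_integral[OF dom(2) \<delta>]) (use bd' sets sp in \<open>auto intro: assms\<close>)
  define a where "a = (\<integral>x. q x \<partial>\<nu>)"
  define b where "b = (\<integral>x. q x \<partial>\<mu>)"
  have b: "0 \<le> a"
    unfolding a_def using bd' by (auto intro!: integral_nonneg_AE)
  have "exp (-\<epsilon>) * a \<le> exp (-\<epsilon>) * (exp \<epsilon> * b + \<delta> * T)"
    using 2 unfolding a_def b_def by (intro mult_left_mono) auto
  also have "\<dots> = b + exp (-\<epsilon>) * (\<delta> * T)" by (simp add: algebra_simps flip: exp_add mult.assoc)
  also have "exp (-\<epsilon>) * (\<delta> * T) \<le> \<delta> * T" using \<epsilon> \<delta> T by (intro mult_left_le_one_le) auto
  finally have 3: "exp (-\<epsilon>) * a \<le> b + \<delta> * T" by simp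
  \<comment> \<open>The factor \<open>exp (-\<epsilon>)\<close> from the reversed domination becomes \<open>1 - (exp \<epsilon> - 1)\<close>.\<close>
  have "2 - exp \<epsilon> \<le> exp (-\<epsilon>)"
  proof -
    have "exp \<epsilon> + exp (-\<epsilon>) \<ge> (1 + \<epsilon>) + (1 + -\<epsilon>)" by (intro add_mono exp_ge_add_one_self)
    then show ?thesis by simp
  qed
  then have "(2 - exp \<epsilon>) * a \<le> exp (-\<epsilon>) * a" using b by (intro mult_right_mono)
  with 3 have 4: "- b \<le> - a + (exp \<epsilon> - 1) * a + \<delta> * T" by (simp add: algebra_simps)
  have eqs: "(\<integral>x. h x \<partial>\<mu>) = (\<integral>x. p x \<partial>\<mu>) - b" "(\<integral>x. h x \<partial>\<nu>) = (\<integral>x. p x \<partial>\<nu>) - a"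
    "(\<integral>x. \<bar>h x\<bar> \<partial>\<nu>) = (\<integral>x. p x \<partial>\<nu>) + a"
    unfolding h(2) unfolding h(1) a_def b_def using I by simp_all
  show ?thesis
    unfolding eqs using 1 4 by (simp add: algebra_simps)
qed

section \<open>Correlation of a private output with orthonormal scores\<close>

lemma integrable_PiM_component:
  fixes g :: "'a \<Rightarrow> real"
  assumes P: "prob_space P" and i: "i \<in> I" and g: "integrable P g"
  shows "integrable (\<Pi>\<^sub>M i\<in>I. P) (\<lambda>X. g (X i))"
    and "(\<integral>X. g (X i) \<partial>(\<Pi>\<^sub>M i\<in>I. P)) = (\<integral>x. g x \<partial>P)"
proof -
  have d: "distr (\<Pi>\<^sub>M i\<in>I. P) P (\<lambda>X. X i) = P" using assms by (intro distr_PiM_component) auto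
  show "integrable (\<Pi>\<^sub>M i\<in>I. P) (\<lambda>X. g (X i))"
    using i g by (subst integrable_distr_eq[of "\<lambda>X. X i" _ P g, symmetric]) (auto simp: d)
  show "(\<integral>X. g (X i) \<partial>(\<Pi>\<^sub>M i\<in>I. P)) = (\<integral>x. g x \<partial>P)"
    using i g by (subst (2) d[symmetric], subst integral_distr) auto
qed

text \<open>The two properties of the scores that the upper bounds use: they are centred and orthonormal
  in the space of square integrable functions.\<close>

locale orthonormal_scores = prob_space P for P :: "'a measure" +
  fixes E :: "'e set" and S :: "'e \<Rightarrow> 'a \<Rightarrow> real"
  assumes finE: "finite E"
    and score_measurable [measurable]: "\<And>e. e \<in> E \<Longrightarrow> S e \<in> borel_measurable P"
    and score_mean: "\<And>e. e \<in> E \<Longrightarrow> (\<integral>x. S e x \<partial>P) = 0"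
    and score_prod_integrable: "\<And>e e'. e \<in> E \<Longrightarrow> e' \<in> E \<Longrightarrow> integrable P (\<lambda>x. S e x * S e' x)"
    and score_prod: "\<And>e e'. e \<in> E \<Longrightarrow> e' \<in> E \<Longrightarrow> (\<integral>x. S e x * S e' x \<partial>P) = of_bool (e = e')"
begin

lemma score_integrable: "e \<in> E \<Longrightarrow> integrable P (S e)"
  using square_integrable_imp_integrable[of "S e"] score_prod_integrable[of e e]
  by (simp add: power2_eq_square)

lemma score_abs_mean: assumes e: "e \<in> E" shows "(\<integral>x. \<bar>S e x\<bar> \<partial>P) \<le> 1"
proof -
  have "(\<integral>x. \<bar>S e x\<bar> \<partial>P) \<le> (\<integral>x. (1 + S e x * S e x) / 2 \<partial>P)"
  proof (rule integral_mono)
    show "\<bar>S e x\<bar> \<le> (1 + S e x * S e x) / 2" for x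
      using zero_le_power2[of "\<bar>S e x\<bar> - 1"]
      by (simp add: power2_diff flip: power2_eq_square)
  qed (use score_integrable[OF e] score_prod_integrable[OF e e] in auto)
  also have "\<dots> = 1" using score_prod_integrable[OF e e] score_prod[OF e e] by (simp add: prob_space)
  finally show ?thesis .
qed

text \<open>By orthonormality the second moment is the squared norm of \<open>u\<close>; the first absolute moment then
  follows from \<open>2 \<bar>t\<bar> \<le> 1 + t\<^sup>2\<close>.\<close>

lemma score_combination:
  assumes u: "(\<Sum>e\<in>E. (u e)\<^sup>2) \<le> 1"
  shows "(\<integral>x. (\<Sum>e\<in>E. u e * S e x) \<partial>P) = 0"
    and "(\<integral>x. \<bar>\<Sum>e\<in>E. u e * S e x\<bar> \<partial>P) \<le> 1"
proof -
  show "(\<integral>x. (\<Sum>e\<in>E. u e * S e x) \<partial>P) = 0"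
    by (subst Bochner_Integration.integral_sum) (auto simp: score_integrable score_mean)
  let ?L = "\<lambda>x. \<Sum>e\<in>E. u e * S e x"
  have sq: "(?L x)\<^sup>2 = (\<Sum>e\<in>E. \<Sum>e'\<in>E. (u e * u e') * (S e x * S e' x))" for x
    by (simp add: power2_eq_square sum_product algebra_simps)
  have I: "integrable P (\<lambda>x. (?L x)\<^sup>2)"
    unfolding sq by (intro Bochner_Integration.integrable_sum integrable_mult_right score_prod_integrable)
  have "(\<integral>x. (?L x)\<^sup>2 \<partial>P) = (\<Sum>e\<in>E. \<Sum>e'\<in>E. (u e * u e') * of_bool (e = e'))"
    unfolding sq by (simp add: Bochner_Integration.integral_sum score_prod_integrable score_prod)
  also have "\<dots> = (\<Sum>e\<in>E. (u e)\<^sup>2)"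
    using finE by (simp add: sum.delta power2_eq_square of_bool_def if_distrib cong: if_cong)
  finally have sq_le: "(\<integral>x. (?L x)\<^sup>2 \<partial>P) \<le> 1" using u by simp
  have "(\<integral>x. \<bar>?L x\<bar> \<partial>P) \<le> (\<integral>x. (1 + (?L x)\<^sup>2) / 2 \<partial>P)"
  proof (intro integral_mono)
    show "integrable P (\<lambda>x. \<bar>?L x\<bar>)"
      by (intro integrable_abs Bochner_Integration.integrable_sum integrable_mult_right score_integrable)
    show "\<bar>?L x\<bar> \<le> (1 + (?L x)\<^sup>2) / 2" for x
      using zero_le_power2[of "\<bar>?L x\<bar> - 1"] by (simp add: power2_diff)
  qed (use I in auto)
  also have "\<dots> \<le> 1" using I sq_le by (simp add: prob_space)
  finally show "(\<integral>x. \<bar>?L x\<bar> \<partial>P) \<le> 1" .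
qed

text \<open>An upper bound, with mean \<open>sqrt (card E)\<close>, for the norm of the score vector. It replaces the norm
  because its mean follows from the second moments alone.\<close>

definition score_bound :: "'a \<Rightarrow> real" where
  "score_bound x = (sqrt (card E) + (\<Sum>e\<in>E. (S e x)\<^sup>2) / sqrt (card E)) / 2"

lemma score_bound_measurable [measurable]: "score_bound \<in> borel_measurable P"
  unfolding score_bound_def by measurable

lemma score_bound_integral:
  assumes "E \<noteq> {}"
  shows "integrable P score_bound" "(\<integral>x. score_bound x \<partial>P) = sqrt (card E)"
proof -
  have k: "sqrt (card E) > 0" using assms finE by (simp add: card_gt_0_iff)
  have I: "integrable P (\<lambda>x. (S e x)\<^sup>2)" if "e \<in> E" for e
    using score_prod_integrable[OF that that] by (simp add: power2_eq_square)
  have e: "(\<integral>x. (S e x)\<^sup>2 \<partial>P) = 1" if "e \<in> E" for e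
    using score_prod[OF that that] by (simp add: power2_eq_square)
  show "integrable P score_bound" unfolding score_bound_def using I by auto
  have "(\<integral>x. score_bound x \<partial>P) = (sqrt (card E) + card E / sqrt (card E)) / 2"
    unfolding score_bound_def using I e by (simp add: prob_space)
  also have "\<dots> = sqrt (card E)" using k by (simp add: field_simps)
  finally show "(\<integral>x. score_bound x \<partial>P) = sqrt (card E)" .
qed

lemma abs_sum_le_score_bound:
  assumes "E \<noteq> {}" and u: "(\<Sum>e\<in>E. (u e)\<^sup>2) \<le> 1"
  shows "\<bar>\<Sum>e\<in>E. u e * S e x\<bar> \<le> score_bound x"
proof -
  define r where "r = sqrt (card E)"
  have r: "r > 0" unfolding r_def using assms finE by (simp add: card_gt_0_iff)
  have "\<bar>\<Sum>e\<in>E. u e * S e x\<bar> \<le> (\<Sum>e\<in>E. \<bar>u e * S e x\<bar>)" by (rule sum_abs)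
  also have "\<dots> \<le> (\<Sum>e\<in>E. (r * (u e)\<^sup>2 + (S e x)\<^sup>2 / r) / 2)"
  proof (intro sum_mono)
    fix e
    have "0 \<le> (r * \<bar>u e\<bar> - \<bar>S e x\<bar>)\<^sup>2 / r" using r by simp
    also have "\<dots> = r * (u e)\<^sup>2 + (S e x)\<^sup>2 / r - 2 * \<bar>u e * S e x\<bar>"
      using r by (simp add: power2_diff field_simps abs_mult power2_eq_square)
    finally show "\<bar>u e * S e x\<bar> \<le> (r * (u e)\<^sup>2 + (S e x)\<^sup>2 / r) / 2" by simp
  qed
  also have "\<dots> = (r * (\<Sum>e\<in>E. (u e)\<^sup>2) + (\<Sum>e\<in>E. (S e x)\<^sup>2) / r) / 2"
    by (simp add: sum.distrib sum_distrib_left sum_divide_distrib add_divide_distrib)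
  also have "\<dots> \<le> score_bound x"
    unfolding score_bound_def r_def[symmetric] using u r by (simp add: divide_right_mono)
  finally show ?thesis .
qed

end

text \<open>The functions \<open>F e\<close> are the coordinates of a vector in the unit ball that is computed from the output.\<close>

locale scored_mechanism = orthonormal_scores P E S
  for P :: "'a measure" and E :: "'e set" and S :: "'e \<Rightarrow> 'a \<Rightarrow> real" +
  fixes n :: nat and Q :: "'b measure" and M :: "(nat \<Rightarrow> 'a) \<Rightarrow> 'b measure"
    and F :: "'e \<Rightarrow> 'b \<Rightarrow> real"
  assumes mech: "mechanism n P Q M"
    and F_measurable [measurable]: "\<And>e. e \<in> E \<Longrightarrow> F e \<in> borel_measurable Q"
    and F_unit: "\<And>y. y \<in> space Q \<Longrightarrow> (\<Sum>e\<in>E. (F e y)\<^sup>2) \<le> 1"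
    and E_ne: "E \<noteq> {}"
begin

abbreviation data :: "(nat \<Rightarrow> 'a) measure" where "data \<equiv> \<Pi>\<^sub>M i\<in>{..<n}. P"

definition h :: "'e \<Rightarrow> (nat \<Rightarrow> 'a) \<Rightarrow> real" where "h e X = (\<integral>y. F e y \<partial>M X)"

sublocale data: product_prob_space "\<lambda>_::nat. P" ..

sublocale data: prob_space data by (rule prob_space_PiM) (rule prob_space_axioms)

lemma M_measurable [measurable]: "M \<in> data \<rightarrow>\<^sub>M subprob_algebra Q"
  using mech unfolding mechanism_def by (rule measurable_prob_algebraD)

lemma M_prob: assumes "X \<in> space data" shows "prob_space (M X)" "sets (M X) = sets Q" "space (M X) = space Q"
proof -
  have "M X \<in> space (prob_algebra Q)"
    using mech assms unfolding mechanism_def by (rule measurable_space)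
  then show "prob_space (M X)" "sets (M X) = sets Q" by (simp_all add: space_prob_algebra)
  then show "space (M X) = space Q" by (intro sets_eq_imp_space_eq)
qed

lemma F_le_1: assumes "e \<in> E" "y \<in> space Q" shows "\<bar>F e y\<bar> \<le> 1"
proof -
  have "(F e y)\<^sup>2 \<le> (\<Sum>e\<in>E. (F e y)\<^sup>2)" using assms finE by (intro member_le_sum) auto
  with F_unit[OF assms(2)] show ?thesis by (simp add: abs_le_square_iff[of _ 1, simplified])
qed

lemma F_measurable_M [measurable]: "e \<in> E \<Longrightarrow> X \<in> space data \<Longrightarrow> F e \<in> borel_measurable (M X)"
  using M_prob(2) F_measurable by (simp cong: measurable_cong_sets)

lemma F_integrable: assumes "e \<in> E" "X \<in> space data" shows "integrable (M X) (F e)"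
proof -
  interpret MX: prob_space "M X" by (rule M_prob[OF assms(2)])
  note [measurable_cong] = M_prob(2)[OF assms(2)]
  show ?thesis
    using F_le_1 assms M_prob(3)[OF assms(2)] by (intro MX.integrable_const_bound[where B=1]) auto
qed

lemma h_measurable [measurable]: "e \<in> E \<Longrightarrow> h e \<in> borel_measurable data"
  unfolding h_def by measurable

lemma h_unit: assumes X: "X \<in> space data" shows "(\<Sum>e\<in>E. (h e X)\<^sup>2) \<le> 1"
proof -
  interpret MX: prob_space "M X" by (rule M_prob[OF X])
  note [measurable_cong] = M_prob(2)[OF X]
  have I: "integrable (M X) (\<lambda>y. (F e y)\<^sup>2)" if e: "e \<in> E" for e
    using F_le_1[OF e] e M_prob(3)[OF X]
    by (intro MX.integrable_const_bound[where B=1])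
      (auto simp: abs_square_le_1 intro!: borel_measurable_power F_measurable_M X)
  have "(\<Sum>e\<in>E. (h e X)\<^sup>2) \<le> (\<Sum>e\<in>E. \<integral>y. (F e y)\<^sup>2 \<partial>M X)"
  proof (intro sum_mono)
    fix e assume e: "e \<in> E"
    show "(h e X)\<^sup>2 \<le> (\<integral>y. (F e y)\<^sup>2 \<partial>M X)"
      using MX.variance_eq[OF F_integrable[OF e X] I[OF e]] MX.variance_positive[of "F e"]
      by (simp add: h_def)
  qed
  also have "\<dots> = (\<integral>y. (\<Sum>e\<in>E. (F e y)\<^sup>2) \<partial>M X)" using I by simp
  also have "\<dots> \<le> (\<integral>y. 1 \<partial>M X)"
    using I F_unit M_prob(3)[OF X] by (intro integral_mono) auto
  finally show ?thesis by (simp add: MX.prob_space)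
qed

lemma h_le_1: assumes "e \<in> E" "X \<in> space data" shows "\<bar>h e X\<bar> \<le> 1"
proof -
  have "(h e X)\<^sup>2 \<le> (\<Sum>e\<in>E. (h e X)\<^sup>2)" using assms finE by (intro member_le_sum) auto
  with h_unit[OF assms(2)] show ?thesis by (simp add: abs_le_square_iff[of _ 1, simplified])
qed

lemma integrable_h_score:
  assumes "i < n" "e \<in> E"
  shows "integrable data (\<lambda>X. h e X * S e (X i))"
proof (rule Bochner_Integration.integrable_bound)
  show "integrable data (\<lambda>X. S e (X i))" using assms by (intro integrable_PiM_component prob_space_axioms score_integrable) auto
  show "AE X in data. norm (h e X * S e (X i)) \<le> norm (S e (X i))"
    using h_le_1[OF assms(2)] by (auto intro!: AE_I2 simp: abs_mult mult_left_le_one_le)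
  have [measurable]: "(\<lambda>X. X i) \<in> data \<rightarrow>\<^sub>M P"
    using assms by (auto intro!: measurable_component_singleton)
  show "(\<lambda>X. h e X * S e (X i)) \<in> borel_measurable data" using assms(2) by measurable
qed

text \<open>Sampling alone bounds the correlation: the score sums of \<open>n\<close> independent samples have second moment \<open>n\<close> in each
  coordinate, and \<open>h W \<le> (t h\<^sup>2 + W\<^sup>2 / t) / 2\<close> with the optimal \<open>t\<close> plays the part of the Cauchy-Schwarz
  inequality for the expectation of the inner product.\<close>

lemma sampling_bound:
  "(\<Sum>i<n. \<integral>X. (\<Sum>e\<in>E. h e X * S e (X i)) \<partial>data) \<le> sqrt (n * card E)"
proof (cases "n = 0")
  case False
  define W where "W = (\<lambda>e X. \<Sum>i<n. S e (X i))"
  define t where "t = sqrt (n * card E)"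
  have t: "t > 0" unfolding t_def using False E_ne finE by (simp add: card_gt_0_iff)
  have prods: "integrable data (\<lambda>X. S e (X i) * S e (X j)) \<and>
      (\<integral>X. S e (X i) * S e (X j) \<partial>data) = of_bool (i = j)" if e: "e \<in> E" and ij: "i < n" "j < n" for e i j
  proof -
    note sq = score_prod_integrable[OF e e]
    have c: "integrable data (\<lambda>X. S e (X i) * S e (X i))" if "i < n" for i
      by (rule integrable_PiM_component(1)[OF prob_space_axioms _ sq]) (use that in auto)
    have [measurable]: "S e \<in> borel_measurable P" using e by measurable
    have [measurable]: "(\<lambda>X. X i) \<in> data \<rightarrow>\<^sub>M P" "(\<lambda>X. X j) \<in> data \<rightarrow>\<^sub>M P"
      using ij by (auto intro!: measurable_component_singleton)
    have I: "integrable data (\<lambda>X. S e (X i) * S e (X j))"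
    proof (rule Bochner_Integration.integrable_bound)
      show "integrable data (\<lambda>X. (S e (X i) * S e (X i) + S e (X j) * S e (X j)))"
        by (intro Bochner_Integration.integrable_add c ij)
      have "\<bar>a * b\<bar> \<le> a * a + b * b" for a b :: real
        using sum_squares_bound[of "\<bar>a\<bar>" "\<bar>b\<bar>", unfolded mult.assoc abs_mult[symmetric]] abs_ge_zero[of "a * b"]
        by (simp add: power2_eq_square flip: abs_mult)
      then show "AE X in data. norm (S e (X i) * S e (X j)) \<le> norm (S e (X i) * S e (X i) + S e (X j) * S e (X j))"
        by (auto intro!: AE_I2 simp: abs_of_nonneg)
    qed measurable
    moreover have "(\<integral>X. S e (X i) * S e (X j) \<partial>data) = of_bool (i = j)"
    proof (cases "i = j")
      case True
      then show ?thesis using integrable_PiM_component(2)[OF prob_space_axioms _ sq, of i "{..<n}"] ij score_prod[OF e e] by simp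
    next
      case False
      let ?I = "{..<n} - {i}"
      have ins: "insert i ?I = {..<n}" using ij by auto
      have "(\<integral>X. S e (X i) * S e (X j) \<partial>data) =
          (\<integral>X. (\<integral>x. S e ((X(i := x)) i) * S e ((X(i := x)) j) \<partial>P) \<partial>PiM ?I (\<lambda>_. P))"
        using data.product_integral_insert[of ?I i "\<lambda>X. S e (X i) * S e (X j)"] I unfolding ins by simp
      also have "\<dots> = 0" using False score_mean[OF e] by simp
      finally show ?thesis using False by simp
    qed
    ultimately show ?thesis by blast
  qed
  have sqW: "(W e X)\<^sup>2 = (\<Sum>i<n. \<Sum>j<n. S e (X i) * S e (X j))" for e X
    unfolding W_def by (simp add: power2_eq_square sum_product)
  have IW: "integrable data (\<lambda>X. (W e X)\<^sup>2)" if "e \<in> E" for e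
    unfolding sqW using prods[OF that] by (intro Bochner_Integration.integrable_sum) auto
  have EW: "(\<integral>X. (W e X)\<^sup>2 \<partial>data) = n" if "e \<in> E" for e
  proof -
    note p = prods[OF that, THEN conjunct1] prods[OF that, THEN conjunct2]
    have "(\<integral>X. (W e X)\<^sup>2 \<partial>data) = (\<Sum>i<n. \<integral>X. (\<Sum>j<n. S e (X i) * S e (X j)) \<partial>data)"
      unfolding sqW using p(1) by (intro Bochner_Integration.integral_sum Bochner_Integration.integrable_sum) auto
    also have "\<dots> = (\<Sum>i<n. \<Sum>j<n. \<integral>X. S e (X i) * S e (X j) \<partial>data)"
      using p(1) by (intro sum.cong refl Bochner_Integration.integral_sum) auto
    also have "\<dots> = (\<Sum>i<n. \<Sum>j<n. of_bool (i = j))"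
      using p(2) by (intro sum.cong refl) auto
    also have "\<dots> = n" by (simp add: of_bool_def)
    finally show ?thesis .
  qed
  have "(\<Sum>i<n. \<integral>X. (\<Sum>e\<in>E. h e X * S e (X i)) \<partial>data) = (\<integral>X. (\<Sum>i<n. \<Sum>e\<in>E. h e X * S e (X i)) \<partial>data)"
    by (subst Bochner_Integration.integral_sum) (auto intro!: Bochner_Integration.integrable_sum integrable_h_score)
  also have "\<dots> \<le> (\<integral>X. (t + (\<Sum>e\<in>E. (W e X)\<^sup>2) / t) / 2 \<partial>data)"
  proof (rule integral_mono)
    show "integrable data (\<lambda>X. \<Sum>i<n. \<Sum>e\<in>E. h e X * S e (X i))"
      by (auto intro!: Bochner_Integration.integrable_sum integrable_h_score)
    show "integrable data (\<lambda>X. (t + (\<Sum>e\<in>E. (W e X)\<^sup>2) / t) / 2)" using IW by auto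
    fix X assume X: "X \<in> space data"
    have "(\<Sum>i<n. \<Sum>e\<in>E. h e X * S e (X i)) = (\<Sum>e\<in>E. h e X * W e X)"
      unfolding W_def by (subst sum.swap) (simp add: sum_distrib_left)
    also have "\<dots> \<le> (\<Sum>e\<in>E. (t * (h e X)\<^sup>2 + (W e X)\<^sup>2 / t) / 2)"
    proof (intro sum_mono)
      fix e
      have "0 \<le> (t * h e X - W e X)\<^sup>2 / t" using t by simp
      also have "\<dots> = t * (h e X)\<^sup>2 + (W e X)\<^sup>2 / t - 2 * (h e X * W e X)"
        using t by (simp add: power2_diff field_simps power2_eq_square)
      finally show "h e X * W e X \<le> (t * (h e X)\<^sup>2 + (W e X)\<^sup>2 / t) / 2" by simp
    qed
    also have "\<dots> = (t * (\<Sum>e\<in>E. (h e X)\<^sup>2) + (\<Sum>e\<in>E. (W e X)\<^sup>2) / t) / 2"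
      by (simp add: sum.distrib sum_distrib_left sum_divide_distrib add_divide_distrib)
    also have "\<dots> \<le> (t + (\<Sum>e\<in>E. (W e X)\<^sup>2) / t) / 2"
      using h_unit[OF X] t by (simp add: divide_right_mono)
    finally show "(\<Sum>i<n. \<Sum>e\<in>E. h e X * S e (X i)) \<le> (t + (\<Sum>e\<in>E. (W e X)\<^sup>2) / t) / 2" .
  qed
  also have "\<dots> = (t + (n * card E) / t) / 2"
    using IW EW by (simp add: data.prob_space mult.commute)
  also have "\<dots> = t" using t unfolding t_def by (simp add: real_div_sqrt)
  finally show ?thesis unfolding t_def .
qed simp

text \<open>The inner product with the fixed score vector of the old \<open>i\<close>-th point is a bounded function of the output,
  so privacy compares its means under the two neighbouring data sets. Overwriting a point with itself gives equal
  data sets, which do not count as neighbouring but satisfy the comparison trivially.\<close>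

lemma privacy_bound_single:
  assumes dp: "diff_private n P Q \<epsilon> \<delta> M" and \<epsilon>: "0 \<le> \<epsilon>" and \<delta>: "0 \<le> \<delta>"
    and i: "i < n" and X: "X \<in> space data" and x: "x \<in> space P"
  shows "(\<Sum>e\<in>E. h e X * S e (X i)) \<le> (\<Sum>e\<in>E. h e (X(i := x)) * S e (X i))
    + (exp \<epsilon> - 1) * (\<integral>y. \<bar>\<Sum>e\<in>E. F e y * S e (X i)\<bar> \<partial>M (X(i := x))) + 2 * \<delta> * score_bound (X i)"
proof -
  let ?X' = "X(i := x)"
  have X': "?X' \<in> space data" using X x i by (auto simp: space_PiM PiE_iff extensional_def)
  have dom: "approx_dominated \<epsilon> \<delta> (M X) (M ?X') \<and> approx_dominated \<epsilon> \<delta> (M ?X') (M X)"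
  proof (cases "X i = x")
    case True
    have "measure (M X) A \<le> exp \<epsilon> * measure (M X) A + \<delta>" for A
      using mult_right_mono[of 1 "exp \<epsilon>" "measure (M X) A"] \<epsilon> \<delta> by simp
    then show ?thesis using True by (auto simp: approx_dominated_def)
  next
    case False
    have "{j \<in> {..<n}. X j \<noteq> ?X' j} = {i}" "{j \<in> {..<n}. ?X' j \<noteq> X j} = {i}" using False i by auto
    then have "neighbouring n X ?X'" "neighbouring n ?X' X" unfolding neighbouring_def by simp_all
    then show ?thesis
      using dp X X' M_prob(2)[OF X] M_prob(2)[OF X'] unfolding diff_private_def approx_dominated_def by simp
  qed
  let ?H = "\<lambda>y. \<Sum>e\<in>E. F e y * S e (X i)"
  have lin: "(\<integral>y. ?H y \<partial>M Z) = (\<Sum>e\<in>E. h e Z * S e (X i))" if "Z \<in> space data" for Z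
    using F_integrable[OF _ that] unfolding h_def by (subst Bochner_Integration.integral_sum) auto
  note [measurable_cong] = M_prob(2)[OF X']
  have "(\<integral>y. ?H y \<partial>M X) \<le> (\<integral>y. ?H y \<partial>M ?X')
    + (exp \<epsilon> - 1) * (\<integral>y. \<bar>?H y\<bar> \<partial>M ?X') + 2 * \<delta> * score_bound (X i)"
  proof (rule approx_dominated_integral)
    show "\<bar>?H y\<bar> \<le> score_bound (X i)" if "y \<in> space (M ?X')" for y
      using that M_prob(3)[OF X'] by (intro abs_sum_le_score_bound E_ne F_unit) auto
    show "?H \<in> borel_measurable (M ?X')"
      using F_measurable_M[OF _ X'] by (intro borel_measurable_sum borel_measurable_times) auto
  qed (use dom \<epsilon> \<delta> M_prob[OF X] M_prob[OF X'] in auto)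
  then show ?thesis by (simp only: lin[OF X] lin[OF X'])
qed

text \<open>Fix all points but the \<open>i\<close>-th, and compare with the data set whose \<open>i\<close>-th point is a constant
  \<open>x0\<close>. On the latter the output is independent of the \<open>i\<close>-th sample \<open>x\<close>, so averaging over \<open>x\<close> removes the
  main term and bounds the mean absolute value by 1.\<close>

lemma privacy_bound_at:
  assumes dp: "diff_private n P Q \<epsilon> \<delta> M" and \<epsilon>: "0 \<le> \<epsilon>" and \<delta>: "0 \<le> \<delta>" and i: "i < n"
  shows "(\<integral>X. (\<Sum>e\<in>E. h e X * S e (X i)) \<partial>data) \<le> (exp \<epsilon> - 1) + 2 * \<delta> * sqrt (card E)"
    (is "_ \<le> ?B")
proof -
  let ?I = "{..<n} - {i}"
  let ?N = "PiM ?I (\<lambda>_. P)"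
  have ins: "insert i ?I = {..<n}" using i by auto
  have B: "0 \<le> ?B" using \<epsilon> \<delta> by simp
  \<comment> \<open>The bound holds for every fixed choice of the other points, and for any comparison point \<open>x0\<close>.\<close>
  have inner: "(\<integral>x. (\<Sum>e\<in>E. h e (X(i := x)) * S e x) \<partial>P) \<le> ?B" if X: "X \<in> space ?N" for X
  proof -
    obtain x0 where x0: "x0 \<in> space P" using not_empty by blast
    have upd: "X(i := x) \<in> space data" if "x \<in> space P" for x
      using X that i by (auto simp: space_PiM PiE_iff extensional_def)
    note X0 = upd[OF x0]
    have [measurable]: "(\<lambda>x. X(i := x)) \<in> P \<rightarrow>\<^sub>M data"
      using measurable_add_dim[of i ?I "\<lambda>_. P"] X
      by (intro measurable_PiM_single') (auto simp: space_PiM PiE_iff extensional_def fun_upd_def i)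
    interpret N: prob_space "M (X(i := x0))" by (rule M_prob[OF X0])
    interpret PN: pair_prob_space P "M (X(i := x0))" ..
    note [measurable_cong] = M_prob(2)[OF X0]
    let ?G = "\<lambda>x y. \<bar>\<Sum>e\<in>E. F e y * S e x\<bar>"
    have [measurable]: "F e \<in> borel_measurable (M (X(i := x0)))" if "e \<in> E" for e
      using that X0 by (rule F_measurable_M)
    have [measurable]: "(\<lambda>z. F e (snd z)) \<in> borel_measurable (P \<Otimes>\<^sub>M M (X(i := x0)))"
        "(\<lambda>z. S e (fst z)) \<in> borel_measurable (P \<Otimes>\<^sub>M M (X(i := x0)))" if "e \<in> E" for e
      using that by measurable
    have [measurable]: "(\<lambda>(x, y). ?G x y) \<in> borel_measurable (P \<Otimes>\<^sub>M M (X(i := x0)))" by measurable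
    have IT: "integrable (P \<Otimes>\<^sub>M M (X(i := x0))) (\<lambda>z. score_bound (fst z))"
      by (subst integrable_distr_eq[of fst _ P score_bound, symmetric])
        (auto simp: N.distr_pair_fst score_bound_integral E_ne)
    have IG: "integrable (P \<Otimes>\<^sub>M M (X(i := x0))) (\<lambda>(x, y). ?G x y)"
    proof (rule Bochner_Integration.integrable_bound[OF IT])
      show "AE z in P \<Otimes>\<^sub>M M (X(i := x0)). norm (case z of (x, y) \<Rightarrow> ?G x y) \<le> norm (score_bound (fst z))"
        using M_prob(3)[OF X0]
        by (auto intro!: AE_I2 order_trans[OF _ abs_ge_self] abs_sum_le_score_bound E_ne F_unit
          simp: space_pair_measure)
    qed measurable
    have swap: "(\<integral>x. (\<integral>y. ?G x y \<partial>M (X(i := x0))) \<partial>P) = (\<integral>y. (\<integral>x. ?G x y \<partial>P) \<partial>M (X(i := x0)))"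
      using PN.Fubini_integral[OF IG] by simp
    have "(\<integral>x. (\<integral>y. ?G x y \<partial>M (X(i := x0))) \<partial>P) \<le> (\<integral>y. 1 \<partial>M (X(i := x0)))"
      unfolding swap
      using PN.integrable_snd[of ?G, OF IG] score_combination(2)[OF F_unit] M_prob(3)[OF X0]
      by (intro integral_mono) auto
    then have G1: "(\<integral>x. (\<integral>y. ?G x y \<partial>M (X(i := x0))) \<partial>P) \<le> 1" by (simp add: N.prob_space)
    have I1: "integrable P (\<lambda>x. \<Sum>e\<in>E. h e (X(i := x)) * S e x)"
    proof (intro Bochner_Integration.integrable_sum)
      fix e assume e: "e \<in> E"
      show "integrable P (\<lambda>x. h e (X(i := x)) * S e x)"
      proof (rule Bochner_Integration.integrable_bound[OF score_integrable[OF e]])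
        show "AE x in P. norm (h e (X(i := x)) * S e x) \<le> norm (S e x)"
          using h_le_1[OF e upd] by (auto intro!: AE_I2 simp: abs_mult mult_left_le_one_le)
      qed (use e in measurable)
    qed
    have I2: "integrable P (\<lambda>x. (\<Sum>e\<in>E. h e (X(i := x0)) * S e x))"
      by (intro Bochner_Integration.integrable_sum integrable_mult_right score_integrable)
    have I3: "integrable P (\<lambda>x. \<integral>y. ?G x y \<partial>M (X(i := x0)))"
      using PN.integrable_fst[of ?G, OF IG] .
    have "(\<integral>x. (\<Sum>e\<in>E. h e (X(i := x)) * S e x) \<partial>P) \<le>
      (\<integral>x. (\<Sum>e\<in>E. h e (X(i := x0)) * S e x) + (exp \<epsilon> - 1) * (\<integral>y. ?G x y \<partial>M (X(i := x0)))
        + 2 * \<delta> * score_bound x \<partial>P)"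
      using I1 I2 I3 score_bound_integral(1)[OF E_ne]
        privacy_bound_single[OF dp \<epsilon> \<delta> i upd x0]
      by (intro integral_mono) auto
    also have "\<dots> = 0 + (exp \<epsilon> - 1) * (\<integral>x. (\<integral>y. ?G x y \<partial>M (X(i := x0))) \<partial>P) + 2 * \<delta> * sqrt (card E)"
      using I2 I3 score_bound_integral[OF E_ne] score_combination(1)[OF h_unit[OF X0]] by simp
    also have "\<dots> \<le> ?B" using mult_left_mono[OF G1, of "exp \<epsilon> - 1"] \<epsilon> by simp
    finally show ?thesis .
  qed
  have "(\<integral>X. (\<Sum>e\<in>E. h e X * S e (X i)) \<partial>data) =
      (\<integral>X. (\<integral>x. (\<Sum>e\<in>E. h e (X(i := x)) * S e ((X(i := x)) i)) \<partial>P) \<partial>?N)"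
    using data.product_integral_insert[of ?I i "\<lambda>X. (\<Sum>e\<in>E. h e X * S e (X i))"] i
    unfolding ins by (simp add: integrable_h_score)
  also have "\<dots> = (\<integral>X. (\<integral>x. (\<Sum>e\<in>E. h e (X(i := x)) * S e x) \<partial>P) \<partial>?N)" by simp
  also have "\<dots> \<le> ?B"
  proof (cases "integrable ?N (\<lambda>X. \<integral>x. (\<Sum>e\<in>E. h e (X(i := x)) * S e x) \<partial>P)")
    case True
    interpret N: prob_space ?N by (rule prob_space_PiM) (rule prob_space_axioms)
    show ?thesis using inner by (intro N.integral_le_const True AE_I2)
  next
    \<comment> \<open>The integral of a non-integrable function is 0.\<close>
    case False
    then show ?thesis using B by (subst not_integrable_integral_eq[OF False])
  qed
  finally show ?thesis .
qed

lemma privacy_bound: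
  assumes "diff_private n P Q \<epsilon> \<delta> M" "0 \<le> \<epsilon>" "0 \<le> \<delta>"
  shows "(\<Sum>i<n. \<integral>X. (\<Sum>e\<in>E. h e X * S e (X i)) \<partial>data) \<le> n * ((exp \<epsilon> - 1) + 2 * \<delta> * sqrt (card E))"
  using sum_mono[of "{..<n}", OF privacy_bound_at[OF assms]] by simp

end

section \<open>The Gaussian regression model\<close>

text \<open>Both sides agree on boxes, where the integral of a product is the product of the integrals.\<close>

lemma PiM_density:
  fixes f :: "'i \<Rightarrow> 'a \<Rightarrow> ennreal"
  assumes I: "finite I" and M: "\<And>i. sigma_finite_measure (M i)"
    and N: "\<And>i. sigma_finite_measure (density (M i) (f i))"
    and f[measurable]: "\<And>i. f i \<in> borel_measurable (M i)"
  shows "PiM I (\<lambda>i. density (M i) (f i)) = density (PiM I M) (\<lambda>x. \<Prod>i\<in>I. f i (x i))"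
proof -
  interpret M: product_sigma_finite M by (rule product_sigma_finite.intro) (rule M)
  interpret N: product_sigma_finite "\<lambda>i. density (M i) (f i)" by (rule product_sigma_finite.intro) (rule N)
  have m[measurable]: "(\<lambda>x. \<Prod>i\<in>I. f i (x i)) \<in> borel_measurable (PiM I M)" by measurable
  show ?thesis
  proof (rule N.PiM_eqI[symmetric, OF I])
    show "sets (density (PiM I M) (\<lambda>x. \<Prod>i\<in>I. f i (x i))) = PiM I (\<lambda>i. density (M i) (f i))"
      by (simp, intro sets_PiM_cong) auto
    fix A assume A: "\<And>i. i \<in> I \<Longrightarrow> A i \<in> sets (density (M i) (f i))"
    then have [measurable]: "i \<in> I \<Longrightarrow> A i \<in> sets (M i)" for i by simp
    have AI: "Pi\<^sub>E I A \<in> sets (PiM I M)" using I by (intro sets_PiM_I_finite) auto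
    have "emeasure (density (PiM I M) (\<lambda>x. \<Prod>i\<in>I. f i (x i))) (Pi\<^sub>E I A)
      = (\<integral>\<^sup>+x. (\<Prod>i\<in>I. f i (x i)) * indicator (Pi\<^sub>E I A) x \<partial>PiM I M)"
      using AI m by (simp add: emeasure_density)
    also have "\<dots> = (\<integral>\<^sup>+x. (\<Prod>i\<in>I. f i (x i) * indicator (A i) (x i)) \<partial>PiM I M)"
    proof (intro nn_integral_cong)
      fix x assume x: "x \<in> space (PiM I M)"
      show "(\<Prod>i\<in>I. f i (x i)) * indicator (Pi\<^sub>E I A) x = (\<Prod>i\<in>I. f i (x i) * indicator (A i) (x i))"
      proof (cases "x \<in> Pi\<^sub>E I A")
        case True
        then show ?thesis by (auto simp: PiE_iff intro!: prod.cong)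
      next
        case False
        with x obtain i where "i \<in> I" "x i \<notin> A i" by (auto simp: space_PiM PiE_iff)
        then have "(\<Prod>i\<in>I. f i (x i) * indicator (A i) (x i)) = 0" using I by (intro prod_zero) (auto intro!: bexI[of _ i])
        then show ?thesis using False by simp
      qed
    qed
    also have "\<dots> = (\<Prod>i\<in>I. \<integral>\<^sup>+x. f i x * indicator (A i) x \<partial>M i)"
      using I by (intro M.product_nn_integral_prod) auto
    also have "\<dots> = (\<Prod>i\<in>I. emeasure (density (M i) (f i)) (A i))"
      by (intro prod.cong refl) (simp add: emeasure_density)
    finally show "emeasure (density (PiM I M) (\<lambda>x. \<Prod>i\<in>I. f i (x i))) (Pi\<^sub>E I A) =
      (\<Prod>i\<in>I. emeasure (density (M i) (f i)) (A i))" .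
  qed
qed

abbreviation (input) lebesgue_vec :: "nat \<Rightarrow> (nat \<Rightarrow> real) measure" where
  "lebesgue_vec d \<equiv> (\<Pi>\<^sub>M i\<in>{..<d}. lborel)"

text \<open>With the other coordinates held fixed, the map is a translation of the coordinate \<open>i\<close>.\<close>

lemma nn_integral_shear:
  fixes c :: "('i \<Rightarrow> real) \<Rightarrow> real"
  assumes I: "finite I" "i \<in> I"
    and c[measurable]: "c \<in> borel_measurable (\<Pi>\<^sub>M i\<in>I. lborel)" and c_upd: "\<And>x t. c (x(i := t)) = c x"
    and g[measurable]: "g \<in> borel_measurable (\<Pi>\<^sub>M i\<in>I. lborel)"
  shows "(\<integral>\<^sup>+x. g (x(i := x i + c x)) \<partial>(\<Pi>\<^sub>M i\<in>I. lborel)) = (\<integral>\<^sup>+x. g x \<partial>(\<Pi>\<^sub>M i\<in>I. lborel))"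
proof -
  interpret L: product_sigma_finite "\<lambda>_. lborel :: real measure" ..
  let ?J = "I - {i}"
  have ins: "insert i ?J = I" using I by auto
  have [measurable]: "(\<lambda>x. x i) \<in> (\<Pi>\<^sub>M i\<in>I. lborel) \<rightarrow>\<^sub>M (borel :: real measure)"
    using measurable_component_singleton[OF I(2), of "\<lambda>_. lborel :: real measure"] by simp
  have sh[measurable]: "(\<lambda>x. x(i := x i + c x)) \<in> (\<Pi>\<^sub>M i\<in>I. lborel) \<rightarrow>\<^sub>M (\<Pi>\<^sub>M i\<in>I. lborel)"
    using I by (intro measurable_fun_upd[where J=I]) auto
  have "(\<integral>\<^sup>+x. g (x(i := x i + c x)) \<partial>(\<Pi>\<^sub>M i\<in>I. lborel)) =
      (\<integral>\<^sup>+x. (\<integral>\<^sup>+t. g (x(i := t + c x)) \<partial>lborel) \<partial>(\<Pi>\<^sub>M i\<in>?J. lborel))"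
    using L.product_nn_integral_insert[of ?J i "\<lambda>x. g (x(i := x i + c x))"] I
    unfolding ins by (simp add: c_upd)
  also have "\<dots> = (\<integral>\<^sup>+x. (\<integral>\<^sup>+t. g (x(i := t)) \<partial>lborel) \<partial>(\<Pi>\<^sub>M i\<in>?J. lborel))"
  proof (rule nn_integral_cong)
    fix x :: "'i \<Rightarrow> real" assume x: "x \<in> space (\<Pi>\<^sub>M i\<in>?J. lborel)"
    have "(\<lambda>t. x(i := t)) \<in> lborel \<rightarrow>\<^sub>M (\<Pi>\<^sub>M i\<in>I. lborel)"
      using x I by (intro measurable_fun_upd[where J="?J"]) auto
    then have [measurable]: "(\<lambda>t. g (x(i := t))) \<in> borel_measurable borel" by measurable
    show "(\<integral>\<^sup>+t. g (x(i := t + c x)) \<partial>lborel) = (\<integral>\<^sup>+t. g (x(i := t)) \<partial>lborel)"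
      by (subst (2) nn_integral_real_affine[of _ 1 "c x"]) (auto simp: add.commute)
  qed
  also have "\<dots> = (\<integral>\<^sup>+x. g x \<partial>(\<Pi>\<^sub>M i\<in>I. lborel))"
    using L.product_nn_integral_insert[of ?J i g] I unfolding ins by simp
  finally show ?thesis .
qed

text \<open>The conditional mean of the coordinate \<open>i\<close> given the preceding ones: \<open>(B y)\<^sub>j\<close> for \<open>i = m + j\<close>, and 0 for
  the coordinates outside the response block.\<close>

definition reg_mean :: "nat \<Rightarrow> (nat \<times> nat \<Rightarrow> real) \<Rightarrow> nat \<Rightarrow> (nat \<Rightarrow> real) \<Rightarrow> real" where
  "reg_mean m B i x = (if m \<le> i \<and> i < 2 * m then \<Sum>k<m. B (i - m, k) * x k else 0)"

definition reg_density :: "nat \<Rightarrow> nat \<Rightarrow> (nat \<times> nat \<Rightarrow> real) \<Rightarrow> (nat \<Rightarrow> real) \<Rightarrow> real" where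
  "reg_density d m B x = (\<Prod>i<d. std_normal_density (x i - reg_mean m B i x))"

definition reg :: "nat \<Rightarrow> nat \<Rightarrow> (nat \<times> nat \<Rightarrow> real) \<Rightarrow> (nat \<Rightarrow> real) measure" where
  "reg d m B = density (lebesgue_vec d) (\<lambda>x. ennreal (reg_density d m B x))"

text \<open>The derivative of the log density in the coefficient \<open>B (j, k)\<close>: residual times regressor.\<close>

definition reg_score :: "nat \<Rightarrow> (nat \<times> nat \<Rightarrow> real) \<Rightarrow> nat \<times> nat \<Rightarrow> (nat \<Rightarrow> real) \<Rightarrow> real" where
  "reg_score m B = (\<lambda>(j, k) x. (x (m + j) - reg_mean m B (m + j) x) * x k)"

abbreviation std_normal :: "real measure" where
  "std_normal \<equiv> density lborel (\<lambda>x. ennreal (std_normal_density x))"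

lemma borel_measurable_component [measurable]:
  "i < d \<Longrightarrow> (\<lambda>x. x i) \<in> borel_measurable (lebesgue_vec d)"
  using measurable_component_singleton[of i "{..<d}" "\<lambda>_. lborel :: real measure"] by simp

lemma reg_mean_measurable [measurable]:
  "2 * m \<le> d \<Longrightarrow> reg_mean m B i \<in> borel_measurable (lebesgue_vec d)"
  unfolding reg_mean_def[abs_def] by (cases "m \<le> i \<and> i < 2 * m") (auto intro!: borel_measurable_sum borel_measurable_times)

lemma reg_mean_upd: "m \<le> i \<Longrightarrow> reg_mean m B j (x(i := t)) = reg_mean m B j x"
  unfolding reg_mean_def by (auto intro!: sum.cong)

lemma reg_mean_cong: "(\<And>k. k < m \<Longrightarrow> x k = y k) \<Longrightarrow> reg_mean m B j x = reg_mean m B j y"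
  unfolding reg_mean_def by (auto intro!: sum.cong)

lemma reg_mean_0: "i < m \<Longrightarrow> reg_mean m B i x = 0" "2 * m \<le> i \<Longrightarrow> reg_mean m B i x = 0"
  unfolding reg_mean_def by auto

text \<open>The linear map that produces a sample of the regression model from standard normal noise.\<close>

definition reg_map :: "nat \<Rightarrow> nat \<Rightarrow> (nat \<times> nat \<Rightarrow> real) \<Rightarrow> (nat \<Rightarrow> real) \<Rightarrow> nat \<Rightarrow> real" where
  "reg_map d m B x = (\<lambda>i\<in>{..<d}. x i + reg_mean m B i x)"

lemma reg_map_measurable [measurable]:
  "2 * m \<le> d \<Longrightarrow> reg_map d m B \<in> lebesgue_vec d \<rightarrow>\<^sub>M lebesgue_vec d"
  unfolding reg_map_def[abs_def]
  by (intro measurable_restrict) (auto intro!: borel_measurable_add)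

lemma reg_mean_map: "2 * m \<le> d \<Longrightarrow> reg_mean m B i (reg_map d m B x) = reg_mean m B i x"
  by (rule reg_mean_cong) (simp add: reg_map_def reg_mean_0)

text \<open>The map is a composition of shears, one for each response coordinate, added one at a time. They do
  not interfere because each uses regressor coordinates only, which no shear changes.\<close>

lemma nn_integral_reg_map:
  assumes d: "2 * m \<le> d" and g: "g \<in> borel_measurable (lebesgue_vec d)"
  shows "(\<integral>\<^sup>+x. g (reg_map d m B x) \<partial>lebesgue_vec d) = (\<integral>\<^sup>+x. g x \<partial>lebesgue_vec d)"
proof -
  define T where "T = (\<lambda>J x. \<lambda>i\<in>{..<d}. x i + (if i \<in> J then reg_mean m B i x else 0))"
  have "finite J \<Longrightarrow> J \<subseteq> {m..<2 * m} \<Longrightarrow> g \<in> borel_measurable (lebesgue_vec d) \<Longrightarrow>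
    (\<integral>\<^sup>+x. g (T J x) \<partial>lebesgue_vec d) = (\<integral>\<^sup>+x. g x \<partial>lebesgue_vec d)" for J
  proof (induction J arbitrary: g rule: finite_induct)
    case empty
    show ?case by (intro nn_integral_cong arg_cong[of _ _ g])
      (auto simp: T_def space_PiM PiE_iff extensional_def fun_eq_iff restrict_def)
  next
    case (insert a J)
    note [measurable] = insert.prems(2)
    have a: "m \<le> a" "a < d" using insert.prems d by auto
    have [measurable]: "(\<lambda>x. x a) \<in> borel_measurable (lebesgue_vec d)"
        "reg_mean m B a \<in> borel_measurable (lebesgue_vec d)" using a d by auto
    have [measurable]: "(\<lambda>x. x(a := x a + reg_mean m B a x)) \<in> lebesgue_vec d \<rightarrow>\<^sub>M lebesgue_vec d"
      using a by (intro measurable_fun_upd[where J="{..<d}"]) auto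
    define g' where "g' = (\<lambda>x. g (x(a := x a + reg_mean m B a x)))"
    have [measurable]: "g' \<in> borel_measurable (lebesgue_vec d)" unfolding g'_def by measurable
    have "T (insert a J) x = (T J x)(a := T J x a + reg_mean m B a (T J x))" for x
    proof -
      have "reg_mean m B a (T J x) = reg_mean m B a x"
        using insert.prems(1) d by (intro reg_mean_cong) (auto simp: T_def)
      then show ?thesis using insert.hyps a by (auto simp: T_def fun_eq_iff)
    qed
    then have "(\<integral>\<^sup>+x. g (T (insert a J) x) \<partial>lebesgue_vec d) = (\<integral>\<^sup>+x. g' (T J x) \<partial>lebesgue_vec d)"
      by (simp add: g'_def)
    also have "\<dots> = (\<integral>\<^sup>+x. g' x \<partial>lebesgue_vec d)" using insert.prems by (intro insert.IH) auto
    also have "\<dots> = (\<integral>\<^sup>+x. g x \<partial>lebesgue_vec d)"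
      unfolding g'_def using a by (intro nn_integral_shear reg_mean_upd) auto
    finally show ?case .
  qed
  from this[OF _ _ g, of "{m..<2 * m}"]
  have "(\<integral>\<^sup>+x. g (T {m..<2 * m} x) \<partial>lebesgue_vec d) = (\<integral>\<^sup>+x. g x \<partial>lebesgue_vec d)" by simp
  moreover have "T {m..<2 * m} = reg_map d m B"
    by (auto simp: T_def reg_map_def fun_eq_iff reg_mean_def)
  ultimately show ?thesis by simp
qed

lemma reg_density_measurable [measurable]:
  "2 * m \<le> d \<Longrightarrow> reg_density d m B \<in> borel_measurable (lebesgue_vec d)"
  unfolding reg_density_def[abs_def]
  by (intro borel_measurable_prod measurable_compose[OF _ borel_measurable_normal_density] borel_measurable_diff) auto

lemma prob_space_std_normal: "prob_space std_normal"
  by (rule prob_space_normal_density) simp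

lemma std_normal_PiM: "PiM {..<d} (\<lambda>_. std_normal) = density (lebesgue_vec d) (\<lambda>x. \<Prod>i<d. ennreal (std_normal_density (x i)))"
  using prob_space_std_normal
  by (intro PiM_density) (auto intro: lborel.sigma_finite_measure_axioms prob_space_imp_sigma_finite)

lemma reg_eq_distr:
  assumes d: "2 * m \<le> d"
  shows "reg d m B = distr (PiM {..<d} (\<lambda>_. std_normal)) (lebesgue_vec d) (reg_map d m B)"
proof (rule measure_eqI)
  show "sets (reg d m B) = sets (distr (PiM {..<d} (\<lambda>_. std_normal)) (lebesgue_vec d) (reg_map d m B))"
    by (simp add: reg_def)
  fix A assume "A \<in> sets (reg d m B)"
  then have [measurable]: "A \<in> sets (lebesgue_vec d)" by (simp add: reg_def)
  note [measurable] = reg_map_measurable[OF d] reg_density_measurable[OF d]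
  have "emeasure (reg d m B) A = (\<integral>\<^sup>+x. ennreal (reg_density d m B x) * indicator A x \<partial>lebesgue_vec d)"
    unfolding reg_def by (intro emeasure_density) measurable
  also have "\<dots> = (\<integral>\<^sup>+x. ennreal (reg_density d m B (reg_map d m B x)) * indicator A (reg_map d m B x) \<partial>lebesgue_vec d)"
    by (rule nn_integral_reg_map[OF d, symmetric]) measurable
  also have "\<dots> = (\<integral>\<^sup>+x. (\<Prod>i<d. ennreal (std_normal_density (x i))) *
      indicator (reg_map d m B -` A \<inter> space (lebesgue_vec d)) x \<partial>lebesgue_vec d)"
  proof (intro nn_integral_cong)
    fix x assume x: "x \<in> space (lebesgue_vec d)"
    have "reg_density d m B (reg_map d m B x) = (\<Prod>i<d. std_normal_density (x i))"
      unfolding reg_density_def reg_mean_map[OF d] by (intro prod.cong) (auto simp: reg_map_def)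
    then show "ennreal (reg_density d m B (reg_map d m B x)) * indicator A (reg_map d m B x) =
      (\<Prod>i<d. ennreal (std_normal_density (x i))) * indicator (reg_map d m B -` A \<inter> space (lebesgue_vec d)) x"
      using x by (simp add: prod_ennreal indicator_def)
  qed
  also have "\<dots> = emeasure (PiM {..<d} (\<lambda>_. std_normal)) (reg_map d m B -` A \<inter> space (lebesgue_vec d))"
    unfolding std_normal_PiM by (subst emeasure_density) measurable
  also have "\<dots> = emeasure (distr (PiM {..<d} (\<lambda>_. std_normal)) (lebesgue_vec d) (reg_map d m B)) A"
    unfolding std_normal_PiM by (subst emeasure_distr) auto
  finally show "emeasure (reg d m B) A = emeasure (distr (PiM {..<d} (\<lambda>_. std_normal)) (lebesgue_vec d) (reg_map d m B)) A" .
qed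

lemma sets_std_normal_PiM [measurable_cong]: "sets (PiM {..<d} (\<lambda>_. std_normal)) = sets (lebesgue_vec d)"
  by (simp add: std_normal_PiM)

lemma reg_map_measurable' [measurable]:
  "2 * m \<le> d \<Longrightarrow> reg_map d m B \<in> PiM {..<d} (\<lambda>_. std_normal) \<rightarrow>\<^sub>M lebesgue_vec d"
  by measurable

lemma sets_reg [simp, measurable_cong]: "sets (reg d m B) = sets (lebesgue_vec d)"
  by (simp add: reg_def)

lemma prob_space_reg: "2 * m \<le> d \<Longrightarrow> prob_space (reg d m B)"
  unfolding reg_eq_distr
  by (intro prob_space.prob_space_distr prob_space_PiM prob_space_std_normal reg_map_measurable')

lemma std_normal_power:
  "integrable std_normal (\<lambda>x. x ^ k)"
  "(\<integral>x. x \<partial>std_normal) = 0" "(\<integral>x. x ^ 2 \<partial>std_normal) = 1"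
  using integrable_std_normal_moment[of k] std_normal_moment_odd[of 0] std_normal_moment_even[of 1]
  by (simp_all add: integrable_density integral_density has_bochner_integral_iff)

text \<open>Moments of independent normal variables are computed for monomials with an exponent for every
  coordinate, so that coinciding indices need no separate treatment.\<close>

lemma std_normal_monomial:
  fixes p :: "nat \<Rightarrow> nat"
  shows "integrable (PiM {..<d} (\<lambda>_. std_normal)) (\<lambda>x. \<Prod>i<d. x i ^ p i)"
  "(\<integral>x. (\<Prod>i<d. x i ^ p i) \<partial>PiM {..<d} (\<lambda>_. std_normal)) = (\<Prod>i<d. \<integral>x. x ^ p i \<partial>std_normal)"
proof -
  interpret product_prob_space "\<lambda>_::nat. std_normal"
    by (intro product_prob_spaceI prob_space_std_normal)
  show "integrable (PiM {..<d} (\<lambda>_. std_normal)) (\<lambda>x. \<Prod>i<d. x i ^ p i)"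
    by (rule product_integrable_prod[of _ "\<lambda>i t. t ^ p i"]) (auto intro: std_normal_power)
  show "(\<integral>x. (\<Prod>i<d. x i ^ p i) \<partial>PiM {..<d} (\<lambda>_. std_normal)) = (\<Prod>i<d. \<integral>x. x ^ p i \<partial>std_normal)"
    by (rule product_integral_prod[of _ "\<lambda>i t. t ^ p i"]) (auto intro: std_normal_power)
qed

lemma std_normal_monomial_zero:
  fixes p :: "nat \<Rightarrow> nat"
  assumes "a < d" "p a = 1"
  shows "(\<integral>x. (\<Prod>i<d. x i ^ p i) \<partial>PiM {..<d} (\<lambda>_. std_normal)) = 0"
  unfolding std_normal_monomial using assms std_normal_power(2) by (intro prod_zero[OF finite_lessThan] bexI[of _ a]) auto

lemma prod_power_delta: "a < (d::nat) \<Longrightarrow> (\<Prod>i<d. (x i :: real) ^ of_bool (i = a)) = x a"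
  by (simp add: prod.delta of_bool_def if_distrib cong: if_cong)

lemma reg_score_measurable [measurable]:
  "2 * m \<le> d \<Longrightarrow> j < m \<Longrightarrow> k < m \<Longrightarrow> reg_score m B (j, k) \<in> borel_measurable (lebesgue_vec d)"
  unfolding reg_score_def by (auto intro!: borel_measurable_times borel_measurable_diff)

lemma reg_score_map:
  assumes "2 * m \<le> d" "j < m" "k < m"
  shows "reg_score m B (j, k) (reg_map d m B x) = x (m + j) * x k"
  using assms unfolding reg_score_def reg_map_def[symmetric]
  by (simp add: reg_mean_map) (simp add: reg_map_def reg_mean_0)

text \<open>In terms of the noise the scores are products \<open>x (m + j) * x k\<close> of one coordinate of the response block
  and one regressor coordinate. The two index ranges are disjoint, so a product of two different scores has
  a coordinate with exponent 1, and its mean vanishes.\<close>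

lemma reg_score_moments:
  assumes d: "2 * m \<le> d" and jk: "j < m" "k < m" and jk': "j' < m" "k' < m"
  shows "(\<integral>x. reg_score m B (j, k) x \<partial>reg d m B) = 0"
    and "integrable (reg d m B) (\<lambda>x. reg_score m B (j, k) x * reg_score m B (j', k') x)"
    and "(\<integral>x. reg_score m B (j, k) x * reg_score m B (j', k') x \<partial>reg d m B) = of_bool ((j, k) = (j', k'))"
proof -
  let ?N = "PiM {..<d} (\<lambda>_. std_normal)"
  note [measurable] = reg_map_measurable'[OF d] reg_score_measurable[OF d jk] reg_score_measurable[OF d jk']
  note sc = reg_score_map[OF d jk] reg_score_map[OF d jk']
  have lt: "m + j < d" "k < d" "m + j' < d" "k' < d" using assms by auto
  define p where "p = (\<lambda>i. of_bool (i = m + j) + of_bool (i = k) :: nat)"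
  define q where "q = (\<lambda>i. of_bool (i = m + j) + of_bool (i = k) + (of_bool (i = m + j') + of_bool (i = k')) :: nat)"
  have mono1: "x (m + j) * x k = (\<Prod>i<d. x i ^ p i)" for x :: "nat \<Rightarrow> real"
    unfolding p_def power_add prod.distrib using lt by (simp only: prod_power_delta)
  have mono2: "(x (m + j) * x k) * (x (m + j') * x k') = (\<Prod>i<d. x i ^ q i)" for x :: "nat \<Rightarrow> real"
    unfolding q_def power_add prod.distrib using lt by (simp only: prod_power_delta)
  show "(\<integral>x. reg_score m B (j, k) x \<partial>reg d m B) = 0"
    unfolding reg_eq_distr[OF d]
    apply (subst integral_distr[OF reg_map_measurable'[OF d]],
        (intro borel_measurable_times reg_score_measurable d jk jk'))
    unfolding sc mono1
    using jk lt by (intro std_normal_monomial_zero[of "m + j"]) (auto simp: p_def)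
  show "integrable (reg d m B) (\<lambda>x. reg_score m B (j, k) x * reg_score m B (j', k') x)"
    unfolding reg_eq_distr[OF d]
    apply (subst integrable_distr_eq[OF reg_map_measurable'[OF d]],
        (intro borel_measurable_times reg_score_measurable d jk jk'))
    unfolding sc mono2 by (rule std_normal_monomial)
  have "(\<integral>x. reg_score m B (j, k) x * reg_score m B (j', k') x \<partial>reg d m B) = (\<integral>x. (\<Prod>i<d. x i ^ q i) \<partial>?N)"
    unfolding reg_eq_distr[OF d]
    apply (subst integral_distr[OF reg_map_measurable'[OF d]],
        (intro borel_measurable_times reg_score_measurable d jk jk'))
    unfolding sc mono2 ..
  also have "\<dots> = of_bool ((j, k) = (j', k'))"
  proof (cases "(j, k) = (j', k')")
    case True
    have "(\<integral>x. (\<Prod>i<d. x i ^ q i) \<partial>?N) = (\<Prod>i<d. \<integral>x. x ^ q i \<partial>std_normal)" by (rule std_normal_monomial)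
    also have "\<dots> = 1"
    proof (rule prod.neutral, rule)
      fix i
      have "q i = 0 \<or> q i = 2" using True jk by (auto simp: q_def of_bool_def)
      then show "(\<integral>x. x ^ q i \<partial>std_normal) = 1"
        using std_normal_power(3) prob_space.prob_space[OF prob_space_std_normal] by auto
    qed
    finally show ?thesis using True by simp
  next
    case False
    then have "j \<noteq> j' \<or> k \<noteq> k'" by auto
    then have "(q (m + j) = 1 \<or> q k = 1)" using jk jk' by (auto simp: q_def of_bool_def)
    then have "(\<integral>x. (\<Prod>i<d. x i ^ q i) \<partial>?N) = 0" using std_normal_monomial_zero lt by blast
    then show ?thesis using False by simp
  qed
  finally show "(\<integral>x. reg_score m B (j, k) x * reg_score m B (j', k') x \<partial>reg d m B) = of_bool ((j, k) = (j', k'))" .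
qed

section \<open>The posterior identity\<close>

text \<open>The integrand is, up to sign, the derivative of the exponential. Completing the square shows the same as the vanishing
  first central moment of a normal distribution.\<close>

lemma gaussian_centred_integral:
  fixes a c k :: real
  assumes a: "0 < a"
  shows "(\<integral>b. exp (- (a * b\<^sup>2 / 2 - c * b + k)) * (a * b - c) \<partial>lborel) = 0"
proof -
  define \<mu> where "\<mu> = c / a"
  define \<sigma> where "\<sigma> = 1 / sqrt a"
  define K where "K = exp (c\<^sup>2 / (2 * a) - k) * sqrt (2 * pi / a) * a"
  have \<sigma>: "0 < \<sigma>" "\<sigma>\<^sup>2 = 1 / a" using a by (auto simp: \<sigma>_def power_divide)
  have "exp (- (a * b\<^sup>2 / 2 - c * b + k)) * (a * b - c) = K * (normal_density \<mu> \<sigma> b * (b - \<mu>) ^ (2 * 0 + 1))" for b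
  proof -
    have e: "- (a * b\<^sup>2 / 2 - c * b + k) = (c\<^sup>2 / (2 * a) - k) + (- (b - \<mu>)\<^sup>2 / (2 * \<sigma>\<^sup>2))"
      using a unfolding \<sigma> \<mu>_def by (simp add: field_simps power2_eq_square)
    have l: "a * b - c = a * (b - \<mu>)" using a by (simp add: \<mu>_def field_simps)
    have sq: "sqrt (2 * pi * \<sigma>\<^sup>2) = sqrt (2 * pi / a)" "sqrt (2 * pi / a) \<noteq> 0" using a by (simp_all add: \<sigma>)
    show ?thesis unfolding e exp_add l normal_density_def K_def sq(1) using sq(2) by (simp add: field_simps)
  qed
  then show ?thesis using integral_normal_moment_odd[OF \<sigma>(1), of \<mu> 0] by simp
qed

abbreviation (input) normal_prior :: "real \<Rightarrow> real measure" where
  "normal_prior s \<equiv> density lborel (\<lambda>b. ennreal (normal_density 0 s b))"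

abbreviation (input) coeff_index :: "nat \<Rightarrow> (nat \<times> nat) set" where
  "coeff_index m \<equiv> {..<m} \<times> {..<m}"

lemma orthonormal_reg: "2 * m \<le> d \<Longrightarrow> orthonormal_scores (reg d m B) (coeff_index m) (reg_score m B)"
  using reg_score_moments reg_score_measurable
  by (intro orthonormal_scores.intro prob_space_reg orthonormal_scores_axioms.intro) (auto cong: measurable_cong_sets)

lemma reg_mean_update_same:
  assumes "j < m" "k < m"
  shows "reg_mean m (B((j, k) := b)) (m + j) x = reg_mean m (B((j, k) := 0)) (m + j) x + b * x k"
proof -
  have "(\<Sum>l<m. (B((j, k) := b)) (j, l) * x l) = (\<Sum>l<m. (B((j, k) := 0)) (j, l) * x l + (if l = k then b * x k else 0))"
    by (intro sum.cong) auto
  also have "\<dots> = (\<Sum>l<m. (B((j, k) := 0)) (j, l) * x l) + b * x k"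
    using assms by (simp add: sum.distrib)
  finally show ?thesis using assms by (simp add: reg_mean_def)
qed

lemma reg_mean_update_other:
  assumes "i \<noteq> m + j"
  shows "reg_mean m (B((j, k) := b)) i x = reg_mean m B i x"
proof -
  from assms have "m \<le> i \<Longrightarrow> i - m \<noteq> j" by auto
  then show ?thesis by (auto simp: reg_mean_def intro!: sum.cong)
qed

text \<open>For given data the prior times the likelihood is, as a function of the single coefficient \<open>b\<close>, the
  exponential of a quadratic polynomial, because \<open>b\<close> enters only the residuals of the response \<open>j\<close>, and
  linearly. The second factor is minus its logarithmic derivative.\<close>

lemma posterior_score_integral:
  fixes X :: "nat \<Rightarrow> nat \<Rightarrow> real" and B :: "nat \<times> nat \<Rightarrow> real"
  assumes d: "2 * m \<le> d" and s: "0 < s" and jk: "j < m" "k < m"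
  defines "C \<equiv> \<lambda>b. B((j, k) := b)"
  shows "(\<integral>b. normal_density 0 s b * ((\<Prod>i<n. reg_density d m (C b) (X i)) *
     (b / s\<^sup>2 - (\<Sum>i<n. reg_score m (C b) (j, k) (X i)))) \<partial>lborel) = 0"
proof -
  define r where "r = (\<lambda>i. X i (m + j) - reg_mean m (B((j, k) := 0)) (m + j) (X i))"
  define y where "y = (\<lambda>i. X i k)"
  define A where "A = (\<Prod>i<n. \<Prod>l\<in>{..<d} - {m + j}. std_normal_density (X i l - reg_mean m B l (X i)))"
  define a where "a = 1 / s\<^sup>2 + (\<Sum>i<n. (y i)\<^sup>2)"
  define c where "c = (\<Sum>i<n. r i * y i)"
  define q where "q = (\<Sum>i<n. (r i)\<^sup>2) / 2"
  define K where "K = A * (1 / sqrt (2 * pi)) ^ n / sqrt (2 * pi * s\<^sup>2)"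
  have a: "0 < a" unfolding a_def using s by (intro add_pos_nonneg sum_nonneg) auto
  have lt: "m + j \<in> {..<d}" using d jk by auto
  have res: "X i (m + j) - reg_mean m (C b) (m + j) (X i) = r i - b * y i" for i b
    unfolding C_def by (subst reg_mean_update_same[OF jk]) (simp add: r_def y_def)
  have "normal_density 0 s b * ((\<Prod>i<n. reg_density d m (C b) (X i)) *
      (b / s\<^sup>2 - (\<Sum>i<n. reg_score m (C b) (j, k) (X i))))
    = K * (exp (- (a * b\<^sup>2 / 2 - c * b + q)) * (a * b - c))" for b
  proof -
    have score: "reg_score m (C b) (j, k) (X i) = r i * y i - b * (y i)\<^sup>2" for i
      unfolding reg_score_def by (simp add: res) (simp add: y_def algebra_simps power2_eq_square)
    have sc: "b / s\<^sup>2 - (\<Sum>i<n. reg_score m (C b) (j, k) (X i)) = a * b - c"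
      unfolding score a_def c_def by (simp add: sum_subtractf algebra_simps sum_distrib_left)
    have one: "reg_density d m (C b) (X i) =
      std_normal_density (r i - b * y i) * (\<Prod>l\<in>{..<d} - {m + j}. std_normal_density (X i l - reg_mean m B l (X i)))" for i
    proof -
      have "reg_density d m (C b) (X i) = std_normal_density (X i (m + j) - reg_mean m (C b) (m + j) (X i)) *
        (\<Prod>l\<in>{..<d} - {m + j}. std_normal_density (X i l - reg_mean m (C b) l (X i)))"
        unfolding reg_density_def using lt by (intro prod.remove) auto
      also have "(\<Prod>l\<in>{..<d} - {m + j}. std_normal_density (X i l - reg_mean m (C b) l (X i))) =
         (\<Prod>l\<in>{..<d} - {m + j}. std_normal_density (X i l - reg_mean m B l (X i)))"
        unfolding C_def by (intro prod.cong refl) (simp add: reg_mean_update_other)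
      finally show ?thesis by (simp only: res)
    qed
    have snd: "std_normal_density t = (1 / sqrt (2 * pi)) * exp (- t\<^sup>2 / 2)" for t
      by (simp add: std_normal_density_def)
    have nd: "normal_density 0 s b = exp (- b\<^sup>2 / (2 * s\<^sup>2)) / sqrt (2 * pi * s\<^sup>2)"
      by (simp add: normal_density_def)
    have ex: "- b\<^sup>2 / (2 * s\<^sup>2) + (\<Sum>i<n. - (r i - b * y i)\<^sup>2 / 2) = - (a * b\<^sup>2 / 2 - c * b + q)"
    proof -
      have "(\<Sum>i<n. - (r i - b * y i)\<^sup>2 / 2) = (\<Sum>i<n. b * (r i * y i) - ((r i)\<^sup>2 / 2 + b\<^sup>2 / 2 * (y i)\<^sup>2))"
        by (intro sum.cong refl) (simp add: power2_eq_square field_simps)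
      also have "\<dots> = b * c - (q + b\<^sup>2 / 2 * (\<Sum>i<n. (y i)\<^sup>2))"
        unfolding c_def q_def by (simp add: sum_subtractf sum.distrib sum_distrib_left sum_divide_distrib)
      finally show ?thesis unfolding a_def by (simp add: algebra_simps add_divide_distrib)
    qed
    have "normal_density 0 s b * (\<Prod>i<n. reg_density d m (C b) (X i)) =
      K * (exp (- b\<^sup>2 / (2 * s\<^sup>2)) * (\<Prod>i<n. exp (- (r i - b * y i)\<^sup>2 / 2)))"
      unfolding one prod.distrib A_def[symmetric] unfolding nd snd K_def by (simp add: power_divide prod_dividef mult_ac)
    also have "\<dots> = K * exp (- (a * b\<^sup>2 / 2 - c * b + q))"
      unfolding exp_sum[OF finite_lessThan, symmetric] exp_add[symmetric] ex ..
    finally show ?thesis unfolding sc by (simp add: mult.assoc[symmetric])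
  qed
  then show ?thesis using gaussian_centred_integral[OF a, of c q] by simp
qed

lemma PiM_reg:
  fixes n :: nat
  assumes d: "2 * m \<le> d"
  shows "(\<Pi>\<^sub>M i\<in>{..<n}. reg d m B) =
    density (\<Pi>\<^sub>M i\<in>{..<n}. lebesgue_vec d) (\<lambda>X. ennreal (\<Prod>i<n. reg_density d m B (X i)))"
proof -
  interpret L: product_sigma_finite "\<lambda>_::nat. lborel :: real measure" ..
  have nn: "0 \<le> reg_density d m B x" for x unfolding reg_density_def by (intro prod_nonneg) simp
  have "(\<Pi>\<^sub>M i\<in>{..<n}. reg d m B) = density (\<Pi>\<^sub>M i\<in>{..<n}. lebesgue_vec d) (\<lambda>X. \<Prod>i<n. ennreal (reg_density d m B (X i)))"
    unfolding reg_def
  proof (rule PiM_density)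
    show "sigma_finite_measure (lebesgue_vec d)" by (rule L.sigma_finite) simp
    show "sigma_finite_measure (density (lebesgue_vec d) (\<lambda>x. ennreal (reg_density d m B x)))"
      using prob_space_reg[OF d, of B] by (simp add: reg_def prob_space_imp_sigma_finite)
  qed (use reg_density_measurable[OF d] in auto)
  then show ?thesis by (simp add: prod_ennreal nn)
qed

lemma reg_mean_joint_measurable:
  assumes "2 * m \<le> d" and f: "f \<in> R \<rightarrow>\<^sub>M (\<Pi>\<^sub>M e\<in>coeff_index m. lborel)" and g: "g \<in> R \<rightarrow>\<^sub>M lebesgue_vec d"
  shows "(\<lambda>z. reg_mean m (f z) i (g z)) \<in> borel_measurable R"
proof (cases "m \<le> i \<and> i < 2 * m")
  case True
  have "(\<lambda>z. f z (i - m, k) * g z k) \<in> borel_measurable R" if k: "k < m" for k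
  proof -
    have "(\<lambda>z. f z (i - m, k)) \<in> borel_measurable R"
      using measurable_compose[OF f measurable_component_singleton[of "(i - m, k)"]] True k by auto
    moreover have "(\<lambda>z. g z k) \<in> borel_measurable R"
      using measurable_compose[OF g measurable_component_singleton[of k]] assms(1) k by auto
    ultimately show ?thesis by measurable
  qed
  then show ?thesis using True by (simp add: reg_mean_def borel_measurable_sum)
next
  case False
  then have "(\<lambda>z. reg_mean m (f z) i (g z)) = (\<lambda>z. 0)" by (auto simp: reg_mean_def)
  then show ?thesis by simp
qed

context
  fixes d m n :: nat and s :: real and h :: "(nat \<Rightarrow> nat \<Rightarrow> real) \<Rightarrow> real" and e :: "nat \<times> nat"
  assumes d: "2 * m \<le> d" and s: "0 < s" and e: "e \<in> coeff_index m"
    and h[measurable]: "h \<in> borel_measurable (\<Pi>\<^sub>M i\<in>{..<n}. lebesgue_vec d)"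
    and h1: "\<And>X. X \<in> space (\<Pi>\<^sub>M i\<in>{..<n}. lebesgue_vec d) \<Longrightarrow> \<bar>h X\<bar> \<le> 1"
begin

text \<open>The function whose mean over the prior and the data vanishes: a statistic \<open>h\<close> of the data times minus the
  derivative, in the coefficient \<open>e\<close>, of the log of prior density times likelihood.\<close>

definition posterior_gap :: "(nat \<times> nat \<Rightarrow> real) \<Rightarrow> (nat \<Rightarrow> nat \<Rightarrow> real) \<Rightarrow> real" where
  "posterior_gap B X = h X * (B e / s\<^sup>2 - (\<Sum>i<n. reg_score m B e (X i)))"

lemma sets_data: "sets (\<Pi>\<^sub>M i\<in>{..<n}. reg d m B) = sets (\<Pi>\<^sub>M i\<in>{..<n}. lebesgue_vec d)"
  by (intro sets_PiM_cong) auto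

lemma posterior_gap_joint_measurable:
  assumes f: "f \<in> R \<rightarrow>\<^sub>M (\<Pi>\<^sub>M e\<in>coeff_index m. lborel)" and g: "g \<in> R \<rightarrow>\<^sub>M (\<Pi>\<^sub>M i\<in>{..<n}. lebesgue_vec d)"
  shows "(\<lambda>z. posterior_gap (f z) (g z)) \<in> borel_measurable R"
    and "(\<lambda>z. \<Prod>i<n. reg_density d m (f z) (g z i)) \<in> borel_measurable R"
proof -
  have gi: "(\<lambda>z. g z i) \<in> R \<rightarrow>\<^sub>M lebesgue_vec d" if "i < n" for i
    using measurable_compose[OF g measurable_component_singleton[of i]] that by auto
  have gil: "(\<lambda>z. g z i l) \<in> borel_measurable R" if "i < n" "l < d" for i l
    using measurable_compose[OF gi[OF that(1)] measurable_component_singleton[of l]] that by auto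
  have mean: "(\<lambda>z. reg_mean m (f z) l (g z i)) \<in> borel_measurable R" if "i < n" for i l
    by (rule reg_mean_joint_measurable[OF d f gi[OF that]])
  show "(\<lambda>z. \<Prod>i<n. reg_density d m (f z) (g z i)) \<in> borel_measurable R"
    unfolding reg_density_def using gil mean
    by (intro borel_measurable_prod measurable_compose[OF _ borel_measurable_normal_density] borel_measurable_diff) auto
  have fe: "(\<lambda>z. f z e) \<in> borel_measurable R"
    using measurable_compose[OF f measurable_component_singleton[OF e]] by simp
  obtain j k where jk: "e = (j, k)" "j < m" "k < m" using e by auto
  have sc: "(\<lambda>z. reg_score m (f z) e (g z i)) \<in> borel_measurable R" if "i < n" for i
    unfolding jk reg_score_def prod.case using d jk that
    by (intro borel_measurable_times borel_measurable_diff gil mean) auto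
  have "(\<lambda>z. h (g z)) \<in> borel_measurable R" by (rule measurable_compose[OF g h])
  then show "(\<lambda>z. posterior_gap (f z) (g z)) \<in> borel_measurable R"
    unfolding posterior_gap_def using fe sc
    by (intro borel_measurable_times borel_measurable_diff borel_measurable_sum borel_measurable_divide) auto
qed

lemma posterior_gap_bound:
  assumes B: "B \<in> space (\<Pi>\<^sub>M e\<in>coeff_index m. lborel)"
  shows "integrable (\<Pi>\<^sub>M i\<in>{..<n}. reg d m B) (posterior_gap B)"
    and "(\<integral>X. \<bar>posterior_gap B X\<bar> \<partial>(\<Pi>\<^sub>M i\<in>{..<n}. reg d m B)) \<le> \<bar>B e\<bar> / s\<^sup>2 + n"
proof -
  interpret orthonormal_scores "reg d m B" "coeff_index m" "reg_score m B" by (rule orthonormal_reg[OF d])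
  let ?D = "\<Pi>\<^sub>M i\<in>{..<n}. reg d m B"
  interpret D: prob_space ?D by (rule prob_space_PiM) (rule prob_space_axioms)
  let ?G = "\<lambda>X. \<bar>B e\<bar> / s\<^sup>2 + (\<Sum>i<n. \<bar>reg_score m B e (X i)\<bar>)"
  have abs: "integrable (reg d m B) (\<lambda>x. \<bar>reg_score m B e x\<bar>)" using score_integrable[OF e] by auto
  note comp = integrable_PiM_component[OF prob_space_axioms _ abs, of _ "{..<n}"]
  have IG: "integrable ?D ?G"
    by (intro Bochner_Integration.integrable_add D.integrable_const Bochner_Integration.integrable_sum comp(1))
  have [measurable]: "posterior_gap B \<in> borel_measurable ?D"
    using posterior_gap_joint_measurable(1)[of "\<lambda>_. B" "\<Pi>\<^sub>M i\<in>{..<n}. lebesgue_vec d" "\<lambda>x. x"] B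
    by (simp cong: measurable_cong_sets[OF sets_data refl])
  have le: "\<bar>posterior_gap B X\<bar> \<le> ?G X" if "X \<in> space ?D" for X
  proof -
    have "\<bar>h X\<bar> \<le> 1" using h1 that sets_eq_imp_space_eq[OF sets_data] by blast
    then have "\<bar>posterior_gap B X\<bar> \<le> \<bar>B e / s\<^sup>2 - (\<Sum>i<n. reg_score m B e (X i))\<bar>"
      unfolding posterior_gap_def abs_mult by (intro mult_left_le_one_le) auto
    also have "\<dots> \<le> \<bar>B e / s\<^sup>2\<bar> + \<bar>\<Sum>i<n. reg_score m B e (X i)\<bar>" by (rule abs_triangle_ineq4)
    also have "\<dots> \<le> ?G X" using s by (intro add_mono sum_abs) (simp add: abs_divide)
    finally show ?thesis .
  qed
  show I: "integrable ?D (posterior_gap B)"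
    by (rule Bochner_Integration.integrable_bound[OF IG]) (auto intro!: AE_I2 order_trans[OF le])
  have "(\<integral>X. \<bar>posterior_gap B X\<bar> \<partial>?D) \<le> (\<integral>X. ?G X \<partial>?D)"
    using I IG le by (intro integral_mono) auto
  also have "\<dots> = (\<integral>X. \<bar>B e\<bar> / s\<^sup>2 \<partial>?D) + (\<integral>X. (\<Sum>i<n. \<bar>reg_score m B e (X i)\<bar>) \<partial>?D)"
    by (intro Bochner_Integration.integral_add D.integrable_const Bochner_Integration.integrable_sum comp(1))
  also have "(\<integral>X. (\<Sum>i<n. \<bar>reg_score m B e (X i)\<bar>) \<partial>?D) = (\<Sum>i<n. \<integral>X. \<bar>reg_score m B e (X i)\<bar> \<partial>?D)"
    by (intro Bochner_Integration.integral_sum comp(1))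
  also have "(\<integral>X. \<bar>B e\<bar> / s\<^sup>2 \<partial>?D) = \<bar>B e\<bar> / s\<^sup>2" by (simp add: D.prob_space)
  also have "(\<Sum>i<n. \<integral>X. \<bar>reg_score m B e (X i)\<bar> \<partial>?D) = (\<Sum>i<n. \<integral>x. \<bar>reg_score m B e x\<bar> \<partial>reg d m B)"
    by (intro sum.cong refl comp(2))
  also have "\<bar>B e\<bar> / s\<^sup>2 + (\<Sum>i<n. \<integral>x. \<bar>reg_score m B e x\<bar> \<partial>reg d m B) \<le> \<bar>B e\<bar> / s\<^sup>2 + n"
    using sum_mono[of "{..<n}", OF score_abs_mean[OF e]] by simp
  finally show "(\<integral>X. \<bar>posterior_gap B X\<bar> \<partial>?D) \<le> \<bar>B e\<bar> / s\<^sup>2 + n" .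
qed

lemma posterior_gap_density:
  assumes B: "B \<in> space (\<Pi>\<^sub>M e\<in>coeff_index m. lborel)"
  defines "L \<equiv> \<lambda>X. \<Prod>i<n. reg_density d m B (X i)"
  shows "integrable (\<Pi>\<^sub>M i\<in>{..<n}. lebesgue_vec d) (\<lambda>X. L X * posterior_gap B X)"
    and "(\<integral>X. L X * posterior_gap B X \<partial>(\<Pi>\<^sub>M i\<in>{..<n}. lebesgue_vec d)) =
      (\<integral>X. posterior_gap B X \<partial>(\<Pi>\<^sub>M i\<in>{..<n}. reg d m B))"
    and "(\<integral>X. \<bar>L X * posterior_gap B X\<bar> \<partial>(\<Pi>\<^sub>M i\<in>{..<n}. lebesgue_vec d)) =
      (\<integral>X. \<bar>posterior_gap B X\<bar> \<partial>(\<Pi>\<^sub>M i\<in>{..<n}. reg d m B))"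
proof -
  have L0: "0 \<le> L X" for X unfolding L_def reg_density_def by (intro prod_nonneg) (auto intro!: prod_nonneg)
  have [measurable]: "L \<in> borel_measurable (\<Pi>\<^sub>M i\<in>{..<n}. lebesgue_vec d)"
     "posterior_gap B \<in> borel_measurable (\<Pi>\<^sub>M i\<in>{..<n}. lebesgue_vec d)"
    using posterior_gap_joint_measurable[of "\<lambda>_. B" "\<Pi>\<^sub>M i\<in>{..<n}. lebesgue_vec d" "\<lambda>x. x"] B
    by (simp_all add: L_def[abs_def])
  have D: "(\<Pi>\<^sub>M i\<in>{..<n}. reg d m B) = density (\<Pi>\<^sub>M i\<in>{..<n}. lebesgue_vec d) (\<lambda>X. ennreal (L X))"
    unfolding L_def by (rule PiM_reg[OF d])
  show "integrable (\<Pi>\<^sub>M i\<in>{..<n}. lebesgue_vec d) (\<lambda>X. L X * posterior_gap B X)"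
    using posterior_gap_bound(1)[OF B] unfolding D by (subst (asm) integrable_density) (auto simp: L0 intro!: AE_I2)
  show "(\<integral>X. L X * posterior_gap B X \<partial>(\<Pi>\<^sub>M i\<in>{..<n}. lebesgue_vec d)) =
      (\<integral>X. posterior_gap B X \<partial>(\<Pi>\<^sub>M i\<in>{..<n}. reg d m B))"
    unfolding D by (subst integral_density) (auto simp: L0 intro!: AE_I2)
  show "(\<integral>X. \<bar>L X * posterior_gap B X\<bar> \<partial>(\<Pi>\<^sub>M i\<in>{..<n}. lebesgue_vec d)) =
      (\<integral>X. \<bar>posterior_gap B X\<bar> \<partial>(\<Pi>\<^sub>M i\<in>{..<n}. reg d m B))"
    unfolding D by (subst integral_density) (auto simp: L0 abs_mult intro!: AE_I2)
qed

lemma sigma_finite_lebesgue_data: "sigma_finite_measure (\<Pi>\<^sub>M i\<in>{..<n}. lebesgue_vec d)"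
proof -
  interpret L: product_sigma_finite "\<lambda>_::nat. lborel :: real measure" ..
  interpret LL: product_sigma_finite "\<lambda>_::nat. lebesgue_vec d"
    by (intro product_sigma_finite.intro L.sigma_finite) simp
  show ?thesis by (rule LL.sigma_finite) simp
qed

text \<open>Exchange the integrals over the data and over the coefficient \<open>b\<close>. For given data \<open>h\<close> is a constant,
  and the inner integral is the vanishing posterior score.\<close>

lemma posterior_gap_average_coordinate:
  assumes B: "B \<in> space (\<Pi>\<^sub>M e\<in>coeff_index m. lborel)"
  shows "(\<integral>b. (\<integral>X. posterior_gap (B(e := b)) X \<partial>(\<Pi>\<^sub>M i\<in>{..<n}. reg d m (B(e := b)))) \<partial>normal_prior s) = 0"
proof -
  let ?N = "\<Pi>\<^sub>M i\<in>{..<n}. lebesgue_vec d"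
  interpret N: sigma_finite_measure ?N by (rule sigma_finite_lebesgue_data)
  interpret P: pair_sigma_finite lborel ?N ..
  define C where "C = (\<lambda>b. B(e := b))"
  have C: "C b \<in> space (\<Pi>\<^sub>M e\<in>coeff_index m. lborel)" for b
    using B e by (auto simp: C_def space_PiM PiE_iff extensional_def)
  have Cm: "C \<in> lborel \<rightarrow>\<^sub>M (\<Pi>\<^sub>M e\<in>coeff_index m. lborel)"
    unfolding C_def using B e by (intro measurable_fun_upd[where J="coeff_index m"]) auto
  define L where "L = (\<lambda>b X. \<Prod>i<n. reg_density d m (C b) (X i))"
  define G where "G = (\<lambda>b X. normal_density 0 s b * (L b X * posterior_gap (C b) X))"
  have fs: "(\<lambda>z. C (fst z)) \<in> lborel \<Otimes>\<^sub>M ?N \<rightarrow>\<^sub>M (\<Pi>\<^sub>M e\<in>coeff_index m. lborel)"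
    by (rule measurable_compose[OF measurable_fst Cm])
  note jm = posterior_gap_joint_measurable[OF fs measurable_snd]
  have Gm: "(\<lambda>z. G (fst z) (snd z)) \<in> borel_measurable (lborel \<Otimes>\<^sub>M ?N)"
    unfolding G_def L_def using jm
    by (intro borel_measurable_times measurable_compose[OF measurable_fst] borel_measurable_normal_density) auto
  have IG: "integrable (lborel \<Otimes>\<^sub>M ?N) (\<lambda>(b, X). G b X)"
  proof (rule P.Fubini_integrable)
    show "(\<lambda>(b, X). G b X) \<in> borel_measurable (lborel \<Otimes>\<^sub>M ?N)" using Gm by (simp add: case_prod_beta')
    show "AE b in lborel. integrable ?N (\<lambda>X. case (b, X) of (b, X) \<Rightarrow> G b X)"
      using posterior_gap_density(1)[OF C] by (auto simp: G_def L_def)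
    show "integrable lborel (\<lambda>b. \<integral>X. norm (case (b, X) of (b, X) \<Rightarrow> G b X) \<partial>?N)"
    proof (rule Bochner_Integration.integrable_bound)
      have "integrable lborel (\<lambda>b. normal_density 0 s b * \<bar>b\<bar>)"
        using integrable_normal_moment_abs[OF s, of 0 1] by simp
      then show "integrable lborel (\<lambda>b. normal_density 0 s b * \<bar>b\<bar> / s\<^sup>2 + normal_density 0 s b * n)"
        using integrable_normal_density[OF s, of 0] by auto
      show "(\<lambda>b. \<integral>X. norm (case (b, X) of (b, X) \<Rightarrow> G b X) \<partial>?N) \<in> borel_measurable lborel"
        using Gm by (intro N.borel_measurable_lebesgue_integral) (simp add: case_prod_beta')
      show "AE b in lborel. norm (\<integral>X. norm (case (b, X) of (b, X) \<Rightarrow> G b X) \<partial>?N)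
          \<le> norm (normal_density 0 s b * \<bar>b\<bar> / s\<^sup>2 + normal_density 0 s b * n)"
      proof (rule AE_I2)
        fix b :: real
        have "(\<integral>X. norm (G b X) \<partial>?N) = normal_density 0 s b * (\<integral>X. \<bar>L b X * posterior_gap (C b) X\<bar> \<partial>?N)"
          unfolding G_def by (simp add: abs_mult)
        also have "\<dots> \<le> normal_density 0 s b * (\<bar>C b e\<bar> / s\<^sup>2 + n)"
          unfolding L_def posterior_gap_density(3)[OF C] by (intro mult_left_mono posterior_gap_bound C) simp
        finally show "norm (\<integral>X. norm (case (b, X) of (b, X) \<Rightarrow> G b X) \<partial>?N)
          \<le> norm (normal_density 0 s b * \<bar>b\<bar> / s\<^sup>2 + normal_density 0 s b * n)"
          by (simp add: C_def algebra_simps)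
      qed
    qed
  qed
  have inner: "(\<integral>b. G b X \<partial>lborel) = 0" for X
  proof -
    obtain j k where jk: "e = (j, k)" "j < m" "k < m" using e by auto
    have "(\<integral>b. G b X \<partial>lborel) = (\<integral>b. h X * (normal_density 0 s b * (L b X *
        (b / s\<^sup>2 - (\<Sum>i<n. reg_score m (C b) e (X i))))) \<partial>lborel)"
      by (simp add: G_def posterior_gap_def C_def algebra_simps)
    also have "\<dots> = 0"
      using posterior_score_integral[OF d s jk(2,3), where B=B and n=n and X=X] by (simp add: L_def C_def jk)
    finally show ?thesis .
  qed
  have "(\<integral>b. (\<integral>X. posterior_gap (C b) X \<partial>(\<Pi>\<^sub>M i\<in>{..<n}. reg d m (C b))) \<partial>normal_prior s)
      = (\<integral>b. normal_density 0 s b * (\<integral>X. L b X * posterior_gap (C b) X \<partial>?N) \<partial>lborel)"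
    unfolding L_def posterior_gap_density(2)[OF C]
  proof (subst integral_density)
    have "(\<lambda>b. \<integral>X. L b X * posterior_gap (C b) X \<partial>?N) \<in> borel_measurable lborel"
      using jm by (intro N.borel_measurable_lebesgue_integral) (simp add: case_prod_beta' L_def)
    then show "(\<lambda>b. \<integral>X. posterior_gap (C b) X \<partial>(\<Pi>\<^sub>M i\<in>{..<n}. reg d m (C b))) \<in> borel_measurable lborel"
      unfolding L_def posterior_gap_density(2)[OF C] .
  qed auto
  also have "\<dots> = (\<integral>b. (\<integral>X. G b X \<partial>?N) \<partial>lborel)" by (simp add: G_def)
  also have "\<dots> = (\<integral>X. (\<integral>b. G b X \<partial>lborel) \<partial>?N)"
    using P.Fubini_integral[OF IG] by simp
  also have "\<dots> = 0" unfolding inner by simp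
  finally show ?thesis unfolding C_def .
qed

text \<open>The other coefficients are integrated last, which reduces the identity to a single coefficient.\<close>

lemma posterior_gap_average:
  defines "\<Phi> \<equiv> \<lambda>B. \<integral>X. posterior_gap B X \<partial>(\<Pi>\<^sub>M i\<in>{..<n}. reg d m B)"
  shows "integrable (\<Pi>\<^sub>M e\<in>coeff_index m. normal_prior s) \<Phi>"
    and "(\<integral>B. \<Phi> B \<partial>(\<Pi>\<^sub>M e\<in>coeff_index m. normal_prior s)) = 0"
proof -
  let ?N = "\<Pi>\<^sub>M i\<in>{..<n}. lebesgue_vec d"
  let ?P = "\<Pi>\<^sub>M e\<in>coeff_index m. normal_prior s"
  have pr: "prob_space (normal_prior s)" by (rule prob_space_normal_density[OF s])
  interpret N: sigma_finite_measure ?N by (rule sigma_finite_lebesgue_data)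
  interpret PP: product_prob_space "\<lambda>_::nat \<times> nat. normal_prior s" by (intro product_prob_spaceI pr)
  interpret Pi: prob_space ?P by (rule prob_space_PiM) (rule pr)
  have sP: "sets ?P = sets (\<Pi>\<^sub>M e\<in>coeff_index m. lborel)" by (intro sets_PiM_cong) auto
  have spP: "space ?P = space (\<Pi>\<^sub>M e\<in>coeff_index m. lborel)" by (rule sets_eq_imp_space_eq[OF sP])
  have fs: "fst \<in> ?P \<Otimes>\<^sub>M ?N \<rightarrow>\<^sub>M (\<Pi>\<^sub>M e\<in>coeff_index m. lborel)"
    using measurable_fst[of ?P ?N] by (simp cong: measurable_cong_sets[OF refl sP])
  note jm = posterior_gap_joint_measurable[OF fs measurable_snd]
  have "(\<lambda>B. \<integral>X. (\<Prod>i<n. reg_density d m B (X i)) * posterior_gap B X \<partial>?N) \<in> borel_measurable ?P"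
    using jm by (intro N.borel_measurable_lebesgue_integral) (simp add: case_prod_beta')
  then have \<Phi>m: "\<Phi> \<in> borel_measurable ?P"
    unfolding \<Phi>_def using posterior_gap_density(2) spP by (subst measurable_cong) auto
  have Ib: "integrable ?P (\<lambda>B. \<bar>B e\<bar>)"
  proof -
    have "integrable (normal_prior s) (\<lambda>b. \<bar>b\<bar>)"
      using integrable_normal_moment_abs[OF s, of 0 1] by (simp add: integrable_density)
    then show ?thesis using integrable_PiM_component(1)[OF pr e] by blast
  qed
  show I: "integrable ?P \<Phi>"
  proof (rule Bochner_Integration.integrable_bound[OF _ \<Phi>m])
    show "integrable ?P (\<lambda>B. \<bar>B e\<bar> / s\<^sup>2 + n)"
      using Ib by (intro Bochner_Integration.integrable_add Pi.integrable_const integrable_divide)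
    show "AE B in ?P. norm (\<Phi> B) \<le> norm (\<bar>B e\<bar> / s\<^sup>2 + n)"
    proof (rule AE_I2)
      fix B assume "B \<in> space ?P"
      then have B: "B \<in> space (\<Pi>\<^sub>M e\<in>coeff_index m. lborel)" by (simp add: spP)
      have "\<bar>\<Phi> B\<bar> \<le> (\<integral>X. \<bar>posterior_gap B X\<bar> \<partial>(\<Pi>\<^sub>M i\<in>{..<n}. reg d m B))"
        unfolding \<Phi>_def by (rule integral_abs_bound)
      also have "\<dots> \<le> \<bar>B e\<bar> / s\<^sup>2 + n" by (rule posterior_gap_bound[OF B])
      finally show "norm (\<Phi> B) \<le> norm (\<bar>B e\<bar> / s\<^sup>2 + n)" by simp
    qed
  qed
  let ?I = "coeff_index m - {e}"
  have ins: "insert e ?I = coeff_index m" using e by auto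
  have "(\<integral>B. \<Phi> B \<partial>?P) = (\<integral>B. (\<integral>b. \<Phi> (B(e := b)) \<partial>normal_prior s) \<partial>(\<Pi>\<^sub>M e\<in>?I. normal_prior s))"
    using PP.product_integral_insert[of ?I e \<Phi>] I unfolding ins by simp
  also have "\<dots> = (\<integral>B. 0 \<partial>(\<Pi>\<^sub>M e\<in>?I. normal_prior s))"
  proof (intro Bochner_Integration.integral_cong refl)
    fix B assume B: "B \<in> space (\<Pi>\<^sub>M e\<in>?I. normal_prior s)"
    have "B(e := 0) \<in> space (\<Pi>\<^sub>M e\<in>coeff_index m. lborel)"
      using B e by (auto simp: space_PiM PiE_iff extensional_def)
    from posterior_gap_average_coordinate[OF this]
    show "(\<integral>b. \<Phi> (B(e := b)) \<partial>normal_prior s) = 0" by (simp add: \<Phi>_def)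
  qed
  finally show "(\<integral>B. \<Phi> B \<partial>?P) = 0" by simp
qed

end

section \<open>From accuracy to sample size\<close>

lemma sets_reg_data: "sets (\<Pi>\<^sub>M i\<in>{..<n}. reg d m B) = sets (\<Pi>\<^sub>M i\<in>{..<n}. borel_vec d)"
proof (intro sets_PiM_cong refl)
  have "sets (lebesgue_vec d) = sets (borel_vec d)" by (intro sets_PiM_cong) auto
  then show "sets (reg d m B) = sets (borel_vec d)" by simp
qed

lemma diff_private_cong:
  assumes "sets D = sets D'"
  shows "diff_private n D Q \<epsilon> \<delta> M \<longleftrightarrow> diff_private n D' Q \<epsilon> \<delta> M"
proof -
  have s: "sets (\<Pi>\<^sub>M i\<in>{..<n}. D) = sets (\<Pi>\<^sub>M i\<in>{..<n}. D')" using assms by (intro sets_PiM_cong) auto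
  have "space (\<Pi>\<^sub>M i\<in>{..<n}. D) = space (\<Pi>\<^sub>M i\<in>{..<n}. D')" by (rule sets_eq_imp_space_eq[OF s])
  then show ?thesis
    unfolding diff_private_def mechanism_def by (simp cong: measurable_cong_sets[OF s refl])
qed

lemma normal_prior_moments:
  assumes s: "0 < s"
  shows "integrable (normal_prior s) abs" "(\<integral>b. \<bar>b\<bar> \<partial>normal_prior s) = s * sqrt (2 / pi)"
    and "integrable (normal_prior s) (\<lambda>b. b\<^sup>2)" "(\<integral>b. b\<^sup>2 \<partial>normal_prior s) = s\<^sup>2"
  using normal_moment_abs_odd[OF s, of 0 0] normal_moment_even[OF s, of 0 1] s
  by (simp_all add: integrable_density integral_density has_bochner_integral_iff fact_numeral)

lemma sqrt_2_pi: "3 / 4 \<le> sqrt (2 / pi)"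
proof (rule real_le_rsqrt)
  have "pi \<le> 32 / 9" using pi_less_4 pi_approx by simp
  then show "(3 / 4)\<^sup>2 \<le> 2 / pi" using pi_gt_zero by (simp add: field_simps power2_eq_square)
qed

text \<open>The norm is at least the sum of the absolute values divided by \<open>sqrt (card E)\<close>, and an entry has mean
  absolute value \<open>s * sqrt (2 / pi)\<close>.\<close>

lemma prior_norm:
  assumes s: "0 < s" and E: "finite E" "E \<noteq> {}"
  shows "integrable (\<Pi>\<^sub>M e\<in>E. normal_prior s) (\<lambda>B. L2_set B E)"
    and "3 / 4 * s * sqrt (card E) \<le> (\<integral>B. L2_set B E \<partial>(\<Pi>\<^sub>M e\<in>E. normal_prior s))"
proof -
  have pr: "prob_space (normal_prior s)" by (rule prob_space_normal_density[OF s])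
  let ?P = "\<Pi>\<^sub>M e\<in>E. normal_prior s"
  have I: "integrable ?P (\<lambda>B. \<bar>B e\<bar>)" "(\<integral>B. \<bar>B e\<bar> \<partial>?P) = s * sqrt (2 / pi)" if "e \<in> E" for e
    using integrable_PiM_component[OF pr that normal_prior_moments(1)[OF s]] normal_prior_moments(2)[OF s] by auto
  have m: "(\<lambda>B. B e) \<in> borel_measurable ?P" if "e \<in> E" for e
    using measurable_component_singleton[OF that, of "\<lambda>_. normal_prior s"] by simp
  show IL: "integrable ?P (\<lambda>B. L2_set B E)"
  proof (rule Bochner_Integration.integrable_bound)
    show "integrable ?P (\<lambda>B. \<Sum>e\<in>E. \<bar>B e\<bar>)" using I by auto
    show "(\<lambda>B. L2_set B E) \<in> borel_measurable ?P" unfolding L2_set_def using m by measurable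
    show "AE B in ?P. norm (L2_set B E) \<le> norm (\<Sum>e\<in>E. \<bar>B e\<bar>)"
      using L2_set_le_sum_abs by (auto intro!: AE_I2 simp: sum_nonneg)
  qed
  have k: "0 < sqrt (card E)" using E by (simp add: card_gt_0_iff)
  \<comment> \<open>Cauchy-Schwarz against the constant function 1.\<close>
  have CS: "(\<Sum>e\<in>E. \<bar>B e\<bar>) / sqrt (card E) \<le> L2_set B E" for B
    using L2_set_mult_ineq[of B "\<lambda>_. 1" E] k by (simp add: L2_set_constant field_simps)
  have "3 / 4 * s * sqrt (card E) \<le> s * sqrt (2 / pi) * sqrt (card E)"
    using sqrt_2_pi s k by simp
  also have "\<dots> = (card E * (s * sqrt (2 / pi))) / sqrt (card E)"
  proof -
    have "(card E * (s * sqrt (2 / pi))) / sqrt (card E) = (card E / sqrt (card E)) * (s * sqrt (2 / pi))" by simp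
    then show ?thesis unfolding real_div_sqrt[OF of_nat_0_le_iff] by (simp only: mult.commute)
  qed
  also have "\<dots> = (\<integral>B. (\<Sum>e\<in>E. \<bar>B e\<bar>) / sqrt (card E) \<partial>?P)" using I by simp
  also have "\<dots> \<le> (\<integral>B. L2_set B E \<partial>?P)" using I IL CS by (intro integral_mono) auto
  finally show "3 / 4 * s * sqrt (card E) \<le> (\<integral>B. L2_set B E \<partial>?P)" .
qed

text \<open>The fingerprinting inequality. \<open>A B\<close> is a lower bound for the mean correlation of the vector \<open>F\<close> with
  the true coefficients. By the posterior identity its prior mean is at most \<open>s\<^sup>2\<close> times the correlation with the
  scores, which is bounded for every single \<open>B\<close>, with and without privacy.\<close>

lemma regression_lower_bound:
  fixes A :: "(nat \<times> nat \<Rightarrow> real) \<Rightarrow> real"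
  assumes d: "2 * m \<le> d" and m: "1 \<le> m" and s: "0 < s"
    and dp: "diff_private n (borel_vec d) Q \<epsilon> \<delta> M" and \<epsilon>: "0 \<le> \<epsilon>" and \<delta>: "0 \<le> \<delta>"
    and F: "\<And>e. e \<in> coeff_index m \<Longrightarrow> F e \<in> borel_measurable Q"
    and F_unit: "\<And>y. y \<in> space Q \<Longrightarrow> (\<Sum>e\<in>coeff_index m. (F e y)\<^sup>2) \<le> 1"
    and A: "integrable (\<Pi>\<^sub>M e\<in>coeff_index m. normal_prior s) A"
    and acc: "\<And>B. A B \<le> (\<integral>y. (\<Sum>e\<in>coeff_index m. F e y * B e) \<partial>output_law n (reg d m B) M)"
  shows "(\<integral>B. A B \<partial>(\<Pi>\<^sub>M e\<in>coeff_index m. normal_prior s)) \<le> s\<^sup>2 * (n * ((exp \<epsilon> - 1) + 2 * \<delta> * m))"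
    and "(\<integral>B. A B \<partial>(\<Pi>\<^sub>M e\<in>coeff_index m. normal_prior s)) \<le> s\<^sup>2 * (sqrt n * m)"
proof -
  let ?E = "coeff_index m"
  let ?\<pi> = "\<Pi>\<^sub>M e\<in>?E. normal_prior s"
  define h where h_fun: "h = (\<lambda>e X. \<integral>y. F e y \<partial>M X)"
  interpret \<pi>: prob_space ?\<pi> by (intro prob_space_PiM prob_space_normal_density s)
  have sm: "scored_mechanism (reg d m B) ?E (reg_score m B) n Q M F" for B
  proof (intro scored_mechanism.intro orthonormal_reg[OF d] scored_mechanism_axioms.intro F F_unit)
    show "mechanism n (reg d m B) Q M"
      using dp unfolding diff_private_def mechanism_def
      by (simp cong: measurable_cong_sets[OF sets_reg_data refl])
  qed (use m in \<open>auto simp: lessThan_empty_iff\<close>)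
  have h_eq: "scored_mechanism.h M F = h" for B
    unfolding h_fun by (intro ext scored_mechanism.h_def[OF sm])
  define W where "W = (\<lambda>B. \<Sum>i<n. \<integral>X. (\<Sum>e\<in>?E. h e X * reg_score m B e (X i)) \<partial>(\<Pi>\<^sub>M i\<in>{..<n}. reg d m B))"
  have dpr: "diff_private n (reg d m B) Q \<epsilon> \<delta> M" for B
  proof -
    have "sets (lebesgue_vec d) = sets (borel_vec d)" by (intro sets_PiM_cong) auto
    then show ?thesis using dp diff_private_cong[of "reg d m B" "borel_vec d" n Q \<epsilon> \<delta> M] by simp
  qed
  have W1: "W B \<le> n * ((exp \<epsilon> - 1) + 2 * \<delta> * m)" for B
    using scored_mechanism.privacy_bound[OF sm dpr \<epsilon> \<delta>, of B] by (simp add: W_def h_eq real_sqrt_mult)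
  have W2: "W B \<le> sqrt n * m" for B
    using scored_mechanism.sampling_bound[OF sm, of B] by (simp add: W_def h_eq real_sqrt_mult)
  have hm: "h e \<in> borel_measurable (\<Pi>\<^sub>M i\<in>{..<n}. lebesgue_vec d)"
    and h1: "\<And>X. X \<in> space (\<Pi>\<^sub>M i\<in>{..<n}. lebesgue_vec d) \<Longrightarrow> \<bar>h e X\<bar> \<le> 1" if e: "e \<in> ?E" for e
  proof -
    have sd: "sets (\<Pi>\<^sub>M i\<in>{..<n}. reg d m (\<lambda>_. 0)) = sets (\<Pi>\<^sub>M i\<in>{..<n}. lebesgue_vec d)"
      by (intro sets_PiM_cong) auto
    show "h e \<in> borel_measurable (\<Pi>\<^sub>M i\<in>{..<n}. lebesgue_vec d)"
      using scored_mechanism.h_measurable[OF sm e, of "\<lambda>_. 0"]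
      by (simp add: h_eq cong: measurable_cong_sets[OF sd refl])
    show "\<bar>h e X\<bar> \<le> 1" if "X \<in> space (\<Pi>\<^sub>M i\<in>{..<n}. lebesgue_vec d)" for X
      using scored_mechanism.h_le_1[OF sm e, of X "\<lambda>_. 0"] that sets_eq_imp_space_eq[OF sd] by (simp add: h_eq)
  qed
  define \<Phi> where "\<Phi> = (\<lambda>e B. \<integral>X. posterior_gap m n s (h e) e B X \<partial>(\<Pi>\<^sub>M i\<in>{..<n}. reg d m B))"
  have \<Phi>: "integrable ?\<pi> (\<Phi> e)" "(\<integral>B. \<Phi> e B \<partial>?\<pi>) = 0" if e: "e \<in> ?E" for e
    unfolding \<Phi>_def using posterior_gap_average[OF d s e hm[OF e] h1[OF e]] by auto
  have gap: "A B / s\<^sup>2 - W B \<le> (\<Sum>e\<in>?E. \<Phi> e B)" for B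
  proof -
    interpret scored_mechanism "reg d m B" ?E "reg_score m B" n Q M F by (rule sm)
    have Ih: "integrable data (h e)" if e: "e \<in> ?E" for e
      using h_measurable[OF e] h_le_1[OF e] h_eq
      by (intro data.integrable_const_bound[where B=1]) (auto intro!: AE_I2)
    have Is: "integrable data (\<lambda>X. h e X * reg_score m B e (X i))" if "e \<in> ?E" "i < n" for e i
      using integrable_h_score[OF that(2,1)] by (simp add: h_eq)
    have "(\<integral>y. (\<Sum>e\<in>?E. F e y * B e) \<partial>output_law n (reg d m B) M) = (\<integral>X. (\<integral>y. (\<Sum>e\<in>?E. F e y * B e) \<partial>M X) \<partial>data)"
      unfolding output_law_def
    proof (rule integral_bind[where K=Q and B="\<Sum>e\<in>?E. \<bar>B e\<bar>" and B'=1])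
      show "(\<lambda>y. \<Sum>e\<in>?E. F e y * B e) \<in> borel_measurable Q"
        using F by (intro borel_measurable_sum borel_measurable_times) auto
      show "\<bar>\<Sum>e\<in>?E. F e y * B e\<bar> \<le> (\<Sum>e\<in>?E. \<bar>B e\<bar>)" if "y \<in> space Q" for y
        using F_le_1 that by (intro order_trans[OF sum_abs] sum_mono) (auto simp: abs_mult intro!: mult_left_le_one_le)
      show "AE X in data. emeasure (M X) (space (M X)) \<le> ennreal 1"
        using prob_space.emeasure_space_1[OF M_prob(1)] by (intro AE_I2) simp
    qed (rule M_measurable, rule data.finite_measure_axioms)
    also have "\<dots> = (\<integral>X. (\<Sum>e\<in>?E. h e X * B e) \<partial>data)"
    proof (intro Bochner_Integration.integral_cong refl)
      fix X assume X: "X \<in> space data"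
      show "(\<integral>y. (\<Sum>e\<in>?E. F e y * B e) \<partial>M X) = (\<Sum>e\<in>?E. h e X * B e)"
        using F_integrable[OF _ X] unfolding h_fun by (subst Bochner_Integration.integral_sum) auto
    qed
    also have "\<dots> = (\<Sum>e\<in>?E. (\<integral>X. h e X \<partial>data) * B e)"
      using Ih by (subst Bochner_Integration.integral_sum) auto
    finally have out: "A B \<le> (\<Sum>e\<in>?E. (\<integral>X. h e X \<partial>data) * B e)" using acc[of B] by simp
    have \<Phi>_eq: "\<Phi> e B = (\<integral>X. h e X \<partial>data) * B e / s\<^sup>2 - (\<Sum>i<n. \<integral>X. h e X * reg_score m B e (X i) \<partial>data)"
      if e: "e \<in> ?E" for e
    proof -
      have pg: "posterior_gap m n s (h e) e B = (\<lambda>X. h e X * (B e / s\<^sup>2 - (\<Sum>i<n. reg_score m B e (X i))))"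
        by (intro ext posterior_gap_def[OF d s e hm[OF e] h1[OF e]])
      have "\<Phi> e B = (\<integral>X. h e X * (B e / s\<^sup>2) - (\<Sum>i<n. h e X * reg_score m B e (X i)) \<partial>data)"
        unfolding \<Phi>_def pg
        by (simp add: right_diff_distrib sum_distrib_left)
      also have "\<dots> = (\<integral>X. h e X * (B e / s\<^sup>2) \<partial>data) - (\<integral>X. (\<Sum>i<n. h e X * reg_score m B e (X i)) \<partial>data)"
        using Ih[OF e] Is[OF e] by (intro Bochner_Integration.integral_diff Bochner_Integration.integrable_sum) auto
      also have "(\<integral>X. (\<Sum>i<n. h e X * reg_score m B e (X i)) \<partial>data) = (\<Sum>i<n. \<integral>X. h e X * reg_score m B e (X i) \<partial>data)"
        using Is[OF e] by (intro Bochner_Integration.integral_sum) auto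
      finally show ?thesis by simp
    qed
    have "W B = (\<Sum>i<n. \<Sum>e\<in>?E. \<integral>X. h e X * reg_score m B e (X i) \<partial>data)"
      unfolding W_def using Is by (intro sum.cong refl Bochner_Integration.integral_sum) auto
    also have "\<dots> = (\<Sum>e\<in>?E. \<Sum>i<n. \<integral>X. h e X * reg_score m B e (X i) \<partial>data)" by (rule sum.swap)
    finally have Weq: "W B = (\<Sum>e\<in>?E. \<Sum>i<n. \<integral>X. h e X * reg_score m B e (X i) \<partial>data)" .
    have "(\<Sum>e\<in>?E. \<Phi> e B) = (\<Sum>e\<in>?E. (\<integral>X. h e X \<partial>data) * B e) / s\<^sup>2 - W B"
      unfolding Weq using \<Phi>_eq by (simp add: sum_subtractf sum_divide_distrib)
    then show ?thesis using out by (simp add: divide_right_mono)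
  qed
  have main: "(\<integral>B. A B \<partial>?\<pi>) \<le> s\<^sup>2 * K" if K: "\<And>B. W B \<le> K" for K
  proof -
    have "(\<integral>B. A B / s\<^sup>2 - K \<partial>?\<pi>) \<le> (\<integral>B. (\<Sum>e\<in>?E. \<Phi> e B) \<partial>?\<pi>)"
    proof (rule integral_mono)
      show "integrable ?\<pi> (\<lambda>B. A B / s\<^sup>2 - K)"
        using A by (intro Bochner_Integration.integrable_diff integrable_divide \<pi>.integrable_const)
      show "integrable ?\<pi> (\<lambda>B. \<Sum>e\<in>?E. \<Phi> e B)" using \<Phi>(1) by (intro Bochner_Integration.integrable_sum)
      show "A B / s\<^sup>2 - K \<le> (\<Sum>e\<in>?E. \<Phi> e B)" for B using gap[of B] K[of B] by simp
    qed
    also have "(\<integral>B. (\<Sum>e\<in>?E. \<Phi> e B) \<partial>?\<pi>) = (\<Sum>e\<in>?E. \<integral>B. \<Phi> e B \<partial>?\<pi>)"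
      using \<Phi>(1) by (intro Bochner_Integration.integral_sum)
    also have "\<dots> = 0" using \<Phi>(2) by simp
    also have "(\<integral>B. A B / s\<^sup>2 - K \<partial>?\<pi>) = (\<integral>B. A B \<partial>?\<pi>) / s\<^sup>2 - K"
      using A by (subst Bochner_Integration.integral_diff) (auto simp: \<pi>.prob_space intro!: integrable_divide \<pi>.integrable_const)
    finally show ?thesis using s by (simp add: field_simps)
  qed
  show "(\<integral>B. A B \<partial>?\<pi>) \<le> s\<^sup>2 * (n * ((exp \<epsilon> - 1) + 2 * \<delta> * m))" by (rule main[OF W1])
  show "(\<integral>B. A B \<partial>?\<pi>) \<le> s\<^sup>2 * (sqrt n * m)" by (rule main[OF W2])
qed

section \<open>Covariance matrices of the regression model\<close>

lemma mat_inverse_eqI: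
  fixes A B :: "real mat"
  assumes A: "A \<in> carrier_mat n n" and B: "B \<in> carrier_mat n n" and AB: "A * B = 1\<^sub>m n" and BA: "B * A = 1\<^sub>m n"
  shows "mat_inverse A = Some B"
proof (cases "mat_inverse A")
  case None
  have "A \<in> Units (ring_mat TYPE(real) n ())"
    using assms unfolding Units_def by (auto simp: ring_mat_simps)
  then show ?thesis using mat_inverse(1)[OF A None, of "()"] by simp
next
  case (Some C)
  from mat_inverse(2)[OF A Some] have C: "A * C = 1\<^sub>m n" "C \<in> carrier_mat n n" by auto
  have "C = (B * A) * C" using C by (simp add: BA)
  also have "\<dots> = B * (A * C)" using A B C by simp
  also have "\<dots> = B" using B by (simp add: C)
  finally show ?thesis using Some by simp
qed

lemma sum_lessThan_ge0: "(\<Sum>i = 0..<n. f i) = (\<Sum>i<n. f i)" for f :: "nat \<Rightarrow> real"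
  by (simp add: atLeast0LessThan)

lemma scalar_prod_self: "Matrix.scalar_prod v v = (\<Sum>i<dim_vec v. (vec_index v i)\<^sup>2)" for v :: "real Matrix.vec"
  unfolding scalar_prod_def by (simp add: atLeast0LessThan power2_eq_square)

definition reg_root :: "nat \<Rightarrow> nat \<Rightarrow> (nat \<times> nat \<Rightarrow> real) \<Rightarrow> real mat" where
  "reg_root d m B = Matrix.mat d d (\<lambda>(i, j). if i = j then 1 else if m \<le> i \<and> i < 2 * m \<and> j < m then B (i - m, j) else 0)"

definition reg_cov :: "nat \<Rightarrow> nat \<Rightarrow> (nat \<times> nat \<Rightarrow> real) \<Rightarrow> real mat" where
  "reg_cov d m B = reg_root d m B * transpose_mat (reg_root d m B)"

lemma reg_root_carrier [simp]: "reg_root d m B \<in> carrier_mat d d"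
  by (simp add: reg_root_def)

lemma reg_root_dim [simp]: "dim_row (reg_root d m B) = d" "dim_col (reg_root d m B) = d"
  by (simp_all add: reg_root_def)

lemma reg_root_mult_vec:
  assumes d: "2 * m \<le> d"
  shows "reg_root d m B *\<^sub>v Matrix.vec d x = Matrix.vec d (\<lambda>i. x i + reg_mean m B i x)"
proof (rule eq_vecI)
  fix i assume "i < dim_vec (Matrix.vec d (\<lambda>i. x i + reg_mean m B i x))"
  then have i: "i < d" by simp
  have "vec_index (reg_root d m B *\<^sub>v Matrix.vec d x) i =
      (\<Sum>j<d. (if i = j then 1 else if m \<le> i \<and> i < 2 * m \<and> j < m then B (i - m, j) else 0) * x j)"
    using i by (simp add: reg_root_def scalar_prod_def sum_lessThan_ge0)
  also have "\<dots> = (\<Sum>j<d. (if i = j then x j else 0) + (if m \<le> i \<and> i < 2 * m \<and> j < m then B (i - m, j) * x j else 0))"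
    by (intro sum.cong) auto
  also have "\<dots> = x i + (\<Sum>j<d. if m \<le> i \<and> i < 2 * m \<and> j < m then B (i - m, j) * x j else 0)"
    using i by (simp add: sum.distrib)
  also have "(\<Sum>j<d. if m \<le> i \<and> i < 2 * m \<and> j < m then B (i - m, j) * x j else 0) = reg_mean m B i x"
  proof (cases "m \<le> i \<and> i < 2 * m")
    case True
    have "(\<Sum>j<d. if m \<le> i \<and> i < 2 * m \<and> j < m then B (i - m, j) * x j else 0) =
        (\<Sum>j\<in>{..<d} \<inter> {..<m}. B (i - m, j) * x j)"
      using True by (simp add: sum.inter_restrict)
    also have "{..<d} \<inter> {..<m} = {..<m}" using d by auto
    finally show ?thesis using True by (simp add: reg_mean_def)
  qed (auto simp: reg_mean_def)
  finally show "vec_index (reg_root d m B *\<^sub>v Matrix.vec d x) i =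
      vec_index (Matrix.vec d (\<lambda>i. x i + reg_mean m B i x)) i" using i by simp
qed (simp add: reg_root_def)

lemma reg_mean_uminus: "reg_mean m (\<lambda>e. - B e) i x = - reg_mean m B i x"
  by (simp add: reg_mean_def sum_negf)

lemma reg_root_inverse:
  assumes d: "2 * m \<le> d"
  shows "reg_root d m B * reg_root d m (\<lambda>e. - B e) = 1\<^sub>m d"
proof (rule eq_matI)
  fix i j assume "i < dim_row (1\<^sub>m d)" "j < dim_col (1\<^sub>m d :: real mat)"
  then have ij: "i < d" "j < d" by auto
  let ?C = "reg_root d m (\<lambda>e. - B e)"
  let ?x = "\<lambda>k. if k = j then 1 else 0 :: real"
  have u: "unit_vec d j = Matrix.vec d ?x" by (auto simp: unit_vec_def)
  have "col ?C j = ?C *\<^sub>v unit_vec d j" using ij by (intro eq_vecI) (auto simp: reg_root_def)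
  also have "\<dots> = Matrix.vec d (\<lambda>i. ?x i + reg_mean m (\<lambda>e. - B e) i ?x)"
    unfolding u by (rule reg_root_mult_vec[OF d])
  finally have c: "col ?C j = Matrix.vec d (\<lambda>i. ?x i + reg_mean m (\<lambda>e. - B e) i ?x)" .
  have "(reg_root d m B * ?C) $$ (i, j) = vec_index (reg_root d m B *\<^sub>v col ?C j) i"
    using ij by (simp add: reg_root_def)
  also have "\<dots> = ?x i + reg_mean m (\<lambda>e. - B e) i ?x + reg_mean m B i (\<lambda>i. ?x i + reg_mean m (\<lambda>e. - B e) i ?x)"
    unfolding c using ij by (subst reg_root_mult_vec[OF d]) simp
  also have "reg_mean m B i (\<lambda>i. ?x i + reg_mean m (\<lambda>e. - B e) i ?x) = reg_mean m B i ?x"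
    by (rule reg_mean_cong) (simp add: reg_mean_0)
  finally show "(reg_root d m B * ?C) $$ (i, j) = 1\<^sub>m d $$ (i, j)"
    using ij by (simp add: reg_mean_uminus)
qed (simp_all add: reg_root_def)

lemma reg_root_inverse':
  assumes d: "2 * m \<le> d"
  shows "reg_root d m (\<lambda>e. - B e) * reg_root d m B = 1\<^sub>m d"
  using reg_root_inverse[OF d, of "\<lambda>e. - B e"] by simp

lemma det_reg_cov: "Determinant.det (reg_cov d m B) = 1"
proof -
  have "Determinant.det (reg_root d m B) = prod_list (diag_mat (reg_root d m B))"
    by (rule det_lower_triangular[OF _ reg_root_carrier]) (auto simp: reg_root_def)
  also have "\<dots> = 1" unfolding prod_list_diag_prod by (rule prod.neutral) (auto simp: reg_root_def)
  finally show ?thesis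
    unfolding reg_cov_def
    by (subst det_mult[of _ d]) (auto simp: det_transpose[of _ d])
qed

lemma transpose_mult_one:
  fixes A B :: "real mat"
  assumes "A \<in> carrier_mat n n" "B \<in> carrier_mat n n" "A * B = 1\<^sub>m n"
  shows "transpose_mat B * transpose_mat A = 1\<^sub>m n"
  using transpose_mult[OF assms(1,2)] assms(3) by simp

lemma mat_inverse_reg_cov:
  fixes B :: "nat \<times> nat \<Rightarrow> real"
  assumes d: "2 * m \<le> d"
  defines "C \<equiv> reg_root d m (\<lambda>e. - B e)"
  shows "mat_inverse (reg_cov d m B) = Some (transpose_mat C * C)"
proof (rule mat_inverse_eqI)
  let ?R = "reg_root d m B"
  have [simp]: "C \<in> carrier_mat d d" "?R \<in> carrier_mat d d" "transpose_mat C \<in> carrier_mat d d"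
    "transpose_mat ?R \<in> carrier_mat d d" by (auto simp: C_def)
  have RC: "?R * C = 1\<^sub>m d" and CR: "C * ?R = 1\<^sub>m d"
    unfolding C_def by (rule reg_root_inverse[OF d], rule reg_root_inverse'[OF d])
  have t: "transpose_mat ?R * transpose_mat C = 1\<^sub>m d" "transpose_mat C * transpose_mat ?R = 1\<^sub>m d"
    by (rule transpose_mult_one[of C d ?R], simp_all add: CR) (rule transpose_mult_one[of ?R d C], simp_all add: RC)
  show "reg_cov d m B \<in> carrier_mat d d" "transpose_mat C * C \<in> carrier_mat d d"
    by (auto simp: reg_cov_def intro!: mult_carrier_mat[of _ d d])
  have "reg_cov d m B * (transpose_mat C * C) = ?R * ((transpose_mat ?R * transpose_mat C) * C)"
    unfolding reg_cov_def
    by (simp add: assoc_mult_mat[of _ d d _ d _ d] mult_carrier_mat[of _ d d])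
  then show "reg_cov d m B * (transpose_mat C * C) = 1\<^sub>m d" by (simp add: t RC left_mult_one_mat[of C d d])
  have "(transpose_mat C * C) * reg_cov d m B = transpose_mat C * ((C * ?R) * transpose_mat ?R)"
    unfolding reg_cov_def
    by (simp add: assoc_mult_mat[of _ d d _ d _ d] mult_carrier_mat[of _ d d])
  then show "(transpose_mat C * C) * reg_cov d m B = 1\<^sub>m d" by (simp add: t CR left_mult_one_mat[of "transpose_mat ?R" d d])
qed

text \<open>The inverse covariance is \<open>C\<^sup>T C\<close> for the inverse \<open>C\<close> of the root, and \<open>C\<close> maps \<open>x\<close> to its residuals; so the
  exponent is the sum of the squared residuals.\<close>

lemma mvn_reg_cov:
  assumes d: "2 * m \<le> d"
  shows "mvn d (reg_cov d m B) = reg d m B"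
proof -
  let ?C = "reg_root d m (\<lambda>e. - B e)"
  have "mvn_density d (reg_cov d m B) x = reg_density d m B x" for x
  proof -
    let ?v = "Matrix.vec d x"
    let ?r = "\<lambda>i. x i - reg_mean m B i x"
    have Cv: "?C *\<^sub>v ?v = Matrix.vec d ?r"
      by (subst reg_root_mult_vec[OF d]) (simp add: reg_mean_uminus)
    have "Matrix.scalar_prod ?v ((transpose_mat ?C * ?C) *\<^sub>v ?v) = Matrix.scalar_prod ?v (transpose_mat ?C *\<^sub>v (?C *\<^sub>v ?v))"
      by (subst assoc_mult_mat_vec[of _ d d _ d]) auto
    also have "\<dots> = Matrix.scalar_prod (transpose_mat ?C *\<^sub>v (?C *\<^sub>v ?v)) ?v"
      by (rule comm_scalar_prod[of _ d]) (auto intro!: mult_mat_vec_carrier[of _ d d])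
    also have "\<dots> = Matrix.scalar_prod (?C *\<^sub>v ?v) (?C *\<^sub>v ?v)"
      by (rule transpose_vec_mult_scalar[of _ d d]) (auto intro!: mult_mat_vec_carrier[of _ d d])
    also have "\<dots> = (\<Sum>i<d. (?r i)\<^sup>2)" unfolding Cv scalar_prod_self by simp
    finally have q: "Matrix.scalar_prod ?v ((transpose_mat ?C * ?C) *\<^sub>v ?v) = (\<Sum>i<d. (?r i)\<^sup>2)" .
    have "reg_density d m B x = (\<Prod>i<d. exp (- (?r i)\<^sup>2 / 2)) / sqrt (2 * pi) ^ d"
      unfolding reg_density_def std_normal_density_def by (simp add: prod_dividef)
    also have "(\<Prod>i<d. exp (- (?r i)\<^sup>2 / 2)) = exp (\<Sum>i<d. - (?r i)\<^sup>2 / 2)" by (simp add: exp_sum)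
    also have "(\<Sum>i<d. - (?r i)\<^sup>2 / 2) = - (\<Sum>i<d. (?r i)\<^sup>2) / 2" by (simp add: sum_negf sum_divide_distrib)
    also have "sqrt (2 * pi) ^ d = sqrt ((2 * pi) ^ d * 1)" by (simp only: mult_1_right real_sqrt_power)
    also have "exp (- (\<Sum>i<d. (?r i)\<^sup>2) / 2) / sqrt ((2 * pi) ^ d * 1) = mvn_density d (reg_cov d m B) x"
      unfolding mvn_density_def mat_inverse_reg_cov[OF d] det_reg_cov option.sel q ..
    finally show ?thesis by simp
  qed
  then show ?thesis unfolding mvn_def reg_def by simp
qed

lemma reg_cov_carrier [simp]: "reg_cov d m B \<in> carrier_mat d d"
  unfolding reg_cov_def by (rule mult_carrier_mat[of _ d d]) auto

lemma reg_cov_form: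
  assumes v: "v \<in> carrier_vec d"
  shows "Matrix.scalar_prod v (reg_cov d m B *\<^sub>v v) =
    Matrix.scalar_prod (transpose_mat (reg_root d m B) *\<^sub>v v) (transpose_mat (reg_root d m B) *\<^sub>v v)"
proof -
  let ?R = "reg_root d m B"
  have "Matrix.scalar_prod v (reg_cov d m B *\<^sub>v v) = Matrix.scalar_prod v (?R *\<^sub>v (transpose_mat ?R *\<^sub>v v))"
    unfolding reg_cov_def using v by (subst assoc_mult_mat_vec[of _ d d _ d]) auto
  also have "\<dots> = Matrix.scalar_prod (transpose_mat ?R *\<^sub>v v) (transpose_mat ?R *\<^sub>v v)"
    using v by (subst transpose_vec_mult_scalar[of _ d d]) (auto intro: mult_mat_vec_carrier[of _ d d])
  finally show ?thesis .
qed

lemma reg_cov_symmetric: "transpose_mat (reg_cov d m B) = reg_cov d m B"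
  unfolding reg_cov_def by (subst transpose_mult[of _ d d _ d]) auto

lemma pos_def_reg_cov:
  assumes d: "2 * m \<le> d"
  shows "pos_def_mat d (reg_cov d m B)"
  unfolding pos_def_mat_def symmetric_mat_def
proof (intro conjI ballI impI reg_cov_carrier reg_cov_symmetric)
  fix v :: "real Matrix.vec" assume v: "v \<in> carrier_vec d" "v \<noteq> 0\<^sub>v d"
  let ?R = "reg_root d m B" and ?C = "reg_root d m (\<lambda>e. - B e)"
  let ?w = "transpose_mat ?R *\<^sub>v v"
  have w: "?w \<in> carrier_vec d" using v by (auto intro!: mult_mat_vec_carrier[of _ d d])
  have "v = (transpose_mat ?C * transpose_mat ?R) *\<^sub>v v"
    using transpose_mult_one[of ?R d ?C] reg_root_inverse[OF d, of B] v by simp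
  also have "\<dots> = transpose_mat ?C *\<^sub>v ?w" using v by (subst assoc_mult_mat_vec[of _ d d _ d]) auto
  finally have vw: "v = transpose_mat ?C *\<^sub>v ?w" .
  have "?w \<noteq> 0\<^sub>v d"
  proof
    assume "?w = 0\<^sub>v d"
    then have "v = transpose_mat ?C *\<^sub>v 0\<^sub>v d" using vw by simp
    also have "\<dots> = 0\<^sub>v d" by (intro eq_vecI) (auto simp: scalar_prod_def reg_root_def)
    finally show False using v by simp
  qed
  then obtain i where i: "i < d" "vec_index ?w i \<noteq> 0"
    using w by (metis carrier_vecD eq_vecI index_zero_vec(1) index_zero_vec(2))
  have "0 < (\<Sum>i<dim_vec ?w. (vec_index ?w i)\<^sup>2)"
    using i w by (intro sum_pos2[of _ i]) auto
  then show "0 < Matrix.scalar_prod v (reg_cov d m B *\<^sub>v v)"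
    unfolding reg_cov_form[OF v(1)] scalar_prod_self .
qed

text \<open>A quadratic form bounded by \<open>\<alpha>\<close> belongs to a symmetric operator of norm at most \<open>\<alpha>\<close>: polarize at
  \<open>r = G q\<close> and \<open>\<alpha> q\<close>, which makes both terms of the resulting inequality comparable.\<close>

lemma symmetric_form_bound:
  fixes G :: "real mat"
  assumes G: "G \<in> carrier_mat d d" and sym: "transpose_mat G = G" and \<alpha>: "0 < \<alpha>"
    and bd: "\<And>p. p \<in> carrier_vec d \<Longrightarrow> \<bar>Matrix.scalar_prod p (G *\<^sub>v p)\<bar> \<le> \<alpha> * Matrix.scalar_prod p p"
    and q: "q \<in> carrier_vec d"
  shows "Matrix.scalar_prod (G *\<^sub>v q) (G *\<^sub>v q) \<le> \<alpha>\<^sup>2 * Matrix.scalar_prod q q"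
proof -
  define r where "r = G *\<^sub>v q"
  define q' where "q' = \<alpha> \<cdot>\<^sub>v q"
  have c: "r \<in> carrier_vec d" "q' \<in> carrier_vec d" "G *\<^sub>v r \<in> carrier_vec d" "G *\<^sub>v q' \<in> carrier_vec d"
    using G q by (auto simp: r_def q'_def intro!: mult_mat_vec_carrier[of _ d d])
  let ?sp = "Matrix.scalar_prod"
  have Gq': "G *\<^sub>v q' = \<alpha> \<cdot>\<^sub>v r" unfolding q'_def r_def by (rule mult_mat_vec[OF G q])
  have s1: "?sp r (G *\<^sub>v q') = \<alpha> * ?sp r r" unfolding Gq' using c by simp
  have s2: "?sp q' (G *\<^sub>v r) = \<alpha> * ?sp r r"
    using transpose_vec_mult_scalar[OF G c(1) c(2)] s1 comm_scalar_prod[OF c(1) c(4)] by (simp add: sym)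
  have "?sp (r + q') (G *\<^sub>v (r + q')) = ?sp r (G *\<^sub>v r) + ?sp r (G *\<^sub>v q') + ?sp q' (G *\<^sub>v r) + ?sp q' (G *\<^sub>v q')"
    using c by (simp add: mult_add_distrib_mat_vec[OF G] add_scalar_prod_distrib[of _ d] scalar_prod_add_distrib[of _ d])
  moreover have "?sp (r - q') (G *\<^sub>v (r - q')) = ?sp r (G *\<^sub>v r) - ?sp r (G *\<^sub>v q') - ?sp q' (G *\<^sub>v r) + ?sp q' (G *\<^sub>v q')"
    using c by (simp add: mult_minus_distrib_mat_vec[OF G] minus_scalar_prod_distrib[of _ d] scalar_prod_minus_distrib[of _ d])
  moreover have pp: "?sp (r + q') (r + q') = ?sp r r + ?sp r q' + ?sp q' r + ?sp q' q'"
    using c by (simp add: add_scalar_prod_distrib[of _ d] scalar_prod_add_distrib[of _ d])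
  moreover have mm: "?sp (r - q') (r - q') = ?sp r r - ?sp r q' - ?sp q' r + ?sp q' q'"
    using c by (simp add: minus_scalar_prod_distrib[of _ d] scalar_prod_minus_distrib[of _ d])
  moreover have "\<alpha> * ?sp (r + q') (r + q') + \<alpha> * ?sp (r - q') (r - q') = \<alpha> * (2 * ?sp r r + 2 * ?sp q' q')"
    unfolding pp mm by (simp add: algebra_simps)
  moreover have "?sp (r + q') (G *\<^sub>v (r + q')) \<le> \<alpha> * ?sp (r + q') (r + q')"
    using bd[of "r + q'"] c by simp
  moreover have "- (\<alpha> * ?sp (r - q') (r - q')) \<le> ?sp (r - q') (G *\<^sub>v (r - q'))"
    using bd[of "r - q'"] c by simp
  ultimately have "4 * \<alpha> * ?sp r r \<le> \<alpha> * (2 * ?sp r r + 2 * ?sp q' q')"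
    using s1 s2 by linarith
  then have "4 * ?sp r r \<le> 2 * ?sp r r + 2 * ?sp q' q'" using \<alpha> by simp
  moreover have "?sp q' q' = \<alpha>\<^sup>2 * ?sp q q" unfolding q'_def using q by (simp add: power2_eq_square)
  ultimately show ?thesis by (simp add: r_def)
qed

lemma loewner_le_form:
  assumes "loewner_le d A B" "v \<in> carrier_vec d"
  shows "Matrix.scalar_prod v (A *\<^sub>v v) \<le> Matrix.scalar_prod v (B *\<^sub>v v)"
proof -
  have AB: "A \<in> carrier_mat d d" "B \<in> carrier_mat d d"
    using assms unfolding loewner_le_def symmetric_mat_def by auto
  have "0 \<le> Matrix.scalar_prod v ((B - A) *\<^sub>v v)"
    using assms unfolding loewner_le_def psd_mat_def by auto
  also have "\<dots> = Matrix.scalar_prod v (B *\<^sub>v v) - Matrix.scalar_prod v (A *\<^sub>v v)"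
    using AB assms(2) by (simp add: minus_mult_distrib_mat_vec[of _ d d] scalar_prod_minus_distrib[of _ d] mult_mat_vec_carrier[of _ d d])
  finally show ?thesis by simp
qed

lemma loewner_within_form:
  assumes l: "loewner_le d ((1 - \<alpha>) \<cdot>\<^sub>m S) N" "loewner_le d N ((1 + \<alpha>) \<cdot>\<^sub>m S)"
    and S: "S \<in> carrier_mat d d" and v: "v \<in> carrier_vec d"
  shows "\<bar>Matrix.scalar_prod v ((N - S) *\<^sub>v v)\<bar> \<le> \<alpha> * Matrix.scalar_prod v (S *\<^sub>v v)"
proof -
  have N: "N \<in> carrier_mat d d" using l unfolding loewner_le_def symmetric_mat_def by auto
  have sm: "Matrix.scalar_prod v ((k \<cdot>\<^sub>m S) *\<^sub>v v) = k * Matrix.scalar_prod v (S *\<^sub>v v)" for k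
  proof -
    have "(k \<cdot>\<^sub>m S) *\<^sub>v v = k \<cdot>\<^sub>v (S *\<^sub>v v)" using S v by (intro eq_vecI) auto
    then show ?thesis using S v by simp
  qed
  have "Matrix.scalar_prod v ((N - S) *\<^sub>v v) = Matrix.scalar_prod v (N *\<^sub>v v) - Matrix.scalar_prod v (S *\<^sub>v v)"
    using N S v by (simp add: minus_mult_distrib_mat_vec[of _ d d] scalar_prod_minus_distrib[of _ d] mult_mat_vec_carrier[of _ d d])
  then show ?thesis
    using loewner_le_form[OF l(1) v] loewner_le_form[OF l(2) v] unfolding sm by (simp add: abs_le_iff algebra_simps)
qed

section \<open>Dimension at least two\<close>

lemma mat_entry_unit:
  fixes A :: "real mat"
  assumes "A \<in> carrier_mat d d" "i < d" "k < d"
  shows "vec_index (A *\<^sub>v unit_vec d k) i = A $$ (i, k)"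
  using assms by (auto simp: scalar_prod_def unit_vec_def if_distrib cong: if_cong)

lemma reg_root_transpose_unit:
  assumes "k < m" "2 * m \<le> d"
  shows "transpose_mat (reg_root d m B) *\<^sub>v unit_vec d k = unit_vec d k"
proof (rule eq_vecI)
  fix i assume "i < dim_vec (unit_vec d k)"
  then have "vec_index (transpose_mat (reg_root d m B) *\<^sub>v unit_vec d k) i = reg_root d m B $$ (k, i)"
    using assms by (subst mat_entry_unit[of _ d]) auto
  then show "vec_index (transpose_mat (reg_root d m B) *\<^sub>v unit_vec d k) i = vec_index (unit_vec d k) i"
    using assms \<open>i < dim_vec (unit_vec d k)\<close> by (auto simp: reg_root_def unit_vec_def)
qed simp

text \<open>Write the error of the estimate as \<open>D = R G R\<^sup>T\<close> with the root \<open>R\<close> of the covariance. The hypothesis says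
  that the quadratic form of \<open>G\<close> lies between \<open>-\<alpha>\<close> and \<open>\<alpha>\<close> times the identity, hence \<open>G\<close> has operator norm at most \<open>\<alpha>\<close>. As \<open>R\<close> is unipotent,
  the response block of \<open>D\<close> is the one of \<open>G\<close>, with \<open>m\<close> columns of norm at most \<open>\<alpha>\<close>, plus \<open>B\<close> times the regressor block of
  \<open>G\<close>, with norm at most \<open>\<alpha>\<close> times that of \<open>B\<close>. The size of \<open>B\<close> enters through its
  Frobenius norm alone, which the prior controls coordinate by coordinate.\<close>

lemma reg_accuracy:
  assumes d: "2 * m \<le> d" and \<alpha>: "0 < \<alpha>"
    and l: "loewner_le d ((1 - \<alpha>) \<cdot>\<^sub>m reg_cov d m B) (Matrix.mat d d Y)"
      "loewner_le d (Matrix.mat d d Y) ((1 + \<alpha>) \<cdot>\<^sub>m reg_cov d m B)"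
  shows "L2_set (\<lambda>(j, k). Y (m + j, k) - B (j, k)) (coeff_index m) \<le> \<alpha> * (L2_set B (coeff_index m) + sqrt m)"
proof -
  let ?R = "reg_root d m B" and ?C = "reg_root d m (\<lambda>e. - B e)" and ?S = "reg_cov d m B"
  let ?sp = "Matrix.scalar_prod"
  \<comment> \<open>\<open>?C\<close> is the inverse of \<open>?R\<close>, so \<open>G\<close> is the error in coordinates in which \<open>?S\<close> is the identity.\<close>
  define D where "D = Matrix.mat d d Y - ?S"
  define G where "G = ?C * (D * transpose_mat ?C)"
  have D[simp]: "D \<in> carrier_mat d d" unfolding D_def by (rule minus_carrier_mat[OF reg_cov_carrier])
  have G[simp]: "G \<in> carrier_mat d d" unfolding G_def by (intro mult_carrier_mat[of _ d d]) auto
  have symY: "transpose_mat (Matrix.mat d d Y) = Matrix.mat d d Y"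
    using l unfolding loewner_le_def symmetric_mat_def by auto
  have symD: "transpose_mat D = D"
    unfolding D_def using symY reg_cov_symmetric[of d m B] by (subst transpose_minus[of _ d d]) auto
  have symG: "transpose_mat G = G"
    unfolding G_def
    by (simp add: transpose_mult[of _ d d _ d] mult_carrier_mat[of _ d d _ d] symD assoc_mult_mat[of _ d d _ d _ d])
  have tC: "transpose_mat ?R * transpose_mat ?C = 1\<^sub>m d" "transpose_mat ?C * transpose_mat ?R = 1\<^sub>m d"
    by (rule transpose_mult_one[of ?C d ?R], simp_all add: reg_root_inverse'[OF d])
      (rule transpose_mult_one[of ?R d ?C], simp_all add: reg_root_inverse[OF d])
  have Gv: "G *\<^sub>v p = ?C *\<^sub>v (D *\<^sub>v (transpose_mat ?C *\<^sub>v p))" if "p \<in> carrier_vec d" for p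
    unfolding G_def using that
    by (simp add: assoc_mult_mat_vec[of _ d d _ d] mult_carrier_mat[of _ d d _ d])
  have form: "\<bar>?sp p (G *\<^sub>v p)\<bar> \<le> \<alpha> * ?sp p p" if p: "p \<in> carrier_vec d" for p
  proof -
    define v where "v = transpose_mat ?C *\<^sub>v p"
    have v: "v \<in> carrier_vec d" unfolding v_def using p by (intro mult_mat_vec_carrier[of _ d d]) auto
    have "?sp p (G *\<^sub>v p) = ?sp v (D *\<^sub>v v)"
      unfolding Gv[OF p] v_def[symmetric] using p v
      by (subst transpose_vec_mult_scalar[of ?C d d _ p, symmetric]) (auto simp: v_def[symmetric] intro: mult_mat_vec_carrier[of _ d d])
    moreover have "transpose_mat ?R *\<^sub>v v = p"
      unfolding v_def using p by (subst assoc_mult_mat_vec[of _ d d _ d, symmetric]) (auto simp: tC)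
    then have "?sp v (?S *\<^sub>v v) = ?sp p p" unfolding reg_cov_form[OF v] by simp
    moreover have "\<bar>?sp v (D *\<^sub>v v)\<bar> \<le> \<alpha> * ?sp v (?S *\<^sub>v v)"
      unfolding D_def by (rule loewner_within_form[OF l reg_cov_carrier v])
    ultimately show ?thesis by simp
  qed
  have op: "?sp (G *\<^sub>v q) (G *\<^sub>v q) \<le> \<alpha>\<^sup>2 * ?sp q q" if "q \<in> carrier_vec d" for q
    by (rule symmetric_form_bound[OF G symG \<alpha> _ that]) (rule form)
  \<comment> \<open>Since \<open>C\<close> is the inverse of \<open>R\<close>, this inverts the definition of \<open>G\<close>.\<close>
  have DG: "D *\<^sub>v p = ?R *\<^sub>v (G *\<^sub>v (transpose_mat ?R *\<^sub>v p))" if p: "p \<in> carrier_vec d" for p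
  proof -
    define q where "q = transpose_mat ?R *\<^sub>v p"
    have q: "q \<in> carrier_vec d" unfolding q_def using p by (intro mult_mat_vec_carrier[of _ d d]) auto
    have Cq: "transpose_mat ?C *\<^sub>v q = p"
      unfolding q_def using p by (subst assoc_mult_mat_vec[of _ d d _ d, symmetric]) (auto simp: tC)
    have Dp: "D *\<^sub>v p \<in> carrier_vec d" using p by (intro mult_mat_vec_carrier[of _ d d]) auto
    have "?R *\<^sub>v (?C *\<^sub>v (D *\<^sub>v p)) = (?R * ?C) *\<^sub>v (D *\<^sub>v p)"
      by (rule assoc_mult_mat_vec[of _ d d _ d, symmetric]) (use Dp in auto)
    then show ?thesis unfolding q_def[symmetric] Gv[OF q] Cq using Dp by (simp add: reg_root_inverse[OF d])
  qed
  have entry: "Y (m + j, k) - B (j, k) = G $$ (m + j, k) + (\<Sum>a<m. B (j, a) * G $$ (a, k))"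
    if jk: "j < m" "k < m" for j k
  proof -
    have lt: "m + j < d" "k < d" using jk d by auto
    have "D $$ (m + j, k) = vec_index (D *\<^sub>v unit_vec d k) (m + j)"
      using mat_entry_unit[OF D lt] by simp
    also have "D *\<^sub>v unit_vec d k = ?R *\<^sub>v (G *\<^sub>v unit_vec d k)"
      using reg_root_transpose_unit[OF jk(2) d, of B] by (subst DG) auto
    also have "G *\<^sub>v unit_vec d k = Matrix.vec d (\<lambda>a. G $$ (a, k))"
      using mat_entry_unit[OF G _ lt(2)] by (intro eq_vecI) (auto simp: carrier_matD[OF G])
    finally have D1: "D $$ (m + j, k) = G $$ (m + j, k) + reg_mean m B (m + j) (\<lambda>a. G $$ (a, k))"
      using lt by (simp add: reg_root_mult_vec[OF d])
    have "?S $$ (m + j, k) = vec_index (?S *\<^sub>v unit_vec d k) (m + j)"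
      using mat_entry_unit[OF reg_cov_carrier lt] by simp
    also have "?S *\<^sub>v unit_vec d k = ?R *\<^sub>v (transpose_mat ?R *\<^sub>v unit_vec d k)"
      unfolding reg_cov_def by (rule assoc_mult_mat_vec[of _ d d _ d]) auto
    also have "\<dots> = ?R *\<^sub>v unit_vec d k" using reg_root_transpose_unit[OF jk(2) d, of B] by simp
    also have "vec_index (?R *\<^sub>v unit_vec d k) (m + j) = ?R $$ (m + j, k)"
      using mat_entry_unit[OF reg_root_carrier lt] by simp
    also have "\<dots> = B (j, k)" using jk lt by (simp add: reg_root_def)
    finally have S1: "?S $$ (m + j, k) = B (j, k)" .
    have "D $$ (m + j, k) = Y (m + j, k) - ?S $$ (m + j, k)" using lt by (simp add: D_def carrier_matD[OF reg_cov_carrier])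
    then show ?thesis using D1 S1 jk by (simp add: reg_mean_def)
  qed
  \<comment> \<open>The two parts of the error: columns of \<open>G\<close>, and rows of \<open>B\<close> multiplied by \<open>G\<close>.\<close>
  let ?E1 = "\<lambda>(j, k). G $$ (m + j, k)" and ?E2 = "\<lambda>(j, k). \<Sum>a<m. B (j, a) * G $$ (a, k)"
  have "L2_set (\<lambda>(j, k). Y (m + j, k) - B (j, k)) (coeff_index m) = L2_set (\<lambda>e. ?E1 e + ?E2 e) (coeff_index m)"
    by (rule L2_set_cong) (auto simp: entry)
  also have "\<dots> \<le> L2_set ?E1 (coeff_index m) + L2_set ?E2 (coeff_index m)" by (rule L2_set_triangle_ineq)
  also have "L2_set ?E1 (coeff_index m) \<le> \<alpha> * sqrt m"
  proof -
    have "(\<Sum>j<m. (G $$ (m + j, k))\<^sup>2) \<le> \<alpha>\<^sup>2" if k: "k < m" for k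
    proof -
      have kd: "k < d" using k d by simp
      have "(\<Sum>j<m. (G $$ (m + j, k))\<^sup>2) = (\<Sum>i\<in>(\<lambda>j. m + j) ` {..<m}. (G $$ (i, k))\<^sup>2)"
        by (subst sum.reindex) (auto simp: o_def)
      also have "\<dots> \<le> (\<Sum>i<d. (G $$ (i, k))\<^sup>2)" using d by (intro sum_mono2) auto
      also have "\<dots> = ?sp (G *\<^sub>v unit_vec d k) (G *\<^sub>v unit_vec d k)"
        unfolding scalar_prod_self using mat_entry_unit[OF G _ kd] by (intro sum.cong) (auto simp: carrier_matD[OF G])
      also have "\<dots> \<le> \<alpha>\<^sup>2 * ?sp (unit_vec d k) (unit_vec d k)" by (rule op) auto
      also have "?sp (unit_vec d k) (unit_vec d k :: real Matrix.vec) = 1" using kd by simp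
      finally show ?thesis by simp
    qed
    then have "(\<Sum>k<m. \<Sum>j<m. (G $$ (m + j, k))\<^sup>2) \<le> (\<Sum>k<m. \<alpha>\<^sup>2)" by (intro sum_mono) auto
    moreover have "(\<Sum>e\<in>coeff_index m. (?E1 e)\<^sup>2) = (\<Sum>k<m. \<Sum>j<m. (G $$ (m + j, k))\<^sup>2)"
      by (subst sum.swap) (simp add: sum.cartesian_product case_prod_beta')
    ultimately have "(\<Sum>e\<in>coeff_index m. (?E1 e)\<^sup>2) \<le> (\<alpha> * sqrt m)\<^sup>2"
      by (simp add: power_mult_distrib mult.commute)
    then show ?thesis unfolding L2_set_def using \<alpha> by (intro real_le_lsqrt) (auto intro!: sum_nonneg)
  qed
  also have "L2_set ?E2 (coeff_index m) \<le> \<alpha> * L2_set B (coeff_index m)"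
  proof -
    have row: "(\<Sum>k<m. (\<Sum>a<m. B (j, a) * G $$ (a, k))\<^sup>2) \<le> \<alpha>\<^sup>2 * (\<Sum>a<m. (B (j, a))\<^sup>2)" for j
    proof -
      define q where "q = Matrix.vec d (\<lambda>a. if a < m then B (j, a) else 0)"
      have q: "q \<in> carrier_vec d" by (simp add: q_def)
      have ix: "vec_index (G *\<^sub>v q) k = (\<Sum>a<m. B (j, a) * G $$ (a, k))" if "k < d" for k
      proof -
        have "vec_index (G *\<^sub>v q) k = (\<Sum>a<d. if a \<in> {..<m} then B (j, a) * G $$ (k, a) else 0)"
          using that by (auto simp: q_def scalar_prod_def sum_lessThan_ge0 carrier_matD[OF G] intro!: sum.cong)
        also have "\<dots> = (\<Sum>a\<in>{..<d} \<inter> {..<m}. B (j, a) * G $$ (k, a))" by (rule sum.inter_restrict[symmetric]) simp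
        also have "{..<d} \<inter> {..<m} = {..<m}" using d by auto
        also have "(\<Sum>a<m. B (j, a) * G $$ (k, a)) = (\<Sum>a<m. B (j, a) * G $$ (a, k))"
        proof (intro sum.cong refl arg_cong2[where f="(*)"])
          fix a assume "a \<in> {..<m}"
          then have "a < d" using d by auto
          then have "transpose_mat G $$ (k, a) = G $$ (a, k)" using that by (simp add: carrier_matD[OF G])
          then show "G $$ (k, a) = G $$ (a, k)" by (simp add: symG)
        qed
        finally show ?thesis .
      qed
      have "(\<Sum>k<m. (\<Sum>a<m. B (j, a) * G $$ (a, k))\<^sup>2) \<le> (\<Sum>k<d. (\<Sum>a<m. B (j, a) * G $$ (a, k))\<^sup>2)"
        using d by (intro sum_mono2) auto
      also have "\<dots> = ?sp (G *\<^sub>v q) (G *\<^sub>v q)"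
        unfolding scalar_prod_self using ix by (intro sum.cong) (auto simp: carrier_matD[OF G])
      also have "\<dots> \<le> \<alpha>\<^sup>2 * ?sp q q" by (rule op[OF q])
      also have "?sp q q = (\<Sum>a<d. if a \<in> {..<m} then (B (j, a))\<^sup>2 else 0)"
        unfolding scalar_prod_self by (auto simp: q_def intro!: sum.cong)
      also have "\<dots> = (\<Sum>a\<in>{..<d} \<inter> {..<m}. (B (j, a))\<^sup>2)" by (rule sum.inter_restrict[symmetric]) simp
      also have "{..<d} \<inter> {..<m} = {..<m}" using d by auto
      finally show ?thesis .
    qed
    have "(\<Sum>e\<in>coeff_index m. (?E2 e)\<^sup>2) = (\<Sum>j<m. \<Sum>k<m. (\<Sum>a<m. B (j, a) * G $$ (a, k))\<^sup>2)"
      by (simp add: sum.cartesian_product case_prod_beta')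
    also have "\<dots> \<le> (\<Sum>j<m. \<alpha>\<^sup>2 * (\<Sum>a<m. (B (j, a))\<^sup>2))" by (intro sum_mono row)
    also have "\<dots> = \<alpha>\<^sup>2 * (\<Sum>e\<in>coeff_index m. (B e)\<^sup>2)"
      by (simp add: sum.cartesian_product case_prod_beta' flip: sum_distrib_left)
    finally have "L2_set ?E2 (coeff_index m) \<le> sqrt (\<alpha>\<^sup>2 * (\<Sum>e\<in>coeff_index m. (B e)\<^sup>2))"
      unfolding L2_set_def by (rule real_sqrt_le_mono)
    then show ?thesis unfolding L2_set_def using \<alpha> by (simp add: real_sqrt_mult)
  qed
  finally show ?thesis by (simp add: algebra_simps)
qed

text \<open>If \<open>u\<close> is close to \<open>b\<close>, its direction has nearly the largest possible inner product with \<open>b\<close>. If \<open>u\<close>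
  vanishes, division by zero makes the direction 0, and the left side is not positive.\<close>

lemma direction_correlation:
  fixes u b :: "'e \<Rightarrow> real"
  assumes "finite E"
  shows "L2_set b E - 2 * L2_set (\<lambda>e. u e - b e) E \<le> (\<Sum>e\<in>E. u e / L2_set u E * b e)"
proof (cases "L2_set u E = 0")
  case True
  then have u0: "u e = 0" if "e \<in> E" for e using that assms by (simp add: L2_set_eq_0_iff)
  have "L2_set (\<lambda>e. u e - b e) E = L2_set b E" unfolding L2_set_def using u0 by simp
  then show ?thesis using True by simp
next
  case False
  define r where "r = L2_set u E"
  have r: "r > 0" using False L2_set_nonneg[of u E] unfolding r_def less_le by auto
  let ?w = "\<lambda>e. u e - b e"
  have rr: "(\<Sum>e\<in>E. (u e)\<^sup>2) = r\<^sup>2" by (simp add: r_def L2_set_def sum_nonneg)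
  have tri: "L2_set b E \<le> r + L2_set ?w E"
  proof -
    have "L2_set (\<lambda>e. u e + - ?w e) E \<le> L2_set u E + L2_set (\<lambda>e. - ?w e) E" by (rule L2_set_triangle_ineq)
    then show ?thesis by (simp add: r_def L2_set_def power2_commute)
  qed
  have "(\<Sum>e\<in>E. u e * ?w e) \<le> (\<Sum>e\<in>E. \<bar>u e\<bar> * \<bar>?w e\<bar>)" by (intro sum_mono) (simp flip: abs_mult)
  also have "\<dots> \<le> r * L2_set ?w E" unfolding r_def by (rule L2_set_mult_ineq)
  finally have "(\<Sum>e\<in>E. u e * ?w e) / r \<le> L2_set ?w E" using r by (simp add: field_simps)
  moreover have "(\<Sum>e\<in>E. u e / r * b e) = r - (\<Sum>e\<in>E. u e * ?w e) / r"
  proof -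
    have "(\<Sum>e\<in>E. u e / r * b e) = (\<Sum>e\<in>E. (u e)\<^sup>2 - u e * ?w e) / r"
      unfolding sum_divide_distrib by (intro sum.cong) (auto simp: power2_eq_square algebra_simps)
    also have "\<dots> = (r\<^sup>2 - (\<Sum>e\<in>E. u e * ?w e)) / r" by (simp add: sum_subtractf rr)
    finally show ?thesis using r by (simp add: field_simps power2_eq_square)
  qed
  ultimately show ?thesis using tri by (simp add: r_def[symmetric])
qed

lemma direction_unit:
  fixes u :: "'e \<Rightarrow> real"
  shows "(\<Sum>e\<in>E. (u e / L2_set u E)\<^sup>2) \<le> 1"
proof -
  have "(\<Sum>e\<in>E. (u e / L2_set u E)\<^sup>2) = (\<Sum>e\<in>E. (u e)\<^sup>2) / (L2_set u E)\<^sup>2"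
    by (simp add: power_divide sum_divide_distrib)
  also have "\<dots> \<le> 1" by (simp add: L2_set_def sum_nonneg divide_le_eq_1)
  finally show ?thesis .
qed

lemma unit_correlation_ge:
  fixes f b :: "'e \<Rightarrow> real"
  assumes "(\<Sum>e\<in>E. (f e)\<^sup>2) \<le> 1"
  shows "\<bar>\<Sum>e\<in>E. f e * b e\<bar> \<le> L2_set b E"
proof -
  have "\<bar>\<Sum>e\<in>E. f e * b e\<bar> \<le> (\<Sum>e\<in>E. \<bar>f e\<bar> * \<bar>b e\<bar>)" using sum_abs[of "\<lambda>e. f e * b e" E] by (simp add: abs_mult)
  also have "\<dots> \<le> L2_set f E * L2_set b E" by (rule L2_set_mult_ineq)
  also have "\<dots> \<le> L2_set b E" using assms by (intro mult_left_le_one_le) (auto simp: L2_set_def sum_nonneg)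
  finally show ?thesis .
qed

text \<open>On \<open>S\<close> the value is at least \<open>\<beta> - t\<close>, elsewhere at least \<open>- \<beta>\<close>; with probability \<open>2/3\<close> for \<open>S\<close> this
  averages to at least \<open>\<beta> / 3 - t\<close>. The set \<open>S\<close> is measurable because non-measurable sets have measure 0.\<close>

lemma expectation_from_event:
  fixes g :: "'a \<Rightarrow> real"
  assumes "prob_space N" and S: "2 / 3 \<le> measure N S"
    and I: "g \<in> borel_measurable N" and abs: "\<And>y. y \<in> space N \<Longrightarrow> \<bar>g y\<bar> \<le> \<beta>"
    and on: "\<And>y. y \<in> S \<Longrightarrow> y \<in> space N \<Longrightarrow> \<beta> - t \<le> g y" and t: "0 \<le> t"
  shows "\<beta> / 3 - t \<le> (\<integral>y. g y \<partial>N)"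
proof -
  interpret prob_space N by fact
  have Ss: "S \<in> sets N" using S measure_notin_sets[of S N] by force
  have \<beta>: "0 \<le> \<beta>" using abs not_empty by fastforce
  have ind: "integrable N (indicator S :: 'a \<Rightarrow> real)"
    using Ss by (intro integrable_real_indicator) (simp_all add: less_top[symmetric])
  have "\<beta> / 3 - t \<le> 2 * \<beta> * prob S - \<beta> - t" using mult_left_mono[OF S, of \<beta>] \<beta> by simp
  also have "\<dots> = (\<integral>y. 2 * \<beta> * indicator S y - (\<beta> + t) \<partial>N)"
    using ind Ss by (subst Bochner_Integration.integral_diff) (auto simp: prob_space)
  also have "\<dots> \<le> (\<integral>y. g y \<partial>N)"
  proof (rule integral_mono)
    show "integrable N g" using I abs by (intro integrable_const_bound[where B=\<beta>]) auto
    fix y assume y: "y \<in> space N"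
    show "2 * \<beta> * indicator S y - (\<beta> + t) \<le> g y"
      using on[OF _ y] abs[OF y] t by (cases "y \<in> S") (auto simp: abs_le_iff)
  qed (use ind in auto)
  finally show ?thesis .
qed

lemma output_law_prob:
  assumes "mechanism n P Q M" "prob_space P"
  shows "prob_space (output_law n P M)" "sets (output_law n P M) = sets Q"
proof -
  have A: "(\<Pi>\<^sub>M i\<in>{..<n}. P) \<in> space (prob_algebra (\<Pi>\<^sub>M i\<in>{..<n}. P))"
    using assms(2) by (auto simp: space_prob_algebra intro!: prob_space_PiM)
  show "prob_space (output_law n P M)"
    unfolding output_law_def using assms(1) unfolding mechanism_def by (rule prob_space_bind'[OF A])
  show "sets (output_law n P M) = sets Q"
    unfolding output_law_def using assms(1) unfolding mechanism_def by (rule sets_bind'[OF A])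
qed

lemma mechanism_reg:
  assumes "mechanism n (borel_vec d) Q M"
  shows "mechanism n (reg d m B) Q M"
  using assms unfolding mechanism_def by (simp cong: measurable_cong_sets[OF sets_reg_data refl])

text \<open>The estimated block of the covariance, scaled to norm 1.\<close>

definition out_direction :: "nat \<Rightarrow> nat \<times> nat \<Rightarrow> (nat \<times> nat \<Rightarrow> real) \<Rightarrow> real" where
  "out_direction m e Y = (let u = (\<lambda>(j, k). Y (m + j, k)) in u e / L2_set u (coeff_index m))"

lemma out_direction_measurable:
  assumes d: "2 * m \<le> d" and e: "e \<in> coeff_index m"
  shows "out_direction m e \<in> borel_measurable (borel_mat d)"
proof -
  have c: "(\<lambda>Y. case e of (j, k) \<Rightarrow> Y (m + j, k)) \<in> borel_measurable (borel_mat d)" if "e \<in> coeff_index m" for e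
    using that d by (cases e) (auto intro!: measurable_component_singleton)
  show ?thesis unfolding out_direction_def Let_def L2_set_def
    by (intro borel_measurable_divide c e measurable_compose[OF _ borel_measurable_sqrt] borel_measurable_sum borel_measurable_power)
qed

lemma accuracy_multivariate:
  assumes d: "2 * m \<le> d" and \<alpha>: "0 < \<alpha>"
    and mech: "mechanism n (borel_vec d) (borel_mat d) M"
    and acc: "2 / 3 \<le> measure (output_law n (mvn d (reg_cov d m B)) M)
           {Y \<in> space (borel_mat d).
              loewner_le d ((1 - \<alpha>) \<cdot>\<^sub>m reg_cov d m B) (Matrix.mat d d Y) \<and>
              loewner_le d (Matrix.mat d d Y) ((1 + \<alpha>) \<cdot>\<^sub>m reg_cov d m B)}"
  shows "L2_set B (coeff_index m) / 3 - 2 * \<alpha> * (L2_set B (coeff_index m) + sqrt m) \<le>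
    (\<integral>y. (\<Sum>e\<in>coeff_index m. out_direction m e y * B e) \<partial>output_law n (reg d m B) M)"
proof (rule expectation_from_event[OF output_law_prob(1) acc[unfolded mvn_reg_cov[OF d]]])
  note mech' = mechanism_reg[OF mech, of m B]
  note sets = output_law_prob(2)[OF mech' prob_space_reg[OF d]]
  show "mechanism n (reg d m B) (borel_mat d) M" "prob_space (reg d m B)" by (rule mech', rule prob_space_reg[OF d])
  show "(\<lambda>y. \<Sum>e\<in>coeff_index m. out_direction m e y * B e) \<in> borel_measurable (output_law n (reg d m B) M)"
    using out_direction_measurable[OF d]
    by (simp cong: measurable_cong_sets[OF sets refl])
  show "\<bar>\<Sum>e\<in>coeff_index m. out_direction m e y * B e\<bar> \<le> L2_set B (coeff_index m)" for y
    unfolding out_direction_def Let_def by (intro unit_correlation_ge direction_unit)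
  fix Y assume "Y \<in> {Y \<in> space (borel_mat d).
              loewner_le d ((1 - \<alpha>) \<cdot>\<^sub>m reg_cov d m B) (Matrix.mat d d Y) \<and>
              loewner_le d (Matrix.mat d d Y) ((1 + \<alpha>) \<cdot>\<^sub>m reg_cov d m B)}"
  then have r: "L2_set (\<lambda>(j, k). Y (m + j, k) - B (j, k)) (coeff_index m) \<le> \<alpha> * (L2_set B (coeff_index m) + sqrt m)"
    by (intro reg_accuracy[OF d \<alpha>]) auto
  have "L2_set B (coeff_index m) - 2 * L2_set (\<lambda>e. (case e of (j, k) \<Rightarrow> Y (m + j, k)) - B e) (coeff_index m)
    \<le> (\<Sum>e\<in>coeff_index m. out_direction m e Y * B e)"
    unfolding out_direction_def Let_def by (rule direction_correlation) simp
  also have "(\<lambda>e. (case e of (j, k) \<Rightarrow> Y (m + j, k)) - B e) = (\<lambda>(j, k). Y (m + j, k) - B (j, k))" by auto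
  finally show "L2_set B (coeff_index m) - 2 * \<alpha> * (L2_set B (coeff_index m) + sqrt m)
      \<le> (\<Sum>e\<in>coeff_index m. out_direction m e Y * B e)" using r by simp
qed (use \<alpha> in \<open>auto intro!: add_nonneg_nonneg\<close>)

lemma exp_minus_one_le: "0 \<le> \<epsilon> \<Longrightarrow> \<epsilon> \<le> 1 \<Longrightarrow> exp \<epsilon> - 1 \<le> 2 * (\<epsilon>::real)"
  using exp_bound[of \<epsilon>] mult_left_le[of \<epsilon> \<epsilon>] by (simp add: power2_eq_square)

text \<open>The choice \<open>s = 32 \<alpha> / sqrt m\<close> makes the prior mean of the norm of \<open>B\<close> at least \<open>24 \<alpha> sqrt m\<close>. As \<open>1/3 - 2 \<alpha> \<ge> 1/4\<close>,
  at least \<open>6 \<alpha> sqrt m\<close> of it survives, and \<open>4 \<alpha> sqrt m\<close> after the error term \<open>2 \<alpha> sqrt m\<close> is subtracted.\<close>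

lemma sample_size_multivariate:
  assumes d: "2 \<le> d" and \<alpha>: "0 < \<alpha>" "\<alpha> \<le> 1 / 2048" and \<epsilon>: "0 < \<epsilon>" "\<epsilon> \<le> 1"
    and \<delta>: "0 \<le> \<delta>" "\<delta> \<le> \<epsilon>\<^sup>2 / (real d)\<^sup>2"
    and dp: "diff_private n (borel_vec d) (borel_mat d) \<epsilon> \<delta> M"
    and acc: "\<And>S. pos_def_mat d S \<Longrightarrow> 2 / 3 \<le> measure (output_law n (mvn d S) M)
           {Y \<in> space (borel_mat d). loewner_le d ((1 - \<alpha>) \<cdot>\<^sub>m S) (Matrix.mat d d Y) \<and>
              loewner_le d (Matrix.mat d d Y) ((1 + \<alpha>) \<cdot>\<^sub>m S)}"
  shows "real d / \<alpha>\<^sup>2 + real d powr (3 / 2) / (\<alpha> * \<epsilon>) \<le> 300000 * n"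
proof -
  define m where "m = d div 2"
  have m: "1 \<le> m" "2 * m \<le> d" "d \<le> 3 * m" using d by (auto simp: m_def)
  define r where "r = sqrt (real m)"
  have r: "0 < r" "r * r = m" using m by (auto simp: r_def)
  define s where "s = 32 * \<alpha> / r"
  have s: "0 < s" using \<alpha> r by (simp add: s_def)
  let ?\<pi> = "\<Pi>\<^sub>M e\<in>coeff_index m. normal_prior s"
  let ?L = "\<lambda>B. L2_set B (coeff_index m)"
  define A where "A = (\<lambda>B. ?L B / 3 - 2 * \<alpha> * (?L B + r))"
  have ne: "coeff_index m \<noteq> {}" using m by (auto simp: lessThan_empty_iff)
  note pn = prior_norm[OF s _ ne]
  have IL: "integrable ?\<pi> ?L" by (rule pn) simp
  interpret \<pi>: prob_space ?\<pi> by (intro prob_space_PiM prob_space_normal_density s)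
  have IA: "integrable ?\<pi> A" unfolding A_def using IL
    by (intro Bochner_Integration.integrable_diff Bochner_Integration.integrable_add integrable_mult_right integrable_divide \<pi>.integrable_const)
  have mech: "mechanism n (borel_vec d) (borel_mat d) M" using dp by (simp add: diff_private_def)
  have ac: "A B \<le> (\<integral>y. (\<Sum>e\<in>coeff_index m. out_direction m e y * B e) \<partial>output_law n (reg d m B) M)" for B
    unfolding A_def r_def by (rule accuracy_multivariate[OF m(2) \<alpha>(1) mech acc[OF pos_def_reg_cov[OF m(2)]]])
  have du: "(\<Sum>e\<in>coeff_index m. (out_direction m e y)\<^sup>2) \<le> 1" for y
    unfolding out_direction_def Let_def by (rule direction_unit)
  note main = regression_lower_bound[OF m(2,1) s dp _ \<delta>(1) out_direction_measurable[OF m(2)] du IA ac]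
  have "4 * \<alpha> * r \<le> 1 / 4 * (3 / 4 * s * m) - 2 * \<alpha> * r"
    using r by (simp add: s_def field_simps)
  also have "3 / 4 * s * m \<le> (\<integral>B. ?L B \<partial>?\<pi>)" using pn(2) by (simp add: real_sqrt_mult)
  also have "1 / 4 * (\<integral>B. ?L B \<partial>?\<pi>) - 2 * \<alpha> * r \<le> (1 / 3 - 2 * \<alpha>) * (\<integral>B. ?L B \<partial>?\<pi>) - 2 * \<alpha> * r"
    using \<alpha> by (intro diff_right_mono mult_right_mono Bochner_Integration.integral_nonneg) auto
  also have "\<dots> = (\<integral>B. (1 / 3 - 2 * \<alpha>) * ?L B - 2 * \<alpha> * r \<partial>?\<pi>)"
    using IL by (subst Bochner_Integration.integral_diff) (auto simp: \<pi>.prob_space)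
  also have "\<dots> = (\<integral>B. A B \<partial>?\<pi>)" by (simp add: A_def algebra_simps)
  finally have low: "4 * \<alpha> * r \<le> (\<integral>B. A B \<partial>?\<pi>)" by simp
  have s2: "s\<^sup>2 * m = 1024 * \<alpha>\<^sup>2" using r m(1) by (simp add: s_def power2_eq_square field_simps) 
  have "2 * \<delta> * m \<le> 2 * \<epsilon>"
  proof -
    have "\<delta> * m \<le> \<epsilon>\<^sup>2 / (real d)\<^sup>2 * d" using \<delta> m d by (intro mult_mono) auto
    also have "\<dots> = \<epsilon> * (\<epsilon> / d)" using d by (simp add: power2_eq_square)
    also have "\<dots> \<le> \<epsilon> * 1" using \<epsilon> d by (intro mult_left_mono) (auto simp: divide_le_eq_1)
    finally show ?thesis by simp
  qed
  then have "(exp \<epsilon> - 1) + 2 * \<delta> * m \<le> 4 * \<epsilon>" using exp_minus_one_le[of \<epsilon>] \<epsilon> by simp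
  then have "4 * \<alpha> * r \<le> s\<^sup>2 * (n * (4 * \<epsilon>))"
    using low main(1) \<epsilon> by (smt (verit) mult_left_mono of_nat_0_le_iff zero_le_power2)
  then have "4 * \<alpha> * r * m \<le> s\<^sup>2 * (n * (4 * \<epsilon>)) * m" by (rule mult_right_mono) simp
  also have "\<dots> = 1024 * \<alpha>\<^sup>2 * (n * (4 * \<epsilon>))" using s2 by (simp add: algebra_simps)
  finally have b1: "r * m \<le> 1024 * (\<alpha> * \<epsilon>) * n" using \<alpha> by (simp add: power2_eq_square)
  have "4 * \<alpha> * r * 1 \<le> s\<^sup>2 * (sqrt n * m)" using low main(2) \<epsilon> by simp
  also have "\<dots> = 1024 * \<alpha>\<^sup>2 * sqrt n" using s2 by (simp add: algebra_simps)
  finally have "r \<le> 256 * \<alpha> * sqrt n" using \<alpha> by (simp add: power2_eq_square)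
  then have "r * r \<le> (256 * \<alpha> * sqrt n) * (256 * \<alpha> * sqrt n)" using r \<alpha> by (intro mult_mono) auto
  also have "\<dots> = 65536 * \<alpha>\<^sup>2 * (sqrt n * sqrt n)" by (simp add: power2_eq_square mult_ac)
  finally have b2: "m \<le> 65536 * \<alpha>\<^sup>2 * n" using r by simp
  have dm: "real d \<le> 3 * m" using m by linarith
  have "real d powr (3 / 2) = d * sqrt d"
    using d powr_add[of "real d" 1 "1 / 2"] by (simp add: powr_half_sqrt)
  also have "\<dots> \<le> (3 * m) * (2 * r)"
  proof (intro mult_mono dm)
    have "sqrt d \<le> sqrt (4 * m)" using dm by simp
    then show "sqrt d \<le> 2 * r" by (simp add: r_def real_sqrt_mult)
  qed auto
  also have "\<dots> \<le> 6 * (1024 * (\<alpha> * \<epsilon>) * n)" using b1 by (simp add: algebra_simps)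
  finally have "real d powr (3 / 2) / (\<alpha> * \<epsilon>) \<le> 6144 * n" using \<alpha> \<epsilon> by (simp add: field_simps)
  moreover have "real d / \<alpha>\<^sup>2 \<le> 196608 * n" using dm b2 \<alpha> by (simp add: field_simps)
  ultimately show ?thesis by simp
qed

section \<open>Dimension one\<close>

definition scalar_cov :: "real \<Rightarrow> real mat" where
  "scalar_cov v = Matrix.mat 1 1 (\<lambda>_. v)"

lemma scalar_cov_form:
  assumes "w \<in> carrier_vec 1"
  shows "Matrix.scalar_prod w (scalar_cov v *\<^sub>v w) = v * (vec_index w 0)\<^sup>2"
  using assms by (simp add: scalar_cov_def scalar_prod_def power2_eq_square)

lemma pos_def_scalar_cov:
  assumes "0 < v"
  shows "pos_def_mat 1 (scalar_cov v)"
  unfolding pos_def_mat_def symmetric_mat_def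
proof (intro conjI ballI impI)
  show "scalar_cov v \<in> carrier_mat 1 1" by (simp add: scalar_cov_def)
  show "transpose_mat (scalar_cov v) = scalar_cov v" by (rule eq_matI) (auto simp: scalar_cov_def)
  fix w :: "real Matrix.vec" assume w: "w \<in> carrier_vec 1" "w \<noteq> 0\<^sub>v 1"
  have "vec_index w 0 \<noteq> 0"
  proof
    assume "vec_index w 0 = 0"
    then have "w = 0\<^sub>v 1" using w(1) by (intro eq_vecI) auto
    then show False using w(2) by simp
  qed
  then show "0 < Matrix.scalar_prod w (scalar_cov v *\<^sub>v w)"
    unfolding scalar_cov_form[OF w(1)] using assms by simp
qed

lemma mvn_scalar_cov:
  assumes v: "0 < v"
  shows "mvn 1 (scalar_cov v) = distr (density lborel (normal_density 0 (sqrt v))) (borel_vec 1) (\<lambda>t. \<lambda>i\<in>{..<1}. t)"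
proof -
  let ?N = "density lborel (\<lambda>t. ennreal (normal_density 0 (sqrt v) t))"
  have pr: "prob_space ?N" using v by (intro prob_space_normal_density) simp
  have one: "{..<1::nat} = {0}" by auto
  have inv: "mat_inverse (scalar_cov v) = Some (scalar_cov (1 / v))"
    using v by (intro mat_inverse_eqI[of _ 1]) (auto simp: scalar_cov_def scalar_prod_def intro!: eq_matI)
  have "mvn_density 1 (scalar_cov v) x = normal_density 0 (sqrt v) (x 0)" for x
  proof -
    have "Determinant.det (scalar_cov v) = v" by (subst det_single) (simp_all add: scalar_cov_def)
    moreover have "Matrix.scalar_prod (Matrix.vec 1 x) (scalar_cov (1 / v) *\<^sub>v Matrix.vec 1 x) = 1 / v * (x 0)\<^sup>2"
      by (subst scalar_cov_form) auto
    ultimately show ?thesis using v by (simp add: mvn_density_def inv normal_density_def)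
  qed
  then have "mvn 1 (scalar_cov v) = density (PiM {0} (\<lambda>_. lborel)) (\<lambda>x. \<Prod>i\<in>{0::nat}. ennreal (normal_density 0 (sqrt v) (x i)))"
    unfolding mvn_def one by simp
  also have "\<dots> = PiM {0} (\<lambda>_. ?N)"
    using prob_space_imp_sigma_finite[OF pr]
    by (intro PiM_density[symmetric]) (auto intro: lborel.sigma_finite_measure_axioms)
  also have "\<dots> = distr ?N (PiM {0} (\<lambda>_. ?N)) (\<lambda>t. \<lambda>i\<in>{0}. t)"
  proof -
    interpret product_sigma_finite "\<lambda>_::nat. ?N"
      by (intro product_sigma_finite.intro prob_space_imp_sigma_finite pr)
    show ?thesis by (rule distr_component[symmetric])
  qed
  also have "\<dots> = distr ?N (borel_vec 1) (\<lambda>t. \<lambda>i\<in>{..<1}. t)"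
    unfolding one by (intro distr_cong refl sets_PiM_cong) auto
  finally show ?thesis .
qed

lemma std_normal_PiM_combination:
  fixes c :: "nat \<Rightarrow> real"
  assumes d: "1 \<le> d" and c: "\<And>i. i < d \<Longrightarrow> c i \<noteq> 0"
  shows "distr (PiM {..<d} (\<lambda>_. std_normal)) lborel (\<lambda>x. \<Sum>i<d. c i * x i) = density lborel (normal_density 0 (sqrt (\<Sum>i<d. (c i)\<^sup>2)))"
proof -
  let ?N = "PiM {..<d} (\<lambda>_. std_normal)"
  interpret N: prob_space ?N by (intro prob_space_PiM prob_space_std_normal)
  have comp: "(\<lambda>x. x i) \<in> ?N \<rightarrow>\<^sub>M std_normal" if "i < d" for i
    using measurable_component_singleton[of i "{..<d}" "\<lambda>_. std_normal"] that by simp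
  have dist: "distr ?N std_normal (\<lambda>x. x i) = std_normal" if "i < d" for i
    using that by (intro distr_PiM_component prob_space_std_normal) auto
  have ne: "{..<d} \<noteq> {}" using d by (auto simp: lessThan_empty_iff)
  have "N.indep_vars (\<lambda>_. std_normal) (\<lambda>i x. x i) {..<d}"
  proof (subst N.indep_vars_iff_distr_eq_PiM'[OF ne])
    show "i \<in> {..<d} \<Longrightarrow> (\<lambda>x. x i) \<in> ?N \<rightarrow>\<^sub>M std_normal" for i using comp by simp
    have "distr ?N ?N (\<lambda>x. restrict x {..<d}) = distr ?N ?N (\<lambda>x. x)"
      by (intro distr_cong refl) (auto simp: space_PiM)
    also have "\<dots> = ?N" by (rule distr_id2) simp
    also have "?N = (\<Pi>\<^sub>M i\<in>{..<d}. distr ?N std_normal (\<lambda>x. x i))"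
      using dist by (intro PiM_cong refl) simp
    finally show "distr ?N ?N (\<lambda>x. \<lambda>i\<in>{..<d}. x i) = (\<Pi>\<^sub>M i\<in>{..<d}. distr ?N std_normal (\<lambda>x. x i))" .
  qed
  then have ind: "N.indep_vars (\<lambda>_. borel) (\<lambda>i x. c i * x i) {..<d}"
    by (rule N.indep_vars_compose2[where Y="\<lambda>i t. c i * t"]) simp
  have dn: "distributed ?N lborel (\<lambda>x. c i * x i) (normal_density 0 \<bar>c i\<bar>)" if "i < d" for i
  proof -
    have "distr ?N lborel (\<lambda>x. x i) = distr ?N std_normal (\<lambda>x. x i)" by (intro distr_cong) auto
    then have "distributed ?N lborel (\<lambda>x. x i) std_normal_density"
      unfolding distributed_def using comp[OF that] dist[OF that] by simp
    from N.normal_density_affine[OF this _ c[OF that], of 0] show ?thesis by simp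
  qed
  have "distributed ?N lborel (\<lambda>x. \<Sum>i<d. c i * x i) (normal_density (\<Sum>i<d. 0) (sqrt (\<Sum>i<d. \<bar>c i\<bar>\<^sup>2)))"
    using c by (intro N.sum_indep_normal ind dn ne) auto
  then show ?thesis by (simp add: distributed_distr_eq_density)
qed

text \<open>The sum of regressor and response of a regression with \<open>m = 1\<close>, as a point of the one-dimensional sample space.\<close>

definition pool :: "(nat \<Rightarrow> real) \<Rightarrow> nat \<Rightarrow> real" where
  "pool x = (\<lambda>i\<in>{..<1}. x 0 + x 1)"

lemma pool_measurable: "pool \<in> borel_vec 2 \<rightarrow>\<^sub>M borel_vec 1"
  unfolding pool_def[abs_def] by (intro measurable_restrict borel_measurable_add measurable_component_singleton) auto

lemma sets_reg_borel: "sets (reg d m B) = sets (borel_vec d)"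
  unfolding sets_reg by (intro sets_PiM_cong) auto

text \<open>The sum is \<open>(1 + b) x 0 + x 1\<close> in terms of the noise. For \<open>b = -1\<close> the first coefficient vanishes, and the
  formula for combinations with nonzero coefficients does not apply; only small \<open>b\<close> matter below.\<close>

lemma distr_reg_pool:
  assumes b: "B (0, 0) \<noteq> -1"
  shows "distr (reg 2 1 B) (borel_vec 1) pool = mvn 1 (scalar_cov (1 + (1 + B (0, 0))\<^sup>2))"
proof -
  let ?N = "PiM {..<2::nat} (\<lambda>_. std_normal)"
  define c where "c = (\<lambda>i::nat. if i = 0 then 1 + B (0, 0) else 1)"
  have two: "{..<2::nat} = {0, 1}" by auto
  have v: "(\<Sum>i<2. (c i)\<^sup>2) = 1 + (1 + B (0, 0))\<^sup>2" by (simp add: two c_def)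
  have pm: "pool \<in> lebesgue_vec 2 \<rightarrow>\<^sub>M borel_vec 1"
    using pool_measurable sets_reg_borel[of 2 1 B] by (simp cong: measurable_cong_sets)
  have reg1: "reg 2 1 B = distr ?N (lebesgue_vec 2) (reg_map 2 1 B)" by (rule reg_eq_distr) simp
  have cm: "(\<lambda>x. \<Sum>i<2. c i * x i) \<in> ?N \<rightarrow>\<^sub>M lborel"
    by (auto intro!: borel_measurable_sum borel_measurable_times borel_measurable_component simp: measurable_cong_sets[OF sets_std_normal_PiM refl])
  have "distr (reg 2 1 B) (borel_vec 1) pool = distr ?N (borel_vec 1) (pool \<circ> reg_map 2 1 B)"
    unfolding reg1 using pm by (intro distr_distr reg_map_measurable') auto
  also have "\<dots> = distr ?N (borel_vec 1) ((\<lambda>t. \<lambda>i\<in>{..<1}. t) \<circ> (\<lambda>x. \<Sum>i<2. c i * x i))"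
    by (intro distr_cong refl) (auto simp: pool_def reg_map_def reg_mean_def two c_def algebra_simps fun_eq_iff)
  also have "\<dots> = distr (distr ?N lborel (\<lambda>x. \<Sum>i<2. c i * x i)) (borel_vec 1) (\<lambda>t. \<lambda>i\<in>{..<1}. t)"
    by (intro distr_distr[symmetric] cm measurable_restrict) auto
  also have "\<dots> = mvn 1 (scalar_cov (1 + (1 + B (0, 0))\<^sup>2))"
  proof -
    have "distr ?N lborel (\<lambda>x. \<Sum>i<2. c i * x i) = density lborel (normal_density 0 (sqrt (1 + (1 + B (0, 0))\<^sup>2)))"
      by (rule std_normal_PiM_combination[of 2 c, unfolded v]) (use b in \<open>auto simp: c_def\<close>)
    then show ?thesis by (simp only: mvn_scalar_cov add_pos_nonneg zero_less_one zero_le_power2)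
  qed
  finally show ?thesis .
qed

definition pooled :: "nat \<Rightarrow> ((nat \<Rightarrow> nat \<Rightarrow> real) \<Rightarrow> 'b measure) \<Rightarrow> (nat \<Rightarrow> nat \<Rightarrow> real) \<Rightarrow> 'b measure" where
  "pooled n M X = M (compose {..<n} pool X)"

lemma pool_data_measurable: "compose {..<n} pool \<in> (\<Pi>\<^sub>M i\<in>{..<n}. borel_vec 2) \<rightarrow>\<^sub>M (\<Pi>\<^sub>M i\<in>{..<n}. borel_vec 1)"
  unfolding compose_def
proof (rule measurable_restrict)
  fix i assume "i \<in> {..<n}"
  then show "(\<lambda>X. pool (X i)) \<in> (\<Pi>\<^sub>M i\<in>{..<n}. borel_vec 2) \<rightarrow>\<^sub>M borel_vec 1"
    using measurable_compose[OF measurable_component_singleton[of i "{..<n}" "\<lambda>_. borel_vec 2"] pool_measurable] by simp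
qed

text \<open>Pooling acts on each sample separately, so it maps neighbouring data sets to neighbouring or equal ones.\<close>

lemma diff_private_pooled:
  fixes n :: nat
  assumes dp: "diff_private n (borel_vec 1) Q \<epsilon> \<delta> M" and \<epsilon>: "0 \<le> \<epsilon>" and \<delta>: "0 \<le> \<delta>"
  shows "diff_private n (borel_vec 2) Q \<epsilon> \<delta> (pooled n M)"
  unfolding diff_private_def
proof (intro conjI ballI impI)
  show "mechanism n (borel_vec 2) Q (pooled n M)"
    using dp unfolding diff_private_def mechanism_def pooled_def[abs_def]
    by (intro measurable_compose[OF pool_data_measurable]) auto
  fix X X' E
  assume X: "X \<in> space (\<Pi>\<^sub>M i\<in>{..<n}. borel_vec 2)" "X' \<in> space (\<Pi>\<^sub>M i\<in>{..<n}. borel_vec 2)"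
    and nb: "neighbouring n X X'" and E: "E \<in> sets Q"
  let ?Y = "compose {..<n} pool X" and ?Y' = "compose {..<n} pool X'"
  have Y: "?Y \<in> space (\<Pi>\<^sub>M i\<in>{..<n}. borel_vec 1)" "?Y' \<in> space (\<Pi>\<^sub>M i\<in>{..<n}. borel_vec 1)"
    by (rule measurable_space[OF pool_data_measurable X(1)], rule measurable_space[OF pool_data_measurable X(2)])
  show "measure (pooled n M X') E \<le> exp \<epsilon> * measure (pooled n M X) E + \<delta>"
  proof (cases "?Y = ?Y'")
    case True
    then show ?thesis
      unfolding pooled_def using mult_right_mono[of 1 "exp \<epsilon>" "measure (M ?Y) E"] \<epsilon> \<delta> by simp
  next
    case False
    have fin: "finite {i \<in> {..<n}. ?Y i \<noteq> ?Y' i}" by simp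
    have sub: "{i \<in> {..<n}. ?Y i \<noteq> ?Y' i} \<subseteq> {i \<in> {..<n}. X i \<noteq> X' i}" by (auto simp: compose_def)
    have "{i \<in> {..<n}. ?Y i \<noteq> ?Y' i} \<noteq> {}"
    proof
      assume none: "{i \<in> {..<n}. ?Y i \<noteq> ?Y' i} = {}"
      have "?Y i = ?Y' i" for i by (cases "i < n") (use none in \<open>auto simp: compose_def\<close>)
      then show False using False by blast
    qed
    then have "0 < card {i \<in> {..<n}. ?Y i \<noteq> ?Y' i}" using fin by (simp add: card_gt_0_iff)
    moreover have "card {i \<in> {..<n}. ?Y i \<noteq> ?Y' i} \<le> 1"
      using card_mono[OF _ sub] nb unfolding neighbouring_def by simp
    ultimately have "neighbouring n ?Y ?Y'" unfolding neighbouring_def by simp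
    then show ?thesis using dp Y E unfolding diff_private_def pooled_def by blast
  qed
qed

lemma output_law_pooled:
  assumes mech: "mechanism n (borel_vec 1) Q M" and b: "B (0, 0) \<noteq> -1"
  shows "output_law n (reg 2 1 B) (pooled n M) = output_law n (mvn 1 (scalar_cov (1 + (1 + B (0, 0))\<^sup>2))) M"
proof -
  let ?P = "reg 2 1 B" and ?P' = "mvn 1 (scalar_cov (1 + (1 + B (0, 0))\<^sup>2))"
  have prP: "prob_space ?P" by (rule prob_space_reg) simp
  have pm: "pool \<in> ?P \<rightarrow>\<^sub>M borel_vec 1"
    using pool_measurable by (simp only: measurable_cong_sets[OF sets_reg_borel refl])
  have prP': "prob_space ?P'"
    unfolding distr_reg_pool[of B, OF b, symmetric] by (rule prob_space.prob_space_distr[OF prP pm])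
  have sP': "sets ?P' = sets (borel_vec 1)"
    unfolding distr_reg_pool[of B, OF b, symmetric] by simp
  have sPP: "sets (\<Pi>\<^sub>M i\<in>{..<n}. ?P') = sets (\<Pi>\<^sub>M i\<in>{..<n}. borel_vec 1)"
    by (intro sets_PiM_cong refl sP')
  have "distr (\<Pi>\<^sub>M i\<in>{..<n}. ?P) (\<Pi>\<^sub>M i\<in>{..<n}. ?P') (compose {..<n} pool) = (\<Pi>\<^sub>M i\<in>{..<n}. distr ?P ?P' pool)"
  proof (rule distr_PiM_finite_prob_space)
    show "pool \<in> ?P \<rightarrow>\<^sub>M ?P'" using pm by (simp only: measurable_cong_sets[OF refl sP'])
    show "product_prob_space (\<lambda>_. ?P)" "product_prob_space (\<lambda>_. ?P')"
      by (intro product_prob_spaceI prP, intro product_prob_spaceI prP')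
  qed simp
  also have "distr ?P ?P' pool = ?P'"
    using distr_reg_pool[of B, OF b] sP' by (simp cong: distr_cong)
  finally have D: "distr (\<Pi>\<^sub>M i\<in>{..<n}. ?P) (\<Pi>\<^sub>M i\<in>{..<n}. ?P') (compose {..<n} pool) = (\<Pi>\<^sub>M i\<in>{..<n}. ?P')" .
  have "output_law n ?P' M = distr (\<Pi>\<^sub>M i\<in>{..<n}. ?P) (\<Pi>\<^sub>M i\<in>{..<n}. ?P') (compose {..<n} pool) \<bind> M"
    unfolding output_law_def D ..
  also have "\<dots> = (\<Pi>\<^sub>M i\<in>{..<n}. ?P) \<bind> (\<lambda>X. M (compose {..<n} pool X))"
  proof (rule bind_distr)
    show "compose {..<n} pool \<in> (\<Pi>\<^sub>M i\<in>{..<n}. ?P) \<rightarrow>\<^sub>M (\<Pi>\<^sub>M i\<in>{..<n}. ?P')"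
      using pool_data_measurable[of n] measurable_cong_sets[OF sets_reg_data[of n 2 1 B] sPP] by simp
    show "M \<in> (\<Pi>\<^sub>M i\<in>{..<n}. ?P') \<rightarrow>\<^sub>M subprob_algebra Q"
      using mech unfolding mechanism_def measurable_cong_sets[OF sPP refl] by (rule measurable_prob_algebraD)
    show "space (\<Pi>\<^sub>M i\<in>{..<n}. ?P) \<noteq> {}"
      using prob_space.not_empty[OF prob_space_PiM[OF prP]] .
  qed
  finally show ?thesis by (simp add: output_law_def pooled_def[abs_def])
qed

text \<open>The variance of the pooled sample is 2 for \<open>b = 0\<close> and increases with \<open>b\<close> near 0.\<close>

definition out_sign :: "(nat \<times> nat \<Rightarrow> real) \<Rightarrow> real" where
  "out_sign Y = (if 2 < Y (0, 0) then 1 else - 1)"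

lemma out_sign_measurable: "out_sign \<in> borel_measurable (borel_mat 1)"
proof -
  have [measurable]: "(\<lambda>Y. Y (0, 0)) \<in> borel_measurable (borel_mat 1)"
    using measurable_component_singleton[of "(0, 0)" "{..<1} \<times> {..<1::nat}" "\<lambda>_. borel :: real measure"] by simp
  show ?thesis unfolding out_sign_def[abs_def] by measurable
qed

text \<open>The variance deviates from 2 by about \<open>2 b\<close>, up to \<open>b\<^sup>2\<close>, and the estimate is off by at most \<open>4 \<alpha>\<close>. So
  a wrong sign forces \<open>2 \<bar>b\<bar>\<close> to be at most of that size.\<close>

lemma out_sign_correct:
  assumes \<alpha>: "0 < \<alpha>" "\<alpha> \<le> 1 / 2" and b: "\<bar>b\<bar> \<le> 1 / 3"
    and y: "(1 - \<alpha>) * (1 + (1 + b)\<^sup>2) \<le> Y (0, 0)" "Y (0, 0) \<le> (1 + \<alpha>) * (1 + (1 + b)\<^sup>2)"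
  shows "\<bar>b\<bar> - (4 * \<alpha> + 4 * b\<^sup>2) \<le> out_sign Y * b"
proof (cases "out_sign Y * b = \<bar>b\<bar>")
  case True
  then show ?thesis using \<alpha> zero_le_power2[of b] by linarith
next
  case False
  then have neg: "out_sign Y * b = - \<bar>b\<bar>" by (auto simp: out_sign_def)
  have "2 * \<bar>b\<bar> \<le> 4 * \<alpha> + 4 * b\<^sup>2"
  proof (cases "0 < b")
    case True
    then have "Y (0, 0) \<le> 2" using False by (auto simp: out_sign_def split: if_splits)
    then have "(1 - \<alpha>) * (2 + 2 * b + b\<^sup>2) \<le> 2" using y by (simp add: power2_eq_square algebra_simps)
    then have "2 * b + b\<^sup>2 \<le> \<alpha> * (2 + 2 * b + b\<^sup>2)" by (simp add: algebra_simps)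
    also have "\<dots> \<le> \<alpha> * 4"
    proof -
      have "b\<^sup>2 \<le> 1" using b True by (simp add: abs_square_le_1)
      then show ?thesis using \<alpha> b True by (intro mult_left_mono) auto
    qed
    finally show ?thesis using True by simp (smt (verit) zero_le_power2)
  next
    case False': False
    then have "b < 0" using False by (auto simp: out_sign_def split: if_splits)
    then have "2 \<le> Y (0, 0)" using False by (auto simp: out_sign_def split: if_splits)
    then have "2 \<le> (1 + \<alpha>) * (2 + 2 * b + b\<^sup>2)" using y by (simp add: power2_eq_square algebra_simps)
    then have "- 2 * b \<le> b\<^sup>2 + \<alpha> * (2 + 2 * b + b\<^sup>2)" by (simp add: algebra_simps)
    also have "\<alpha> * (2 + 2 * b + b\<^sup>2) \<le> \<alpha> * 4"
    proof -
      have "b\<^sup>2 \<le> 1" using b by (simp add: abs_square_le_1)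
      then show ?thesis using \<alpha> \<open>b < 0\<close> by (intro mult_left_mono) auto
    qed
    finally show ?thesis using \<open>b < 0\<close> by simp (smt (verit) zero_le_power2)
  qed
  then show ?thesis using neg by simp
qed

text \<open>For \<open>\<bar>b\<bar>\<close> above \<open>1/3\<close> the quadratic term makes the left side smaller than \<open>- \<bar>b\<bar>\<close>, a bound which
  holds for every output. The prior makes such \<open>b\<close> rare.\<close>

lemma accuracy_scalar:
  fixes B :: "nat \<times> nat \<Rightarrow> real"
  assumes \<alpha>: "0 < \<alpha>" "\<alpha> \<le> 1 / 2"
    and mech: "mechanism n (borel_vec 1) (borel_mat 1) M"
    and acc: "\<And>S. pos_def_mat 1 S \<Longrightarrow> 2 / 3 \<le> measure (output_law n (mvn 1 S) M)
           {Y \<in> space (borel_mat 1). loewner_le 1 ((1 - \<alpha>) \<cdot>\<^sub>m S) (Matrix.mat 1 1 Y) \<and>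
              loewner_le 1 (Matrix.mat 1 1 Y) ((1 + \<alpha>) \<cdot>\<^sub>m S)}"
  shows "\<bar>B (0, 0)\<bar> / 3 - (4 * \<alpha> + 4 * (B (0, 0))\<^sup>2) \<le> (\<integral>y. out_sign y * B (0, 0) \<partial>output_law n (reg 2 1 B) (pooled n M))"
proof -
  define b where "b = B (0, 0)"
  let ?O = "output_law n (reg 2 1 B) (pooled n M)"
  have mech2: "mechanism n (borel_vec 2) (borel_mat 1) (pooled n M)"
    using mech unfolding mechanism_def pooled_def[abs_def]
    by (intro measurable_compose[OF pool_data_measurable]) auto
  have prO: "prob_space ?O" and sO: "sets ?O = sets (borel_mat 1)"
    by (rule output_law_prob[OF mechanism_reg[OF mech2] prob_space_reg], simp)+
  interpret O: prob_space ?O by (rule prO)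
  note sm = out_sign_measurable
  have gm: "(\<lambda>y. out_sign y * b) \<in> borel_measurable ?O"
    unfolding measurable_cong_sets[OF sO refl] by (intro borel_measurable_times sm borel_measurable_const)
  have gb: "\<bar>out_sign y * b\<bar> \<le> \<bar>b\<bar>" for y by (simp add: out_sign_def)
  show ?thesis
  proof (cases "\<bar>b\<bar> \<le> 1 / 3")
    case True
    define v where "v = 1 + (1 + b)\<^sup>2"
    have v: "0 < v" by (simp add: v_def add_pos_nonneg)
    have Oeq: "?O = output_law n (mvn 1 (scalar_cov v)) M"
      unfolding v_def b_def using True by (intro output_law_pooled[OF mech]) (auto simp: b_def)
    have "\<bar>b\<bar> / 3 - (4 * \<alpha> + 4 * b\<^sup>2) \<le> (\<integral>y. out_sign y * b \<partial>?O)"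
    proof (rule expectation_from_event[OF prO acc[OF pos_def_scalar_cov[OF v], folded Oeq] gm gb])
      show "0 \<le> 4 * \<alpha> + 4 * b\<^sup>2" using \<alpha> by simp
      fix Y assume Y: "Y \<in> {Y \<in> space (borel_mat 1). loewner_le 1 ((1 - \<alpha>) \<cdot>\<^sub>m scalar_cov v) (Matrix.mat 1 1 Y) \<and>
              loewner_le 1 (Matrix.mat 1 1 Y) ((1 + \<alpha>) \<cdot>\<^sub>m scalar_cov v)}"
      have u: "unit_vec 1 0 \<in> carrier_vec 1" by simp
      have sc: "k \<cdot>\<^sub>m scalar_cov v = scalar_cov (k * v)" for k by (rule eq_matI) (auto simp: scalar_cov_def)
      have my: "Matrix.mat 1 1 Y = scalar_cov (Y (0, 0))" by (rule eq_matI) (auto simp: scalar_cov_def)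
      have l: "loewner_le 1 (scalar_cov ((1 - \<alpha>) * v)) (scalar_cov (Y (0, 0)))"
          "loewner_le 1 (scalar_cov (Y (0, 0))) (scalar_cov ((1 + \<alpha>) * v))"
        using Y unfolding sc mem_Collect_eq my by blast+
      have "(1 - \<alpha>) * v \<le> Y (0, 0)" "Y (0, 0) \<le> (1 + \<alpha>) * v"
        using loewner_le_form[OF l(1) u] loewner_le_form[OF l(2) u] unfolding scalar_cov_form[OF u] by simp_all
      then show "\<bar>b\<bar> - (4 * \<alpha> + 4 * b\<^sup>2) \<le> out_sign Y * b"
        unfolding v_def by (rule out_sign_correct[OF \<alpha> True])
    qed
    then show ?thesis by (simp add: b_def)
  next
    case False
    have "\<bar>b\<bar> * (1 / 3) \<le> \<bar>b\<bar> * \<bar>b\<bar>" using False by (intro mult_left_mono) auto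
    then have "\<bar>b\<bar> / 3 - (4 * \<alpha> + 4 * b\<^sup>2) \<le> - \<bar>b\<bar>" using \<alpha> by (simp add: power2_eq_square)
    also have "\<dots> = (\<integral>y. - \<bar>b\<bar> \<partial>?O)" by (simp add: O.prob_space del: One_nat_def)
    also have "\<dots> \<le> (\<integral>y. out_sign y * b \<partial>?O)"
    proof (rule integral_mono)
      show "integrable ?O (\<lambda>y. out_sign y * b)" using gm gb by (intro O.integrable_const_bound[where B="\<bar>b\<bar>"]) auto
      show "- \<bar>b\<bar> \<le> out_sign y * b" for y using gb[of y] by linarith
    qed (rule O.integrable_const)
    finally show ?thesis by (simp add: b_def)
  qed
qed

text \<open>For \<open>s = 32 \<alpha>\<close> a third of the prior mean of \<open>\<bar>b\<bar>\<close> is at least \<open>8 \<alpha>\<close>. The error terms \<open>4 \<alpha>\<close> and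
  \<open>4 s\<^sup>2 = 4096 \<alpha>\<^sup>2 \<le> 2 \<alpha>\<close> leave \<open>2 \<alpha>\<close>.\<close>

lemma sample_size_scalar:
  assumes \<alpha>: "0 < \<alpha>" "\<alpha> \<le> 1 / 2048" and \<epsilon>: "0 < \<epsilon>" "\<epsilon> \<le> 1"
    and \<delta>: "0 \<le> \<delta>" "\<delta> \<le> \<epsilon>\<^sup>2"
    and dp: "diff_private n (borel_vec 1) (borel_mat 1) \<epsilon> \<delta> M"
    and acc: "\<And>S. pos_def_mat 1 S \<Longrightarrow> 2 / 3 \<le> measure (output_law n (mvn 1 S) M)
           {Y \<in> space (borel_mat 1). loewner_le 1 ((1 - \<alpha>) \<cdot>\<^sub>m S) (Matrix.mat 1 1 Y) \<and>
              loewner_le 1 (Matrix.mat 1 1 Y) ((1 + \<alpha>) \<cdot>\<^sub>m S)}"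
  shows "1 / \<alpha>\<^sup>2 + 1 / (\<alpha> * \<epsilon>) \<le> 300000 * n"
proof -
  define s where "s = 32 * \<alpha>"
  have s: "0 < s" using \<alpha> by (simp add: s_def)
  have E1: "coeff_index 1 = {(0, 0)}" by auto
  let ?\<pi> = "\<Pi>\<^sub>M e\<in>coeff_index 1. normal_prior s"
  define A where "A = (\<lambda>B :: nat \<times> nat \<Rightarrow> real. \<bar>B (0, 0)\<bar> / 3 - (4 * \<alpha> + 4 * (B (0, 0))\<^sup>2))"
  interpret \<pi>: prob_space ?\<pi> by (intro prob_space_PiM prob_space_normal_density s)
  note comp = integrable_PiM_component[OF prob_space_normal_density[OF s, of 0], of "(0, 0)" "coeff_index 1"]
  have I1: "integrable ?\<pi> (\<lambda>B. \<bar>B (0, 0)\<bar>)" "(\<integral>B. \<bar>B (0, 0)\<bar> \<partial>?\<pi>) = s * sqrt (2 / pi)"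
    using comp[OF _ normal_prior_moments(1)[OF s]] normal_prior_moments(2)[OF s] by simp_all
  have I2: "integrable ?\<pi> (\<lambda>B. (B (0, 0))\<^sup>2)" "(\<integral>B. (B (0, 0))\<^sup>2 \<partial>?\<pi>) = s\<^sup>2"
    using comp[OF _ normal_prior_moments(3)[OF s]] normal_prior_moments(4)[OF s] by simp_all
  have IA: "integrable ?\<pi> A" unfolding A_def using I1 I2
    by (intro Bochner_Integration.integrable_diff Bochner_Integration.integrable_add integrable_mult_right integrable_divide \<pi>.integrable_const)
  have mech: "mechanism n (borel_vec 1) (borel_mat 1) M" using dp by (simp add: diff_private_def)
  have \<alpha>': "\<alpha> \<le> 1 / 2" using \<alpha> by simp
  have ac: "A B \<le> (\<integral>y. (\<Sum>e\<in>coeff_index 1. out_sign y * B e) \<partial>output_law n (reg 2 1 B) (pooled n M))" for B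
    using accuracy_scalar[OF \<alpha>(1) \<alpha>' mech acc, of B] unfolding A_def E1 by simp
  note sm = out_sign_measurable
  have du: "(\<Sum>e\<in>coeff_index 1. (out_sign y)\<^sup>2) \<le> 1" for y unfolding E1 by (simp add: out_sign_def)
  have \<epsilon>0: "0 \<le> \<epsilon>" using \<epsilon> by simp
  have dims: "2 * 1 \<le> (2 :: nat)" "1 \<le> (1 :: nat)" by simp_all
  note main = regression_lower_bound[OF dims s diff_private_pooled[OF dp \<epsilon>0 \<delta>(1)] \<epsilon>0 \<delta>(1) sm du IA ac]
  have "3 / 4 * s \<le> s * sqrt (2 / pi)" using sqrt_2_pi s by simp
  moreover have "4096 * \<alpha>\<^sup>2 \<le> 2 * \<alpha>" using mult_left_mono[OF \<alpha>(2), of \<alpha>] \<alpha> by (simp add: power2_eq_square)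
  ultimately have "2 * \<alpha> \<le> s * sqrt (2 / pi) / 3 - (4 * \<alpha> + 4 * s\<^sup>2)"
    unfolding s_def by (simp add: power_mult_distrib)
  also have "\<dots> = (\<integral>B. \<bar>B (0, 0)\<bar> / 3 \<partial>?\<pi>) - ((\<integral>B. 4 * \<alpha> \<partial>?\<pi>) + (\<integral>B. 4 * (B (0, 0))\<^sup>2 \<partial>?\<pi>))"
    using I1(2) I2(2) by (simp add: \<pi>.prob_space del: One_nat_def)
  also have "(\<integral>B. 4 * \<alpha> \<partial>?\<pi>) + (\<integral>B. 4 * (B (0, 0))\<^sup>2 \<partial>?\<pi>) = (\<integral>B. 4 * \<alpha> + 4 * (B (0, 0))\<^sup>2 \<partial>?\<pi>)"
    by (intro Bochner_Integration.integral_add[symmetric] \<pi>.integrable_const integrable_mult_right I2(1))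
  also have "(\<integral>B. \<bar>B (0, 0)\<bar> / 3 \<partial>?\<pi>) - (\<integral>B. 4 * \<alpha> + 4 * (B (0, 0))\<^sup>2 \<partial>?\<pi>) = (\<integral>B. A B \<partial>?\<pi>)"
    unfolding A_def
    by (intro Bochner_Integration.integral_diff[symmetric] Bochner_Integration.integrable_add
        \<pi>.integrable_const integrable_mult_right integrable_divide I1(1) I2(1))
  finally have low: "2 * \<alpha> \<le> (\<integral>B. A B \<partial>?\<pi>)" .
  have s2: "s\<^sup>2 = 1024 * \<alpha>\<^sup>2" by (simp add: s_def power_mult_distrib)
  have "\<epsilon>\<^sup>2 \<le> \<epsilon>" using mult_left_le[of \<epsilon> \<epsilon>] \<epsilon> by (simp add: power2_eq_square)
  then have "(exp \<epsilon> - 1) + 2 * \<delta> \<le> 4 * \<epsilon>" using exp_minus_one_le[of \<epsilon>] \<epsilon> \<delta> by simp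
  then have "s\<^sup>2 * (n * ((exp \<epsilon> - 1) + 2 * \<delta>)) \<le> s\<^sup>2 * (n * (4 * \<epsilon>))" by (intro mult_left_mono) auto
  moreover have "2 * \<alpha> \<le> s\<^sup>2 * (n * ((exp \<epsilon> - 1) + 2 * \<delta>))"
    using order_trans[OF low main(1)] by (simp only: of_nat_1 mult_1_right)
  ultimately have "2 * \<alpha> \<le> 1024 * \<alpha>\<^sup>2 * (n * (4 * \<epsilon>))" unfolding s2 by linarith
  then have b1: "1 \<le> 2048 * (\<alpha> * \<epsilon>) * n" using \<alpha> by (simp add: power2_eq_square algebra_simps)
  have "2 * \<alpha> \<le> 1024 * \<alpha>\<^sup>2 * sqrt n" 
    using order_trans[OF low main(2)] unfolding s2 by (simp only: of_nat_1 mult_1_right)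
  then have "1 \<le> 512 * \<alpha> * sqrt n" using \<alpha> by (simp add: power2_eq_square)
  then have "1 * 1 \<le> (512 * \<alpha> * sqrt n) * (512 * \<alpha> * sqrt n)" using \<alpha> by (intro mult_mono) auto
  also have "\<dots> = 262144 * \<alpha>\<^sup>2 * (sqrt n * sqrt n)" by (simp add: power2_eq_square mult_ac)
  finally have b2: "1 \<le> 262144 * \<alpha>\<^sup>2 * n" by simp
  have "1 / (\<alpha> * \<epsilon>) \<le> 2048 * n" using b1 \<alpha> \<epsilon> by (simp add: field_simps)
  moreover have "1 / \<alpha>\<^sup>2 \<le> 262144 * n" using b2 \<alpha> by (simp add: field_simps)
  ultimately show ?thesis by simp
qed

theorem theorem4p1:
  shows "\<exists>c4 c C :: real. 0 < c4 \<and> c4 < 1 \<and> 0 < c \<and> 0 < C \<and>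
    (\<forall>(d::nat) (n::nat) (\<alpha>::real) (\<epsilon>::real) (\<delta>::real)
        (M :: (nat \<Rightarrow> nat \<Rightarrow> real) \<Rightarrow> (nat \<times> nat \<Rightarrow> real) measure).
      1 \<le> d \<longrightarrow> 1 \<le> n \<longrightarrow>
      0 < \<alpha> \<longrightarrow> \<alpha> \<le> c4 \<longrightarrow> 0 < \<epsilon> \<longrightarrow> \<epsilon> \<le> 1 \<longrightarrow> 0 \<le> \<delta> \<longrightarrow> \<delta> \<le> \<epsilon>\<^sup>2 / (real d)\<^sup>2 \<longrightarrow>
      diff_private n (borel_vec d) (borel_mat d) \<epsilon> \<delta> M \<longrightarrow>
      (\<forall>\<Sigma>. pos_def_mat d \<Sigma> \<longrightarrow>
         measure (output_law n (mvn d \<Sigma>) M)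
           {Y \<in> space (borel_mat d).
              loewner_le d ((1 - \<alpha>) \<cdot>\<^sub>m \<Sigma>) (Matrix.mat d d Y) \<and>
              loewner_le d (Matrix.mat d d Y) ((1 + \<alpha>) \<cdot>\<^sub>m \<Sigma>)} \<ge> 2 / 3) \<longrightarrow>
      real n \<ge> c / ln (2 + real d / (\<alpha> * \<epsilon>)) powr C *
                 (real d / \<alpha>\<^sup>2 + real d powr (3 / 2) / (\<alpha> * \<epsilon>)))"
proof (rule exI[of _ "1 / 2048"], rule exI[of _ "1 / 600000"], rule exI[of _ 1], intro conjI allI impI)
  fix d n :: nat and \<alpha> \<epsilon> \<delta> :: real and M :: "(nat \<Rightarrow> nat \<Rightarrow> real) \<Rightarrow> (nat \<times> nat \<Rightarrow> real) measure"
  assume d: "1 \<le> d" and \<alpha>: "0 < \<alpha>" "\<alpha> \<le> 1 / 2048" and \<epsilon>: "0 < \<epsilon>" "\<epsilon> \<le> 1"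
    and \<delta>: "0 \<le> \<delta>" "\<delta> \<le> \<epsilon>\<^sup>2 / (real d)\<^sup>2" and dp: "diff_private n (borel_vec d) (borel_mat d) \<epsilon> \<delta> M"
    and acc: "\<forall>\<Sigma>. pos_def_mat d \<Sigma> \<longrightarrow>
         measure (output_law n (mvn d \<Sigma>) M)
           {Y \<in> space (borel_mat d).
              loewner_le d ((1 - \<alpha>) \<cdot>\<^sub>m \<Sigma>) (Matrix.mat d d Y) \<and>
              loewner_le d (Matrix.mat d d Y) ((1 + \<alpha>) \<cdot>\<^sub>m \<Sigma>)} \<ge> 2 / 3"
  \<comment> \<open>With exponent 1 the logarithm only costs the factor \<open>1 / ln 2 \<le> 2\<close>.\<close>
  let ?S = "real d / \<alpha>\<^sup>2 + real d powr (3 / 2) / (\<alpha> * \<epsilon>)"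
  have main: "?S \<le> 300000 * n"
  proof (cases "d = 1")
    case True
    have "1 / \<alpha>\<^sup>2 + 1 / (\<alpha> * \<epsilon>) \<le> 300000 * n"
      by (rule sample_size_scalar[OF \<alpha> \<epsilon> \<delta>(1)]) (use \<delta> dp acc True in auto)
    then show ?thesis using True by simp
  next
    case False
    then have "2 \<le> d" using d by simp
    then show ?thesis using sample_size_multivariate[OF _ \<alpha> \<epsilon> \<delta> dp] acc by blast
  qed
  have S: "0 \<le> ?S" using \<alpha> \<epsilon> by simp
  have "1 / 2 \<le> ln (2 :: real)" using ln2_ge_two_thirds by simp
  also have "\<dots> \<le> ln (2 + real d / (\<alpha> * \<epsilon>))" using \<alpha> \<epsilon> by (intro ln_mono) auto
  finally have l: "1 / 2 \<le> ln (2 + real d / (\<alpha> * \<epsilon>))" .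
  then have "1 / 600000 / ln (2 + real d / (\<alpha> * \<epsilon>)) powr 1 \<le> 1 / 300000" by (simp add: field_simps)
  then have "1 / 600000 / ln (2 + real d / (\<alpha> * \<epsilon>)) powr 1 * ?S \<le> 1 / 300000 * ?S"
    using S by (rule mult_right_mono)
  also have "\<dots> \<le> n" using main by simp
  finally show "1 / 600000 / ln (2 + real d / (\<alpha> * \<epsilon>)) powr 1 * ?S \<le> n" .
qed simp_all

end
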